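(* Let $n>2$ and let $(G \rightrightarrows M , \Pi)$ be a Nambu-Lie groupoid of order $n$ with associated weak Lie-Filippov bialgebroid $(AG, A^*G)$. Then the induced Nambu structures on $M$ coming from the Nambu-Lie groupoid and from the weak Lie-Filippov bialgebroid are related by $$\{ \cdot, \ldots, \cdot\}_M = (-1)^{n-1}\{ \cdot, \ldots, \cdot\}_{(AG, A^*G)} .$$
   Context: **Nambu-Poisson structures.** A Nambu-Poisson structure (Nambu structure) of order $n$ on a smooth manifold $P$ is a skew-symmetric $n$-multilinear bracket on $C^\infty(P)$ satisfying the Leibniz rule $\{f_1,\ldots,f_{n-1},fg\}=f\{f_1,\ldots,f_{n-1},g\}+\{f_1,\ldots,f_{n-1},f\}g$ and the Fundamental identity $\{f_1,\ldots,f_{n-1},\{g_1,\ldots,g_n\}\}=\sum_{k=1}^n\{g_1,\ldots,g_{k-1},\{f_1,\ldots,f_{n-1},g_k\},\ldots,g_n\}$. It is given by an $n$-vector field $\Pi$ (the Nambu tensor) via $\{f_1,\ldots,f_n\}=\Pi(df_1,\ldots,df_n)$, and $\Pi^\sharp:\bigwedge^{n-1}T^*P\to TP$ is given by $\langle\beta,\Pi^\sharp(\alpha_1\wedge\cdots\wedge\alpha_{n-1})\rangle=\Pi(\alpha_1,\ldots,\alpha_{n-1},\beta)$. A submanifold $C\hookrightarrow P$ is coisotropic with respect to an $n$-vector field $\Pi$ if $\Pi_x(\alpha_1,\ldots,\alpha_n)=0$ for all $x\in C$ and $\alpha_i\in(TC)^0_x=\{\alpha\in T^*_xP:\alpha|_{T_xC}=0\}$.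 **Nambu-Lie groupoids.** $G\rightrightarrows M$ is a Lie groupoid with source $\alpha$ and target $\beta$; $gh$ is defined when $\beta(g)=\alpha(h)$; $M\subset G$ via the unit map. An $n$-vector field $\Pi$ on $G$ is multiplicative if $\{(g,h,gh):\beta(g)=\alpha(h)\}$ is coisotropic in $G\times G\times G$ with respect to $\Pi\oplus\Pi\oplus(-1)^{n-1}\Pi$. A Nambu-Lie groupoid of order $n$ is a Lie groupoid with a multiplicative Nambu tensor $\Pi$ of order $n$ on $G$. **Structure $\{\cdot,\ldots,\cdot\}_M$.** This is the unique Nambu-Poisson structure of order $n$ on $M$ for which $\alpha$ is a Nambu-Poisson map, i.e. $\{\alpha^*f_1,\ldots,\alpha^*f_n\}_G=\alpha^*\{f_1,\ldots,f_n\}_M$; for it, $\beta$ is anti Nambu-Poisson, i.e. $\{\beta^*f_1,\ldots,\beta^*f_n\}_G=(-1)^{n-1}\beta^*\{f_1,\ldots,f_n\}_M$. **Structure $\{\cdot,\ldots,\cdot\}_{(AG,A^*G)}$.** $AG\to M$ is the Lie algebroid of $G$: the fibre at $x$ is the tangent space at the unit $\epsilon_x$ of $\alpha^{-1}(x)$, the bracket comes from left-invariant vector fields, the anchor is $a=d\beta|_{AG}$. As $TG|_M=TM\oplus AG$, the dual $A^*G$ is identified with the conormal bundle $(TM)^0$ of $M$ in $G$. The pair $(AG,A^*G)$ is a weak Lie-Filippov bialgebroid of order $n$, whose anchor is $\rho=\Pi^\sharp|_{\bigwedge^{n-1}(TM)^0}:\bigwedge^{n-1}A^*G\to TM$ (well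 defined because $M$ is coisotropic in $G$). With $d_A f\in\Gamma A^*G$ given by $\langle d_Af,X\rangle=a(X)f$, the induced Nambu-Poisson structure of order $n$ on $M$ is $$\{f_1,\ldots,f_n\}_{(AG,A^*G)}=\rho(d_Af_1\wedge\cdots\wedge d_Af_{n-1})f_n .$$ *)

theory Defs
  imports "HOL-Analysis.Analysis"
begin

section \<open>Smooth manifolds\<close>

primrec Ck_on :: "nat \<Rightarrow> 'a::real_normed_vector set \<Rightarrow> ('a \<Rightarrow> 'b::real_normed_vector) \<Rightarrow> bool" where
  "Ck_on 0 S f \<longleftrightarrow> continuous_on S f"
| "Ck_on (Suc k) S f \<longleftrightarrow> (\<forall>x\<in>S. f differentiable (at x)) \<and>
     (\<forall>v. Ck_on k S (\<lambda>x. frechet_derivative f (at x) v))"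

text \<open>Used only for open \<open>S\<close> in finite-dimensional spaces, where this is the usual notion.\<close>

definition smooth_on :: "'a::real_normed_vector set \<Rightarrow> ('a \<Rightarrow> 'b::real_normed_vector) \<Rightarrow> bool" where
  "smooth_on S f \<longleftrightarrow> (\<forall>k. Ck_on k S f)"

type_synonym ('p, 'e) atlas = "('p set \<times> ('p \<Rightarrow> 'e)) set"

text \<open>A manifold is a whole type \<open>'p\<close> together with an atlas of charts \<open>(U, \<phi>)\<close>; the values of
  \<open>\<phi>\<close> outside \<open>U\<close> are irrelevant. The model space is any finite-dimensional normed space
  rather than an instance of \<^class>\<open>euclidean_space\<close>, because the latter excludes dimension
  \<open>0\<close>, hence Lie groups as groupoids over a point.\<close>

definition smooth_manifold ::
    "('p::{t2_space, second_countable_topology}, 'e::real_normed_vector) atlas \<Rightarrow> bool" where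
  "smooth_manifold A \<longleftrightarrow>
     (\<exists>B::'e set. finite B \<and> span B = UNIV) \<and>
     (\<Union>(U, \<phi>)\<in>A. U) = UNIV \<and>
     (\<forall>(U, \<phi>)\<in>A. open U \<and> open (\<phi> ` U) \<and> homeomorphism U (\<phi> ` U) \<phi> (inv_into U \<phi>)) \<and>
     (\<forall>(U, \<phi>)\<in>A. \<forall>(V, \<psi>)\<in>A. smooth_on (\<phi> ` (U \<inter> V)) (\<psi> \<circ> inv_into U \<phi>))"

definition std_atlas :: "('e, 'e) atlas" where
  "std_atlas = {(UNIV, \<lambda>x. x)}"

definition prod_atlas :: "('p, 'e) atlas \<Rightarrow> ('q, 'f) atlas \<Rightarrow> ('p \<times> 'q, 'e \<times> 'f) atlas" where
  "prod_atlas A B = {(U \<times> V, map_prod \<phi> \<psi>) | U \<phi> V \<psi>. (U, \<phi>) \<in> A \<and> (V, \<psi>) \<in> B}"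

text \<open>Smoothness of \<open>F\<close> on an open set \<open>W\<close>.\<close>

definition smooth_map :: "('p::topological_space, 'e::real_normed_vector) atlas \<Rightarrow>
    ('q::topological_space, 'f::real_normed_vector) atlas \<Rightarrow> 'p set \<Rightarrow> ('p \<Rightarrow> 'q) \<Rightarrow> bool" where
  "smooth_map A B W F \<longleftrightarrow> open W \<and> continuous_on W F \<and>
     (\<forall>(U, \<phi>)\<in>A. \<forall>(V, \<psi>)\<in>B. smooth_on (\<phi> ` (U \<inter> W \<inter> F -` V)) (\<psi> \<circ> F \<circ> inv_into U \<phi>))"

text \<open>Smoothness on an arbitrary subset, by local extension; for embedded submanifolds (such as
  the composable pairs of a Lie groupoid) this is smoothness for the submanifold structure.\<close>

definition smooth_map_on_subset :: "('p::topological_space, 'e::real_normed_vector) atlas \<Rightarrow>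
    ('q::topological_space, 'f::real_normed_vector) atlas \<Rightarrow> 'p set \<Rightarrow> ('p \<Rightarrow> 'q) \<Rightarrow> bool" where
  "smooth_map_on_subset A B S F \<longleftrightarrow>
     (\<forall>x\<in>S. \<exists>W F'. x \<in> W \<and> smooth_map A B W F' \<and> (\<forall>y\<in>W \<inter> S. F' y = F y))"

definition smooth_functions ::
    "('p::topological_space, 'e::real_normed_vector) atlas \<Rightarrow> ('p \<Rightarrow> real) set" where
  "smooth_functions A = {f. smooth_map A std_atlas UNIV f}"

definition smooth_near ::
    "('p::topological_space, 'e::real_normed_vector) atlas \<Rightarrow> 'p \<Rightarrow> ('p \<Rightarrow> real) \<Rightarrow> bool" where
  "smooth_near A x f \<longleftrightarrow> (\<exists>W. x \<in> W \<and> smooth_map A std_atlas W f)"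


section \<open>Tangent and cotangent spaces\<close>

text \<open>The tangent vector \<open>\<gamma>'(0)\<close> of a curve is encoded by the directional derivative it induces on
  the functions smooth near the base point. It is set to \<open>0\<close> on all other functions, so that
  equality of tangent vectors is equality of HOL functions.\<close>

type_synonym 'p tvec = "('p \<Rightarrow> real) \<Rightarrow> real"
type_synonym 'p cvec = "'p tvec \<Rightarrow> real"

definition curves_in :: "('p::topological_space, 'e::real_normed_vector) atlas \<Rightarrow> 'p set \<Rightarrow> 'p \<Rightarrow>
    (real \<Rightarrow> 'p) set" where
  "curves_in A C x = {\<gamma>. \<gamma> 0 = x \<and>
     (\<exists>r>0. smooth_map std_atlas A {-r<..<r} \<gamma> \<and> \<gamma> ` {-r<..<r} \<subseteq> C)}"

definition velocity :: "('p::topological_space, 'e::real_normed_vector) atlas \<Rightarrow> (real \<Rightarrow> 'p) \<Rightarrow>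
    'p tvec" where
  "velocity A \<gamma> = (\<lambda>f. if smooth_near A (\<gamma> 0) f then deriv (\<lambda>t. f (\<gamma> t)) 0 else 0)"

text \<open>\<open>tangent_space A C x\<close> is \<open>T\<^sub>xC \<subseteq> T\<^sub>xP\<close> for a submanifold \<open>C\<close> of the manifold \<open>P\<close> with atlas
  \<open>A\<close>; the tangent space of \<open>P\<close> itself is the case \<open>C = UNIV\<close>.\<close>

definition tangent_space :: "('p::topological_space, 'e::real_normed_vector) atlas \<Rightarrow> 'p set \<Rightarrow> 'p \<Rightarrow>
    'p tvec set" where
  "tangent_space A C x = velocity A ` curves_in A C x"

definition differential :: "('q::topological_space, 'f::real_normed_vector) atlas \<Rightarrow> ('p \<Rightarrow> 'q) \<Rightarrow>
    'p \<Rightarrow> 'p tvec \<Rightarrow> 'q tvec" where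
  "differential B F x v = (\<lambda>f. if smooth_near B (F x) f then v (f \<circ> F) else 0)"

text \<open>Covectors are extended by \<open>0\<close> outside the tangent space, again to make equality meaningful.\<close>

definition cotangent_space :: "('p::topological_space, 'e::real_normed_vector) atlas \<Rightarrow> 'p \<Rightarrow>
    'p cvec set" where
  "cotangent_space A x = {\<omega>.
     (\<forall>u\<in>tangent_space A UNIV x. \<forall>v\<in>tangent_space A UNIV x. \<forall>a b.
        \<omega> (\<lambda>f. a * u f + b * v f) = a * \<omega> u + b * \<omega> v) \<and>
     (\<forall>v. v \<notin> tangent_space A UNIV x \<longrightarrow> \<omega> v = 0)}"

definition ext_d :: "('p::topological_space, 'e::real_normed_vector) atlas \<Rightarrow> ('p \<Rightarrow> real) \<Rightarrow> 'p \<Rightarrow>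
    'p cvec" where
  "ext_d A f x = (\<lambda>v. if v \<in> tangent_space A UNIV x then v f else 0)"

definition pullback :: "('p::topological_space, 'e::real_normed_vector) atlas \<Rightarrow>
    ('q::topological_space, 'f::real_normed_vector) atlas \<Rightarrow> ('p \<Rightarrow> 'q) \<Rightarrow> 'p \<Rightarrow> 'q cvec \<Rightarrow>
    'p cvec" where
  "pullback A B F x \<omega> =
     (\<lambda>v. if v \<in> tangent_space A UNIV x then \<omega> (differential B F x v) else 0)"

definition conormal_space :: "('p::topological_space, 'e::real_normed_vector) atlas \<Rightarrow> 'p set \<Rightarrow> 'p \<Rightarrow>
    'p cvec set" where
  "conormal_space A C x = {\<omega> \<in> cotangent_space A x. \<forall>v\<in>tangent_space A C x. \<omega> v = 0}"


section \<open>Multivector fields\<close>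

text \<open>\<open>\<Lambda>\<^sup>nT\<^sub>xP\<close> is identified with the skew-symmetric \<open>n\<close>-linear forms on \<open>T\<^sub>x\<^sup>*P\<close>; the arguments
  are given as a list of length \<open>n\<close>.\<close>

definition multivector :: "('p::topological_space, 'e::real_normed_vector) atlas \<Rightarrow> nat \<Rightarrow> 'p \<Rightarrow>
    ('p cvec list \<Rightarrow> real) \<Rightarrow> bool" where
  "multivector A n x \<Lambda> \<longleftrightarrow>
     (\<forall>\<omega>s. length \<omega>s = n \<and> set \<omega>s \<subseteq> cotangent_space A x \<longrightarrow>
        (\<forall>i<n. \<forall>\<xi>\<in>cotangent_space A x. \<forall>\<eta>\<in>cotangent_space A x. \<forall>a b.
           \<Lambda> (\<omega>s[i := (\<lambda>v. a * \<xi> v + b * \<eta> v)]) = a * \<Lambda> (\<omega>s[i := \<xi>]) + b * \<Lambda> (\<omega>s[i := \<eta>])) \<and>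
        (\<forall>i<n. \<forall>j<n. i \<noteq> j \<longrightarrow> \<Lambda> (\<omega>s[i := \<omega>s ! j, j := \<omega>s ! i]) = - \<Lambda> \<omega>s))"

definition multivector_field :: "('p::topological_space, 'e::real_normed_vector) atlas \<Rightarrow> nat \<Rightarrow>
    ('p \<Rightarrow> 'p cvec list \<Rightarrow> real) \<Rightarrow> bool" where
  "multivector_field A n N \<longleftrightarrow>
     (\<forall>x. multivector A n x (N x)) \<and>
     (\<forall>W fs. length fs = n \<and> (\<forall>f\<in>set fs. smooth_map A std_atlas W f) \<and> open W \<longrightarrow>
        smooth_map A std_atlas W (\<lambda>x. N x (map (\<lambda>f. ext_d A f x) fs)))"

definition sharp :: "('p::topological_space, 'e::real_normed_vector) atlas \<Rightarrow>
    ('p \<Rightarrow> 'p cvec list \<Rightarrow> real) \<Rightarrow> 'p \<Rightarrow> 'p cvec list \<Rightarrow> 'p tvec" where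
  "sharp A N x \<omega>s = (THE v. v \<in> tangent_space A UNIV x \<and>
     (\<forall>\<beta>\<in>cotangent_space A x. \<beta> v = N x (\<omega>s @ [\<beta>])))"

definition coisotropic :: "('p::topological_space, 'e::real_normed_vector) atlas \<Rightarrow> nat \<Rightarrow>
    ('p \<Rightarrow> 'p cvec list \<Rightarrow> real) \<Rightarrow> 'p set \<Rightarrow> bool" where
  "coisotropic A n N C \<longleftrightarrow>
     (\<forall>x\<in>C. \<forall>\<omega>s. length \<omega>s = n \<and> set \<omega>s \<subseteq> conormal_space A C x \<longrightarrow> N x \<omega>s = 0)"

text \<open>\<open>N \<oplus> N'\<close> at \<open>(x, y)\<close> is the sum of the push-forwards of \<open>N x\<close> and \<open>N' y\<close> along the inclusions
  \<open>p \<mapsto> (p, y)\<close> and \<open>q \<mapsto> (x, q)\<close>.\<close>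

definition multivector_oplus :: "('p::topological_space, 'e::real_normed_vector) atlas \<Rightarrow>
    ('q::topological_space, 'f::real_normed_vector) atlas \<Rightarrow>
    ('p \<Rightarrow> 'p cvec list \<Rightarrow> real) \<Rightarrow> ('q \<Rightarrow> 'q cvec list \<Rightarrow> real) \<Rightarrow>
    'p \<times> 'q \<Rightarrow> ('p \<times> 'q) cvec list \<Rightarrow> real" where
  "multivector_oplus A B N N' = (\<lambda>(x, y) \<omega>s.
     N x (map (pullback A (prod_atlas A B) (\<lambda>p. (p, y)) x) \<omega>s) +
     N' y (map (pullback B (prod_atlas A B) (\<lambda>q. (x, q)) y) \<omega>s))"


section \<open>Nambu-Poisson structures\<close>

definition smooth_tuples :: "('p::topological_space, 'e::real_normed_vector) atlas \<Rightarrow> nat \<Rightarrow>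
    ('p \<Rightarrow> real) list set" where
  "smooth_tuples A n = {fs. length fs = n \<and> set fs \<subseteq> smooth_functions A}"

definition nambu_poisson :: "('p::topological_space, 'e::real_normed_vector) atlas \<Rightarrow> nat \<Rightarrow>
    (('p \<Rightarrow> real) list \<Rightarrow> 'p \<Rightarrow> real) \<Rightarrow> bool" where
  "nambu_poisson A n br \<longleftrightarrow>
     (\<forall>fs\<in>smooth_tuples A n. br fs \<in> smooth_functions A) \<and>
     (\<forall>fs\<in>smooth_tuples A n. \<forall>i<n. \<forall>j<n. i \<noteq> j \<longrightarrow>
        br (fs[i := fs ! j, j := fs ! i]) = (\<lambda>x. - br fs x)) \<and>
     (\<forall>fs\<in>smooth_tuples A n. \<forall>i<n. \<forall>f\<in>smooth_functions A. \<forall>g\<in>smooth_functions A. \<forall>a b.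
        br (fs[i := (\<lambda>x. a * f x + b * g x)]) = (\<lambda>x. a * br (fs[i := f]) x + b * br (fs[i := g]) x)) \<and>
     (\<forall>fs\<in>smooth_tuples A (n - 1). \<forall>f\<in>smooth_functions A. \<forall>g\<in>smooth_functions A.
        br (fs @ [\<lambda>x. f x * g x]) = (\<lambda>x. f x * br (fs @ [g]) x + br (fs @ [f]) x * g x)) \<and>
     (\<forall>fs\<in>smooth_tuples A (n - 1). \<forall>gs\<in>smooth_tuples A n.
        br (fs @ [br gs]) = (\<lambda>x. \<Sum>k<n. br (gs[k := br (fs @ [gs ! k])]) x))"

definition tensor_bracket :: "('p::topological_space, 'e::real_normed_vector) atlas \<Rightarrow>
    ('p \<Rightarrow> 'p cvec list \<Rightarrow> real) \<Rightarrow> ('p \<Rightarrow> real) list \<Rightarrow> 'p \<Rightarrow> real" where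
  "tensor_bracket A N fs x = N x (map (\<lambda>f. ext_d A f x) fs)"

definition nambu_tensor :: "('p::topological_space, 'e::real_normed_vector) atlas \<Rightarrow> nat \<Rightarrow>
    ('p \<Rightarrow> 'p cvec list \<Rightarrow> real) \<Rightarrow> bool" where
  "nambu_tensor A n N \<longleftrightarrow> multivector_field A n N \<and> nambu_poisson A n (tensor_bracket A N)"

definition nambu_poisson_map :: "('q::topological_space, 'f::real_normed_vector) atlas \<Rightarrow> nat \<Rightarrow>
    (('p \<Rightarrow> real) list \<Rightarrow> 'p \<Rightarrow> real) \<Rightarrow> (('q \<Rightarrow> real) list \<Rightarrow> 'q \<Rightarrow> real) \<Rightarrow> ('p \<Rightarrow> 'q) \<Rightarrow> bool" where
  "nambu_poisson_map B n brP brQ F \<longleftrightarrow>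
     (\<forall>fs\<in>smooth_tuples B n. brP (map (\<lambda>f. f \<circ> F) fs) = brQ fs \<circ> F)"


section \<open>Nambu-Lie groupoids\<close>

record ('g, 'a, 'm, 'b) groupoid_data =
  arr :: "('g, 'a) atlas"
  obj :: "('m, 'b) atlas"
  src :: "'g \<Rightarrow> 'm"
  tgt :: "'g \<Rightarrow> 'm"
  unt :: "'m \<Rightarrow> 'g"
  mul :: "'g \<Rightarrow> 'g \<Rightarrow> 'g"
  ivs :: "'g \<Rightarrow> 'g"

definition groupoid_axioms :: "('g, 'a, 'm, 'b) groupoid_data \<Rightarrow> bool" where
  "groupoid_axioms G \<longleftrightarrow>
     (\<forall>x. src G (unt G x) = x \<and> tgt G (unt G x) = x) \<and>
     (\<forall>g h. tgt G g = src G h \<longrightarrow> src G (mul G g h) = src G g \<and> tgt G (mul G g h) = tgt G h) \<and>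
     (\<forall>g h k. tgt G g = src G h \<and> tgt G h = src G k \<longrightarrow>
        mul G (mul G g h) k = mul G g (mul G h k)) \<and>
     (\<forall>g. mul G (unt G (src G g)) g = g \<and> mul G g (unt G (tgt G g)) = g) \<and>
     (\<forall>g. src G (ivs G g) = tgt G g \<and> tgt G (ivs G g) = src G g \<and>
        mul G g (ivs G g) = unt G (src G g) \<and> mul G (ivs G g) g = unt G (tgt G g))"

definition submersion :: "('p::topological_space, 'e::real_normed_vector) atlas \<Rightarrow>
    ('q::topological_space, 'f::real_normed_vector) atlas \<Rightarrow> ('p \<Rightarrow> 'q) \<Rightarrow> bool" where
  "submersion A B F \<longleftrightarrow> smooth_map A B UNIV F \<and>
     (\<forall>x. differential B F x ` tangent_space A UNIV x = tangent_space B UNIV (F x))"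

definition lie_groupoid ::
    "('g::{t2_space, second_countable_topology}, 'a::real_normed_vector,
      'm::{t2_space, second_countable_topology}, 'b::real_normed_vector) groupoid_data \<Rightarrow> bool" where
  "lie_groupoid G \<longleftrightarrow>
     smooth_manifold (arr G) \<and> smooth_manifold (obj G) \<and> groupoid_axioms G \<and>
     surj (src G) \<and> submersion (arr G) (obj G) (src G) \<and>
     surj (tgt G) \<and> submersion (arr G) (obj G) (tgt G) \<and>
     smooth_map (obj G) (arr G) UNIV (unt G) \<and>
     smooth_map (arr G) (arr G) UNIV (ivs G) \<and>
     smooth_map_on_subset (prod_atlas (arr G) (arr G)) (arr G)
       {(g, h). tgt G g = src G h} (\<lambda>(g, h). mul G g h)"

definition multiplicative :: "nat \<Rightarrow>
    ('g::topological_space, 'a::real_normed_vector, 'm, 'b) groupoid_data \<Rightarrow>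
    ('g \<Rightarrow> 'g cvec list \<Rightarrow> real) \<Rightarrow> bool" where
  "multiplicative n G N \<longleftrightarrow>
     coisotropic (prod_atlas (arr G) (prod_atlas (arr G) (arr G))) n
       (multivector_oplus (arr G) (prod_atlas (arr G) (arr G)) N
          (multivector_oplus (arr G) (arr G) N (\<lambda>x \<omega>s. (-1) ^ (n - 1) * N x \<omega>s)))
       {(g, h, mul G g h) | g h. tgt G g = src G h}"

definition nambu_lie_groupoid :: "nat \<Rightarrow>
    ('g::{t2_space, second_countable_topology}, 'a::real_normed_vector,
     'm::{t2_space, second_countable_topology}, 'b::real_normed_vector) groupoid_data \<Rightarrow>
    ('g \<Rightarrow> 'g cvec list \<Rightarrow> real) \<Rightarrow> bool" where
  "nambu_lie_groupoid n G N \<longleftrightarrow>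
     lie_groupoid G \<and> nambu_tensor (arr G) n N \<and> multiplicative n G N"

text \<open>The bracket \<open>{\<cdot>,\<dots>,\<cdot>}\<^sub>M\<close>. Extensionality only normalises the values on lists that are not
  \<open>n\<close>-tuples of smooth functions, so that the structure is unique as a HOL function.\<close>

definition base_bracket :: "nat \<Rightarrow>
    ('g::topological_space, 'a::real_normed_vector,
     'm::topological_space, 'b::real_normed_vector) groupoid_data \<Rightarrow>
    ('g \<Rightarrow> 'g cvec list \<Rightarrow> real) \<Rightarrow> ('m \<Rightarrow> real) list \<Rightarrow> 'm \<Rightarrow> real" where
  "base_bracket n G N = (THE br. br \<in> extensional (smooth_tuples (obj G) n) \<and>
     nambu_poisson (obj G) n br \<and>
     nambu_poisson_map (obj G) n (tensor_bracket (arr G) N) br (src G))"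


section \<open>The bracket of the weak Lie-Filippov bialgebroid\<close>

definition algebroid_fibre :: "('g::topological_space, 'a::real_normed_vector, 'm, 'b) groupoid_data \<Rightarrow>
    'm \<Rightarrow> 'g tvec set" where
  "algebroid_fibre G x = tangent_space (arr G) (src G -` {x}) (unt G x)"

definition algebroid_anchor :: "('g, 'a, 'm::topological_space, 'b::real_normed_vector) groupoid_data \<Rightarrow>
    'm \<Rightarrow> 'g tvec \<Rightarrow> 'm tvec" where
  "algebroid_anchor G x = differential (obj G) (tgt G) (unt G x)"

definition d_A :: "('g::topological_space, 'a::real_normed_vector,
     'm::topological_space, 'b::real_normed_vector) groupoid_data \<Rightarrow>
    ('m \<Rightarrow> real) \<Rightarrow> 'm \<Rightarrow> 'g cvec" where
  "d_A G f x = (\<lambda>X. if X \<in> algebroid_fibre G x then algebroid_anchor G x X f else 0)"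

text \<open>The isomorphism \<open>A\<^sup>*G \<rightarrow> (TM)\<^sup>0\<close> coming from \<open>TG|\<^sub>M = TM \<oplus> AG\<close>: extension of a functional on
  \<open>A\<^sub>xG\<close> by \<open>0\<close> on \<open>T\<^sub>xM\<close>.\<close>

definition to_conormal :: "('g::topological_space, 'a::real_normed_vector, 'm, 'b) groupoid_data \<Rightarrow>
    'm \<Rightarrow> 'g cvec \<Rightarrow> 'g cvec" where
  "to_conormal G x \<xi> = (THE \<omega>. \<omega> \<in> conormal_space (arr G) (range (unt G)) (unt G x) \<and>
     (\<forall>X\<in>algebroid_fibre G x. \<omega> X = \<xi> X))"

text \<open>The map \<open>\<rho>\<close> on \<open>\<omega>\<^sub>1 \<and> \<dots> \<and> \<omega>\<^sub>n\<^sub>-\<^sub>1\<close>, with \<open>T\<^sub>xM\<close> regarded as a subspace of the tangent space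
  of \<open>G\<close> at the unit by means of the differential of the unit map.\<close>

definition bialgebroid_anchor :: "('g::topological_space, 'a::real_normed_vector,
     'm::topological_space, 'b::real_normed_vector) groupoid_data \<Rightarrow>
    ('g \<Rightarrow> 'g cvec list \<Rightarrow> real) \<Rightarrow> 'm \<Rightarrow> 'g cvec list \<Rightarrow> 'm tvec" where
  "bialgebroid_anchor G N x \<omega>s = (THE v. v \<in> tangent_space (obj G) UNIV x \<and>
     differential (arr G) (unt G) x v = sharp (arr G) N (unt G x) \<omega>s)"

definition bialgebroid_bracket :: "('g::topological_space, 'a::real_normed_vector,
     'm::topological_space, 'b::real_normed_vector) groupoid_data \<Rightarrow>
    ('g \<Rightarrow> 'g cvec list \<Rightarrow> real) \<Rightarrow> ('m \<Rightarrow> real) list \<Rightarrow> 'm \<Rightarrow> real" where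
  "bialgebroid_bracket G N fs x =
     bialgebroid_anchor G N x (map (\<lambda>f. to_conormal G x (d_A G f x)) (butlast fs)) (last fs)"

end

theory Submission
  imports Defs
begin

text \<open>Write \<open>\<alpha>\<close>, \<open>\<beta>\<close>, \<open>\<epsilon>\<close> for source, target and unit map, and \<open>e = \<epsilon>(x)\<close>. Everything follows from
  feeding the multiplicativity of \<open>\<Pi>\<close> with differentials of functions
  \<open>(g, h, k) \<mapsto> a(g) + b(h) + c(k)\<close> whose derivative vanishes along the graph of the multiplication:
  for \<open>n\<close> such triples \<open>(a\<^sub>i, b\<^sub>i, c\<^sub>i)\<close> coisotropy says
  \<open>\<Pi>\<^sub>g(da) + \<Pi>\<^sub>h(db) + (-1)\<^sup>n\<^sup>-\<^sup>1 \<Pi>\<^sub>g\<^sub>h(dc) = 0\<close> (lemma \<open>multiplicative_on_functions\<close>).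

  \<^item> The triples \<open>(\<alpha>\<^sup>*f\<^sub>i, 0, -\<alpha>\<^sup>*f\<^sub>i)\<close> at \<open>(g, g\<inverse>)\<close> show that \<open>{\<alpha>\<^sup>*f\<^sub>1, \<dots>, \<alpha>\<^sup>*f\<^sub>n}\<close> takes the same value at
    \<open>g\<close> and at \<open>\<epsilon>(\<alpha>(g))\<close>. So it descends to \<open>M\<close>, and \<open>{f\<^sub>1, \<dots>, f\<^sub>n}\<^sub>M(x) = \<Pi>\<^sub>e(d\<alpha>\<^sup>*f\<^sub>1, \<dots>, d\<alpha>\<^sup>*f\<^sub>n)\<close>;
    the axioms of a Nambu-Poisson structure are inherited from \<open>G\<close> along \<open>\<epsilon>\<close> (\<open>base_bracket_eq\<close>).
  \<^item> The conormal covector of \<open>M\<close> belonging to \<open>d\<^sub>Af\<close> is \<open>d(\<beta>\<^sup>*f - \<alpha>\<^sup>*f)\<close> at \<open>e\<close>: it kills \<open>TM\<close>, since both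
    \<open>\<alpha>\<close> and \<open>\<beta>\<close> are left inverses of \<open>\<epsilon>\<close>, and \<open>\<alpha>\<^sup>*f\<close> is constant on the source fibre. It is the only
    one because \<open>T\<^sub>eG = T\<^sub>xM + A\<^sub>xG\<close>, which amounts to every vector in the kernel of \<open>d\<alpha>\<close> being the
    velocity of a curve in the source fibre (\<open>tangent_level_set\<close>, \<open>to_conormal_d_A\<close>).
  \<^item> At a unit, a function \<open>\<zeta>\<close> that vanishes on \<open>M\<close> gives a triple \<open>(\<zeta>, \<zeta>, -\<zeta>)\<close>, because the derivative
    of the multiplication there is \<open>(u, v) \<mapsto> u + v - d\<epsilon> d\<alpha> v\<close>. Hence \<open>M\<close> is coisotropic, \<open>\<Pi>\<^sup>\<sharp>\<close> maps
    conormal covectors into \<open>TM\<close>, and the bialgebroid bracket at \<open>x\<close> equals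
    \<open>\<Pi>\<^sub>e(d(\<beta>\<^sup>*f\<^sub>1 - \<alpha>\<^sup>*f\<^sub>1), \<dots>, d(\<beta>\<^sup>*f\<^sub>n\<^sub>-\<^sub>1 - \<alpha>\<^sup>*f\<^sub>n\<^sub>-\<^sub>1), d\<alpha>\<^sup>*f\<^sub>n)\<close> (\<open>bialgebroid_anchor_apply\<close>).
  \<^item> The triples \<open>(\<beta>\<^sup>*f\<^sub>i - \<alpha>\<^sup>*f\<^sub>i, -\<alpha>\<^sup>*f\<^sub>i, \<alpha>\<^sup>*f\<^sub>i)\<close> for \<open>i < n\<close> together with \<open>(\<alpha>\<^sup>*f\<^sub>n, 0, -\<alpha>\<^sup>*f\<^sub>n)\<close> turn this value
    into \<open>(-1)\<^sup>n\<^sup>-\<^sup>1 \<Pi>\<^sub>e(d\<alpha>\<^sup>*f\<^sub>1, \<dots>, d\<alpha>\<^sup>*f\<^sub>n)\<close> in one step (\<open>mixed_bracket_at_unit\<close>).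

  What remains is calculus on manifolds modelled on finite-dimensional normed spaces. Two points need
  more than bookkeeping: covectors and vectors determine each other, so that \<open>\<Pi>\<^sup>\<sharp>\<close> exists
  (\<open>sharp_exists_unique\<close>), and the submersion theorem for curves behind \<open>tangent_level_set\<close>. The latter is
  obtained from one scalar equation at a time (\<open>scalar_straightening\<close>), so that the intermediate value
  theorem takes the place of a contraction argument.\<close>

section \<open>Coordinates and smooth maps in finite-dimensional spaces\<close>

text \<open>A predicate on types rather than a type class, so that it can be a consequence of
  \<open>smooth_manifold\<close>.\<close>

definition finite_dim :: "'e::real_normed_vector itself \<Rightarrow> bool" where
  "finite_dim _ \<longleftrightarrow> (\<exists>B::'e set. finite B \<and> span B = UNIV)"

definition coordinates :: "'e::real_normed_vector set \<Rightarrow> ('e \<Rightarrow> 'e \<Rightarrow> real) \<Rightarrow> bool" where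
  "coordinates B c \<longleftrightarrow> finite B \<and> (\<forall>b\<in>B. bounded_linear (c b)) \<and> (\<forall>v. (\<Sum>b\<in>B. c b v *\<^sub>R b) = v) \<and>
     (\<forall>b\<in>B. \<forall>b'\<in>B. c b b' = (if b = b' then 1 else 0))"

text \<open>Equivalence of norms on the span of a finite independent set: the coefficient vectors with
  \<open>\<ell>\<^sup>1\<close>-norm \<open>1\<close> form a compact set in the product topology, on which the norm of the combination
  has a positive minimum.\<close>

lemma norm_combination_bounded_below:
  fixes B :: "'e::real_normed_vector set"
  assumes "finite B" "independent B"
  shows "\<exists>m>0. \<forall>c. m * (\<Sum>b\<in>B. \<bar>c b\<bar>) \<le> norm (\<Sum>b\<in>B. c b *\<^sub>R b)"
proof (cases "B = {}")
  case True
  then show ?thesis by (auto intro: exI[of _ 1])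
next
  case False
  define K :: "('e \<Rightarrow> real) set" where
    "K = PiE UNIV (\<lambda>b. if b \<in> B then {-1..1} else {0}) \<inter> {c. (\<Sum>b\<in>B. \<bar>c b\<bar>) = 1}"
  define h where "h = (\<lambda>c::'e \<Rightarrow> real. norm (\<Sum>b\<in>B. c b *\<^sub>R b))"
  have proj: "continuous_on UNIV (\<lambda>c::'e \<Rightarrow> real. c b)" for b
    by (simp add: continuous_on_product_coordinates)
  have "compact (PiE UNIV (\<lambda>b::'e. if b \<in> B then {-1..1} else {0::real}))"
  proof -
    have "compactin (product_topology (\<lambda>_::'e. euclidean) UNIV)
        (PiE UNIV (\<lambda>b::'e. if b \<in> B then {-1..1} else {0::real}))"
      unfolding compactin_PiE by simp
    then show ?thesis by (simp only: euclidean_product_topology compactin_euclidean_iff)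
  qed
  moreover have "closed {c::'e \<Rightarrow> real. (\<Sum>b\<in>B. \<bar>c b\<bar>) = 1}"
    by (intro closed_Collect_eq continuous_on_sum continuous_on_rabs continuous_on_const proj)
  ultimately have "compact K" unfolding K_def by (rule compact_Int_closed)
  moreover obtain b0 where b0: "b0 \<in> B" using False by auto
  have "(\<lambda>b. if b = b0 then 1 else 0) \<in> K"
    unfolding K_def
  proof (intro IntI PiE_I CollectI)
    have "(\<Sum>b\<in>B. \<bar>if b = b0 then 1 else (0::real)\<bar>) = (\<Sum>b\<in>B. if b = b0 then 1 else (0::real))"
      by (rule sum.cong) auto
    then show "(\<Sum>b\<in>B. \<bar>if b = b0 then 1 else (0::real)\<bar>) = 1"
      using b0 assms(1) by simp
  qed (auto simp: b0)
  then have "K \<noteq> {}" by auto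
  moreover have "continuous_on K h"
    unfolding h_def
    by (rule continuous_on_subset[OF _ subset_UNIV], rule continuous_on_norm, rule continuous_on_sum,
        rule continuous_on_scaleR[OF proj continuous_on_const])
  ultimately have "\<exists>c0\<in>K. \<forall>c\<in>K. h c0 \<le> h c" by (rule continuous_attains_inf)
  then obtain c0 where c0: "c0 \<in> K" "\<And>c. c \<in> K \<Longrightarrow> h c0 \<le> h c" by blast
  have "h c0 \<noteq> 0"
  proof
    assume "h c0 = 0"
    then have "(\<Sum>b\<in>B. c0 b *\<^sub>R b) = 0" by (simp add: h_def)
    then have "\<forall>b\<in>B. c0 b = 0"
      using assms independentD by blast
    then have "(\<Sum>b\<in>B. \<bar>c0 b\<bar>) = 0" by simp
    with c0(1) show False by (simp add: K_def)
  qed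
  then have pos: "h c0 > 0" by (simp add: h_def)
  have "h c0 * (\<Sum>b\<in>B. \<bar>c b\<bar>) \<le> norm (\<Sum>b\<in>B. c b *\<^sub>R b)" for c
  proof (cases "(\<Sum>b\<in>B. \<bar>c b\<bar>) = 0")
    case True
    then show ?thesis by simp
  next
    case nz: False
    define s where "s = (\<Sum>b\<in>B. \<bar>c b\<bar>)"
    have s: "s > 0" using nz by (simp add: s_def sum_nonneg less_le)
    define c' where "c' = (\<lambda>b. if b \<in> B then c b / s else 0)"
    have le: "\<bar>c b\<bar> \<le> s" if "b \<in> B" for b
      unfolding s_def using that assms(1) by (intro member_le_sum) auto
    have "(\<Sum>b\<in>B. \<bar>c' b\<bar>) = (\<Sum>b\<in>B. \<bar>c b\<bar>) / s"
      unfolding sum_divide_distrib by (rule sum.cong) (use s in \<open>auto simp: c'_def\<close>)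
    then have "(\<Sum>b\<in>B. \<bar>c' b\<bar>) = 1" using s by (simp flip: s_def)
    moreover have "c' b \<in> (if b \<in> B then {-1..1} else {0})" for b
      using le[of b] s by (auto simp: c'_def field_simps)
    ultimately have "c' \<in> K" by (auto simp: K_def)
    then have "h c0 \<le> h c'" by (rule c0(2))
    moreover have "(\<Sum>b\<in>B. c' b *\<^sub>R b) = (1 / s) *\<^sub>R (\<Sum>b\<in>B. c b *\<^sub>R b)"
      unfolding scaleR_sum_right by (rule sum.cong) (auto simp: c'_def)
    ultimately show ?thesis using s by (simp add: h_def s_def[symmetric] field_simps)
  qed
  with pos show ?thesis by blast
qed

lemma finite_dim_coordinates:
  assumes "finite_dim TYPE('e::real_normed_vector)"
  obtains B :: "'e::real_normed_vector set" and c where "coordinates B c"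
proof -
  obtain B0 :: "'e set" where "finite B0" "span B0 = UNIV" using assms by (auto simp: finite_dim_def)
  then obtain B :: "'e set" where B: "finite B" "independent B" "span B = UNIV"
  proof -
    obtain B where B: "B \<subseteq> B0" "independent B" "B0 \<subseteq> span B"
      using maximal_independent_subset[of B0] by auto
    have "span B0 \<subseteq> span B" using span_minimal[OF B(3) subspace_span] by simp
    moreover have "finite B" using finite_subset[OF B(1) \<open>finite B0\<close>] .
    moreover have "span B = UNIV"
      using calculation(1) by (simp only: \<open>span B0 = UNIV\<close> top.extremum_unique)
    ultimately show ?thesis using B(2) that by metis
  qed
  obtain m where m: "m > 0" "\<And>c. m * (\<Sum>b\<in>B. \<bar>c b\<bar>) \<le> norm (\<Sum>b\<in>B. c b *\<^sub>R b)"
    using norm_combination_bounded_below[OF B(1,2)] by blast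
  define c where "c = (\<lambda>b v. representation B v b)"
  have rep: "(\<Sum>b\<in>B. c b v *\<^sub>R b) = v" for v
    unfolding c_def by (rule real_vector.sum_representation_eq) (use B in auto)
  have "bounded_linear (c b)" if b: "b \<in> B" for b
  proof (rule bounded_linear_intro[where K = "1 / m"])
    fix v w and r :: real
    show "c b (v + w) = c b v + c b w" "c b (r *\<^sub>R v) = r *\<^sub>R c b v"
      using B by (auto simp: c_def real_vector.representation_add real_vector.representation_scale)
    have "m * \<bar>c b v\<bar> \<le> m * (\<Sum>b\<in>B. \<bar>c b v\<bar>)"
      using b B(1) m(1) by (auto intro!: mult_left_mono member_le_sum)
    also have "\<dots> \<le> norm v" using m(2)[of "\<lambda>b. c b v"] by (simp add: rep)
    finally show "norm (c b v) \<le> norm v * (1 / m)" using m(1) by (simp add: field_simps)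
  qed
  moreover have "c b b' = (if b = b' then 1 else 0)" if "b \<in> B" "b' \<in> B" for b b'
    using B that by (simp add: c_def real_vector.representation_basis)
  ultimately have "coordinates B c" using B(1) rep by (simp add: coordinates_def)
  then show ?thesis by (rule that)
qed

lemma finite_dim_prod:
  assumes "finite_dim TYPE('e::real_normed_vector)" "finite_dim TYPE('f::real_normed_vector)"
  shows "finite_dim TYPE('e \<times> 'f)"
proof -
  obtain B :: "'e set" and C :: "'f set" where B: "finite B" "span B = UNIV" "finite C" "span C = UNIV"
    using assms by (auto simp: finite_dim_def)
  define D where "D = (\<lambda>b. (b, 0::'f)) ` B \<union> (\<lambda>b. (0::'e, b)) ` C"
  have lin: "linear (\<lambda>b. (b, 0::'f))" "linear (\<lambda>b. (0::'e, b))" by (auto intro!: linearI)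
  have "(x, 0) \<in> span D" for x
    using B(2) span_mono[of "(\<lambda>b. (b, 0::'f)) ` B" D] real_vector.linear_span_image[OF lin(1), of B]
    by (auto simp: D_def)
  moreover have "(0, y) \<in> span D" for y
    using B(4) span_mono[of "(\<lambda>b. (0::'e, b)) ` C" D] real_vector.linear_span_image[OF lin(2), of C]
    by (auto simp: D_def)
  ultimately have "(x, y) \<in> span D" for x y
    using span_add[of "(x, 0)" D "(0, y)"] by simp
  then have "span D = UNIV" by auto
  moreover have "finite D" using B by (auto simp: D_def)
  ultimately show ?thesis by (auto simp: finite_dim_def)
qed

lemma finite_dim_real: "finite_dim TYPE(real)"
proof -
  have "x \<in> span {1::real}" for x
    using span_scale[OF span_base[of "1::real" "{1}"], of x] by simp
  then show ?thesis by (auto simp: finite_dim_def intro!: exI[of _ "{1}"])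
qed

lemma Ck_on_cong_imp:
  assumes "open S" "Ck_on k S f" "\<And>x. x \<in> S \<Longrightarrow> f x = g x"
  shows "Ck_on k S g"
  using assms(2,3)
proof (induction k arbitrary: f g)
  case 0
  then show ?case using continuous_on_cong[of S S f g] by simp
next
  case (Suc k)
  have "frechet_derivative f (at x) = frechet_derivative g (at x)" if "x \<in> S" for x
    using frechet_derivative_transform_within_open[of f x S g] Suc.prems that assms(1) by auto
  note eq = this
  have "g differentiable (at x)" if "x \<in> S" for x
  proof -
    have "(f has_derivative frechet_derivative f (at x)) (at x)"
      using Suc.prems(1) that frechet_derivative_works by auto
    then have "(g has_derivative frechet_derivative f (at x)) (at x)"
      by (rule has_derivative_transform_within_open[OF _ assms(1) that Suc.prems(2)])
    then show ?thesis by (auto simp: differentiable_def)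
  qed
  moreover have "Ck_on k S (\<lambda>x. frechet_derivative g (at x) v)" for v
    by (rule Suc.IH[of "\<lambda>x. frechet_derivative f (at x) v"]) (use Suc.prems(1) eq in auto)
  ultimately show ?case by simp
qed

text \<open>Any family of derivatives may be used in place of \<^const>\<open>frechet_derivative\<close>.\<close>

lemma Ck_on_SucI:
  assumes "open S" "\<And>x. x \<in> S \<Longrightarrow> (f has_derivative f' x) (at x)"
    "\<And>v. Ck_on k S (\<lambda>x. f' x v)"
  shows "Ck_on (Suc k) S f"
proof -
  have "frechet_derivative f (at x) = f' x" if "x \<in> S" for x
    using frechet_derivative_at[OF assms(2)[OF that]] by simp
  then have "Ck_on k S (\<lambda>x. frechet_derivative f (at x) v)" for v
    using Ck_on_cong_imp[OF assms(1) assms(3)[of v]] by auto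
  then show ?thesis using assms(2) by (auto simp: differentiable_def)
qed

lemma Ck_on_SucD:
  assumes "Ck_on (Suc k) S f"
  shows "x \<in> S \<Longrightarrow> (f has_derivative frechet_derivative f (at x)) (at x)"
    "Ck_on k S (\<lambda>x. frechet_derivative f (at x) v)"
  using assms frechet_derivative_works by auto

lemma Ck_on_lower: "Ck_on (Suc k) S f \<Longrightarrow> Ck_on k S f"
proof (induction k arbitrary: f)
  case 0
  then show ?case
    by (auto intro!: continuous_at_imp_continuous_on differentiable_imp_continuous_within)
next
  case (Suc k)
  then have "\<forall>v. Ck_on k S (\<lambda>x. frechet_derivative f (at x) v)" by simp
  then show ?case using Suc.prems by simp
qed

lemma Ck_on_subset:
  "Ck_on k S f \<Longrightarrow> T \<subseteq> S \<Longrightarrow> Ck_on k T f"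
proof (induction k arbitrary: f)
  case 0
  then show ?case by (simp add: continuous_on_subset)
next
  case (Suc k)
  have "Ck_on k T (\<lambda>x. frechet_derivative f (at x) v)" for v
    using Suc by simp
  then show ?case using Suc.prems by auto
qed

lemma Ck_on_local:
  assumes "\<And>x. x \<in> S \<Longrightarrow> \<exists>T. open T \<and> x \<in> T \<and> Ck_on k T f"
  shows "Ck_on k S f"
  using assms
proof (induction k arbitrary: f)
  case 0
  have "continuous (at x) f" if "x \<in> S" for x
    using 0[OF that] by (auto simp: continuous_on_eq_continuous_at)
  then show ?case by (simp add: continuous_at_imp_continuous_on)
next
  case (Suc k)
  have "f differentiable (at x)" if "x \<in> S" for x
    using Suc.prems[OF that] by auto
  moreover have "Ck_on k S (\<lambda>x. frechet_derivative f (at x) v)" for v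
  proof (rule Suc.IH)
    fix x assume "x \<in> S"
    then obtain T where "open T" "x \<in> T" "Ck_on (Suc k) T f" using Suc.prems by blast
    then show "\<exists>T. open T \<and> x \<in> T \<and> Ck_on k T (\<lambda>x. frechet_derivative f (at x) v)"
      using Ck_on_SucD(2) by blast
  qed
  ultimately show ?case by simp
qed

lemma Ck_on_const: "Ck_on k S (\<lambda>x. c)"
proof (induction k arbitrary: c)
  case (Suc k)
  then show ?case by simp
qed simp

lemma Ck_on_linear: "bounded_linear f \<Longrightarrow> Ck_on k S f"
proof (cases k)
  case (Suc j)
  assume f: "bounded_linear f"
  have "frechet_derivative f (at x) = f" for x
    using frechet_derivative_at[OF bounded_linear_imp_has_derivative[OF f]] by simp
  then show ?thesis using Suc f Ck_on_const by (auto simp: bounded_linear_imp_differentiable)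
qed (auto intro: linear_continuous_on)

lemma Ck_on_bounded_linear:
  assumes "open S" "bounded_linear h" "Ck_on k S f"
  shows "Ck_on k S (\<lambda>x. h (f x))"
  using assms(3)
proof (induction k arbitrary: f)
  case 0
  then show ?case using assms(2) by (auto intro: bounded_linear.continuous_on)
next
  case (Suc k)
  show ?case
    by (rule Ck_on_SucI[OF assms(1) bounded_linear.has_derivative[OF assms(2) Ck_on_SucD(1)[OF Suc.prems]]])
      (assumption | rule Suc.IH[OF Ck_on_SucD(2)[OF Suc.prems]])+
qed

lemma Ck_on_add:
  assumes "open S" "Ck_on k S f" "Ck_on k S g"
  shows "Ck_on k S (\<lambda>x. f x + g x)"
  using assms(2,3)
proof (induction k arbitrary: f g)
  case 0
  then show ?case by (auto intro: continuous_on_add)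
next
  case (Suc k)
  show ?case
    by (rule Ck_on_SucI[OF assms(1) has_derivative_add[OF Ck_on_SucD(1)[OF Suc.prems(1)] Ck_on_SucD(1)[OF Suc.prems(2)]]])
      (assumption | rule Suc.IH[OF Ck_on_SucD(2)[OF Suc.prems(1)] Ck_on_SucD(2)[OF Suc.prems(2)]])+
qed

lemma Ck_on_sum:
  assumes "open S" "\<And>i. i \<in> I \<Longrightarrow> Ck_on k S (f i)"
  shows "Ck_on k S (\<lambda>x. \<Sum>i\<in>I. f i x)"
  using assms(2)
proof (induction I rule: infinite_finite_induct)
  case (insert i I)
  have "Ck_on k S (\<lambda>x. f i x + (\<Sum>i\<in>I. f i x))"
    by (rule Ck_on_add[OF assms(1) insert.prems[OF insertI1] insert.IH[OF insert.prems[OF insertI2]]])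
  then show ?case using insert.hyps by simp
qed (simp_all add: Ck_on_const)

lemma Ck_on_bilinear:
  assumes "open S" "bounded_bilinear p" "Ck_on k S f" "Ck_on k S g"
  shows "Ck_on k S (\<lambda>x. p (f x) (g x))"
  using assms(3,4)
proof (induction k arbitrary: f g)
  case 0
  then show ?case
    unfolding Ck_on.simps by (rule bounded_bilinear.continuous_on[OF assms(2)])
next
  case (Suc k)
  let ?f' = "\<lambda>x. frechet_derivative f (at x)" and ?g' = "\<lambda>x. frechet_derivative g (at x)"
  have "((\<lambda>x. p (f x) (g x)) has_derivative (\<lambda>v. p (f x) (?g' x v) + p (?f' x v) (g x))) (at x)"
    if "x \<in> S" for x
    by (rule bounded_bilinear.FDERIV[OF assms(2) Ck_on_SucD(1)[OF Suc.prems(1) that] Ck_on_SucD(1)[OF Suc.prems(2) that]])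
  moreover have "Ck_on k S (\<lambda>x. p (f x) (?g' x v) + p (?f' x v) (g x))" for v
    by (rule Ck_on_add[OF assms(1)
        Suc.IH[OF Ck_on_lower[OF Suc.prems(1)] Ck_on_SucD(2)[OF Suc.prems(2)]]
        Suc.IH[OF Ck_on_SucD(2)[OF Suc.prems(1)] Ck_on_lower[OF Suc.prems(2)]]])
  ultimately show ?case by (rule Ck_on_SucI[OF assms(1)])
qed

lemma Ck_on_inverse:
  fixes f :: "'a::real_normed_vector \<Rightarrow> real"
  assumes "open S" "Ck_on k S f" "\<And>x. x \<in> S \<Longrightarrow> f x \<noteq> 0"
  shows "Ck_on k S (\<lambda>x. inverse (f x))"
  using assms(2,3)
proof (induction k)
  case 0
  then show ?case by (auto intro: continuous_on_inverse)
next
  case (Suc k)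
  have inv: "Ck_on k S (\<lambda>x. inverse (f x))" 
    by (rule Suc.IH[OF Ck_on_lower[OF Suc.prems(1)] Suc.prems(2)])
  have "Ck_on k S (\<lambda>x. - (inverse (f x) * frechet_derivative f (at x) v * inverse (f x)))" for v
    by (rule Ck_on_bounded_linear[OF assms(1) bounded_linear_minus[OF bounded_linear_ident]]
        Ck_on_bilinear[OF assms(1) bounded_bilinear_mult] inv Ck_on_SucD(2)[OF Suc.prems(1)])+
  moreover have "((\<lambda>x. inverse (f x)) has_derivative
      (\<lambda>v. - (inverse (f x) * frechet_derivative f (at x) v * inverse (f x)))) (at x)" if "x \<in> S" for x
    by (rule Deriv.has_derivative_inverse[OF Suc.prems(2)[OF that] Ck_on_SucD(1)[OF Suc.prems(1) that]])
  ultimately show ?case by (intro Ck_on_SucI[OF assms(1)])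
qed

text \<open>The derivative of \<open>g \<circ> f\<close> in direction \<open>v\<close> evaluates \<open>Dg\<close> in the moving direction \<open>Df(x) v\<close>,
  whereas \<^const>\<open>Ck_on\<close> only speaks of fixed directions; expanding \<open>Df(x) v\<close> in coordinates of the middle
  space removes the discrepancy.\<close>

lemma Ck_on_compose:
  fixes f :: "'a::real_normed_vector \<Rightarrow> 'b::real_normed_vector"
  assumes "finite_dim TYPE('b)" "open S" "Ck_on k S f" "Ck_on k T g" "f ` S \<subseteq> T"
  shows "Ck_on k S (\<lambda>x. g (f x))"
  using assms(3-5)
proof (induction k arbitrary: f g)
  case 0
  then show ?case by (auto intro: continuous_on_compose2)
next
  case (Suc k)
  obtain B :: "'b set" and c where B: "coordinates B c" using finite_dim_coordinates[OF assms(1)] .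
  have fd: "(f has_derivative frechet_derivative f (at x)) (at x)" if "x \<in> S" for x
    using Ck_on_SucD(1)[OF Suc.prems(1) that] .
  have gd: "(g has_derivative frechet_derivative g (at (f x))) (at (f x))" if "x \<in> S" for x
    using Ck_on_SucD(1)[OF Suc.prems(2)] that Suc.prems(3) by auto
  have d: "((\<lambda>x. g (f x)) has_derivative (\<lambda>v. frechet_derivative g (at (f x)) (frechet_derivative f (at x) v))) (at x)"
    if "x \<in> S" for x using has_derivative_compose[OF fd gd] that by auto
  have exp: "(\<Sum>b\<in>B. c b (frechet_derivative f (at x) v) *\<^sub>R frechet_derivative g (at (f x)) b)
      = frechet_derivative g (at (f x)) (frechet_derivative f (at x) v)" if "x \<in> S" for x v
  proof -
    have lin: "linear (frechet_derivative g (at (f x)))"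
      using gd[OF that] has_derivative_linear by blast
    have "frechet_derivative g (at (f x)) (\<Sum>b\<in>B. c b (frechet_derivative f (at x) v) *\<^sub>R b)
      = (\<Sum>b\<in>B. c b (frechet_derivative f (at x) v) *\<^sub>R frechet_derivative g (at (f x)) b)"
      by (simp add: linear_sum[OF lin] linear_cmul[OF lin])
    then show ?thesis using B by (simp add: coordinates_def)
  qed
  have "Ck_on k S (\<lambda>x. \<Sum>b\<in>B. c b (frechet_derivative f (at x) v) *\<^sub>R frechet_derivative g (at (f x)) b)" for v
  proof (intro Ck_on_sum[OF assms(2)] Ck_on_bilinear[OF assms(2) bounded_bilinear_scaleR])
    fix b assume b: "b \<in> B"
    show "Ck_on k S (\<lambda>x. c b (frechet_derivative f (at x) v))"
      using Ck_on_bounded_linear[OF assms(2) _ Ck_on_SucD(2)[OF Suc.prems(1)], of "c b"] B b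
      by (simp add: coordinates_def)
    show "Ck_on k S (\<lambda>x. frechet_derivative g (at (f x)) b)"
      using Suc.IH[OF Ck_on_lower[OF Suc.prems(1)] Ck_on_SucD(2)[OF Suc.prems(2), of b] Suc.prems(3)] .
  qed
  then have "Ck_on k S (\<lambda>x. frechet_derivative g (at (f x)) (frechet_derivative f (at x) v))" for v
    by (rule Ck_on_cong_imp[OF assms(2) _ exp])
  from d this show ?case by (rule Ck_on_SucI[OF assms(2)])
qed

lemma Ck_on_Pair:
  assumes "open S" "Ck_on k S f" "Ck_on k S g"
  shows "Ck_on k S (\<lambda>x. (f x, g x))"
proof -
  have "Ck_on k S (\<lambda>x. (f x, 0) + (0, g x))"
    by (intro Ck_on_add Ck_on_bounded_linear[where h = "\<lambda>x. (x, 0)"] Ck_on_bounded_linear[where h = "\<lambda>x. (0, x)"] assms)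
      (auto intro!: bounded_linear_Pair bounded_linear_ident bounded_linear_zero)
  then show ?thesis by simp
qed

lemma smooth_on_cong:
  "open S \<Longrightarrow> smooth_on S f \<Longrightarrow> (\<And>x. x \<in> S \<Longrightarrow> f x = g x) \<Longrightarrow> smooth_on S g"
  unfolding smooth_on_def using Ck_on_cong_imp by blast

lemma smooth_on_subset: "smooth_on S f \<Longrightarrow> T \<subseteq> S \<Longrightarrow> smooth_on T f"
  unfolding smooth_on_def using Ck_on_subset by blast

lemma smooth_on_local:
  assumes "\<And>x. x \<in> S \<Longrightarrow> \<exists>T. open T \<and> x \<in> T \<and> smooth_on T f"
  shows "smooth_on S f"
  unfolding smooth_on_def
proof
  fix k
  show "Ck_on k S f"
    by (rule Ck_on_local) (use assms smooth_on_def in fast)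
qed

lemma smooth_on_const: "smooth_on S (\<lambda>x. c)"
  by (simp add: smooth_on_def Ck_on_const)

lemma smooth_on_linear: "bounded_linear f \<Longrightarrow> smooth_on S f"
  by (simp add: smooth_on_def Ck_on_linear)

lemma smooth_on_id: "smooth_on S (\<lambda>x. x)"
  by (rule smooth_on_linear[OF bounded_linear_ident])

lemma smooth_on_bounded_linear:
  "open S \<Longrightarrow> bounded_linear h \<Longrightarrow> smooth_on S f \<Longrightarrow> smooth_on S (\<lambda>x. h (f x))"
  by (simp add: smooth_on_def Ck_on_bounded_linear)

lemma smooth_on_add:
  "open S \<Longrightarrow> smooth_on S f \<Longrightarrow> smooth_on S g \<Longrightarrow> smooth_on S (\<lambda>x. f x + g x)"
  by (simp add: smooth_on_def Ck_on_add)

lemma smooth_on_bilinear: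
  "open S \<Longrightarrow> bounded_bilinear p \<Longrightarrow> smooth_on S f \<Longrightarrow> smooth_on S g \<Longrightarrow>
    smooth_on S (\<lambda>x. p (f x) (g x))"
  by (simp add: smooth_on_def Ck_on_bilinear)

lemma smooth_on_compose:
  fixes f :: "'a::real_normed_vector \<Rightarrow> 'b::real_normed_vector"
  assumes "finite_dim TYPE('b)" "open S" "smooth_on S f" "smooth_on T g" "f ` S \<subseteq> T"
  shows "smooth_on S (\<lambda>x. g (f x))"
  unfolding smooth_on_def
proof
  fix k
  show "Ck_on k S (\<lambda>x. g (f x))"
    by (rule Ck_on_compose[OF assms(1,2) _ _ assms(5)]) (use assms(3,4) in \<open>simp_all add: smooth_on_def\<close>)
qed

lemma smooth_on_Pair:
  "open S \<Longrightarrow> smooth_on S f \<Longrightarrow> smooth_on S g \<Longrightarrow> smooth_on S (\<lambda>x. (f x, g x))"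
  by (simp add: smooth_on_def Ck_on_Pair)

lemma smooth_on_continuous: "smooth_on S f \<Longrightarrow> continuous_on S f"
  using Ck_on.simps(1) by (auto simp: smooth_on_def simp del: Ck_on.simps)

lemma smooth_on_has_derivative:
  "smooth_on S f \<Longrightarrow> x \<in> S \<Longrightarrow> (f has_derivative frechet_derivative f (at x)) (at x)"
  using Ck_on_SucD(1)[of 0 S f x] by (simp add: smooth_on_def del: Ck_on.simps)

section \<open>Level sets of submersions\<close>

text \<open>A regular scalar function becomes affine after a change of variables \<open>g\<close> that moves points along
  the lines in direction \<open>u\<close>. Near \<open>y\<^sub>0\<close>, the function is strictly increasing on each such line with slope above \<open>1/2\<close>,
  so the intermediate value theorem yields \<open>g z = z + t(z) u\<close>, and the slope bound makes \<open>t\<close>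
  continuous. As \<open>g\<close> is inverse to \<open>y \<mapsto> y + (b y - b y\<^sub>0 - l (y - y\<^sub>0)) u\<close>, whose derivative
  is a rank-one perturbation of the identity, its derivative is an explicit smooth expression in \<open>g\<close>
  itself; so each degree of differentiability gives the next one.\<close>

lemma scalar_straightening:
  fixes b :: "'e::real_normed_vector \<Rightarrow> real"
  assumes fd: "finite_dim TYPE('e)" and S: "open S" "y0 \<in> S" and b: "smooth_on S b"
    and deriv: "(b has_derivative l) (at y0)" and u: "l u = 1"
  shows "\<exists>V g. open V \<and> y0 \<in> V \<and> g ` V \<subseteq> S \<and> g y0 = y0 \<and> smooth_on V g \<and>
    (\<forall>z\<in>V. b (g z) = b y0 + l (z - y0)) \<and> (g has_derivative (\<lambda>v. v)) (at y0)"
proof -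
  define m where "m = (\<lambda>y. frechet_derivative b (at y))"
  have m: "(b has_derivative m y) (at y)" if "y \<in> S" for y
    using smooth_on_has_derivative[OF b that] by (simp add: m_def)
  have l: "l = m y0" using has_derivative_unique[OF deriv m[OF S(2)]] .
  interpret l: bounded_linear l using deriv by (rule has_derivative_bounded_linear)
  have u0: "norm u > 0" using u l.zero by (cases "u = 0") auto
  have m_smooth: "Ck_on k S (\<lambda>y. m y v)" for k v
    using Ck_on_SucD(2)[of k S b v] b by (simp add: smooth_on_def m_def del: Ck_on.simps)
  have "continuous_on S (\<lambda>y. m y u)" using m_smooth[of 0 u] by simp
  then have "isCont (\<lambda>y. m y u) y0" using S by (simp add: continuous_on_eq_continuous_at)
  then have "\<forall>\<^sub>F y in at y0. m y u > 1/2"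
    using l u by (intro order_tendstoD(1)[of _ "m y0 u"]) (auto simp: isCont_def)
  then have "\<forall>\<^sub>F y in nhds y0. m y u > 1/2"
    using l u by (simp add: eventually_nhds_conv_at)
  moreover have "\<forall>\<^sub>F y in nhds y0. y \<in> S" using S by (simp add: eventually_nhds_in_open)
  ultimately have "\<forall>\<^sub>F y in nhds y0. y \<in> S \<and> m y u > 1/2" by eventually_elim auto
  then obtain R where R: "R > 0" "\<And>y. dist y y0 < R \<Longrightarrow> y \<in> S \<and> m y u > 1/2"
    by (auto simp: eventually_nhds_metric)
  \<comment> \<open>Moving by at most \<open>d\<close> along \<open>u\<close> costs \<open>R/4\<close>, which keeps points of the ball of radius \<open>R/2\<close>
    inside the ball of radius \<open>R\<close>.\<close>
  define d where "d = R / (4 * norm u)"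
  have d: "d > 0" using R(1) u0 by (simp add: d_def)
  have du: "d * norm u = R / 4" using u0 by (simp add: d_def)
  have inball: "dist (z + t *\<^sub>R u) y0 < R" if "dist z y0 < R/2" "\<bar>t\<bar> \<le> d" for z t
  proof -
    have "dist (z + t *\<^sub>R u) y0 \<le> dist z y0 + \<bar>t\<bar> * norm u"
      by (simp add: dist_norm) (metis add_diff_eq diff_add_eq norm_scaleR norm_triangle_ineq)
    also have "\<bar>t\<bar> * norm u \<le> d * norm u" using that(2) by (simp add: mult_right_mono)
    finally show ?thesis using that(1) du R(1) by simp
  qed
  have slope1: "b (z + t *\<^sub>R u) - b (z + s *\<^sub>R u) \<ge> (t - s) / 2"
    if z: "dist z y0 < R/2" and st: "\<bar>s\<bar> \<le> d" "\<bar>t\<bar> \<le> d" "s < t" for z s t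
  proof -
    have "((\<lambda>x. b (z + x *\<^sub>R u)) has_derivative (\<lambda>h. m (z + x *\<^sub>R u) (h *\<^sub>R u))) (at x within {s..t})"
      if "s \<le> x" "x \<le> t" for x
    proof (rule has_derivative_compose[of "\<lambda>x. z + x *\<^sub>R u" "\<lambda>h. h *\<^sub>R u"])
      show "((\<lambda>x. z + x *\<^sub>R u) has_derivative (\<lambda>h. h *\<^sub>R u)) (at x within {s..t})"
        by (auto intro!: derivative_eq_intros)
      show "(b has_derivative m (z + x *\<^sub>R u)) (at (z + x *\<^sub>R u))"
        by (rule m) (use R(2)[OF inball[OF z, of x]] that st in auto)
    qed
    from mvt_simple[OF st(3) this] obtain x where x: "x \<in> {s<..<t}"
      "b (z + t *\<^sub>R u) - b (z + s *\<^sub>R u) = m (z + x *\<^sub>R u) ((t - s) *\<^sub>R u)" by blast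
    have x': "z + x *\<^sub>R u \<in> S" "m (z + x *\<^sub>R u) u > 1/2" using R(2)[OF inball[OF z, of x]] x st by auto
    have "linear (m (z + x *\<^sub>R u))" using m[OF x'(1)] has_derivative_linear by blast
    then have "m (z + x *\<^sub>R u) ((t - s) *\<^sub>R u) = (t - s) * m (z + x *\<^sub>R u) u"
      by (simp add: linear_cmul)
    moreover have "(t - s) * m (z + x *\<^sub>R u) u \<ge> (t - s) * (1/2)"
      using x'(2) st(3) by (intro mult_left_mono) auto
    ultimately show ?thesis using x(2) by simp
  qed
  have slope: "\<bar>t - s\<bar> \<le> 2 * \<bar>b (z + t *\<^sub>R u) - b (z + s *\<^sub>R u)\<bar>"
    if "dist z y0 < R/2" "\<bar>s\<bar> \<le> d" "\<bar>t\<bar> \<le> d" for z s t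
    using slope1[OF that(1,2,3)] slope1[OF that(1,3,2)] by (cases s t rule: linorder_cases) auto
  define H where "H = (\<lambda>z t. b (z + t *\<^sub>R u) - b y0 - l (z - y0))"
  have bcont: "isCont b y" if "y \<in> S" for y using m[OF that] has_derivative_continuous by blast
  have Hcont: "isCont (\<lambda>z. H z t) z" if "dist z y0 < R/2" "\<bar>t\<bar> \<le> d" for z t
  proof -
    have "isCont b (z + t *\<^sub>R u)" using bcont R(2)[OF inball[OF that]] by blast
    then have "isCont (\<lambda>z. b (z + t *\<^sub>R u)) z"
      by (intro isCont_o2[of z "\<lambda>z. z + t *\<^sub>R u" b]) auto
    moreover have "isCont (\<lambda>z. l (z - y0)) z"
      by (intro isCont_o2[of z "\<lambda>z. z - y0" l] l.isCont continuous_intros)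
    ultimately show ?thesis unfolding H_def by (intro continuous_intros)
  qed
  have y0R: "dist y0 y0 < R/2" using R(1) by simp
  have "H y0 d > 0" "H y0 (-d) < 0"
    using slope1[OF y0R, of 0 d] slope1[OF y0R, of "-d" 0] d by (auto simp: H_def l.zero)
  then have "\<forall>\<^sub>F z in nhds y0. H z d > 0" "\<forall>\<^sub>F z in nhds y0. H z (-d) < 0"
    using order_tendstoD[OF Hcont[OF y0R, of d, unfolded isCont_def]]
      order_tendstoD[OF Hcont[OF y0R, of "-d", unfolded isCont_def]] d
    by (auto simp: eventually_nhds_conv_at)
  moreover have "\<forall>\<^sub>F z in nhds y0. dist z y0 < R/2"
    unfolding eventually_nhds_metric using R(1) by (intro exI[of _ "R/2"]) auto
  ultimately have "\<forall>\<^sub>F z in nhds y0. dist z y0 < R/2 \<and> H z d > 0 \<and> H z (-d) < 0"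
    by eventually_elim auto
  then obtain V where V: "open V" "y0 \<in> V"
    "\<And>z. z \<in> V \<Longrightarrow> dist z y0 < R/2 \<and> H z d > 0 \<and> H z (-d) < 0"
    by (auto simp: eventually_nhds)
  have "\<exists>t. \<bar>t\<bar> \<le> d \<and> H z t = 0" if z: "z \<in> V" for z
  proof -
    have "isCont (\<lambda>t. H z t) t" if "t \<in> {-d..d}" for t
    proof -
      have "isCont b (z + t *\<^sub>R u)" using bcont R(2)[OF inball, of z t] V(3)[OF z] that by auto
      then have "isCont (\<lambda>t. b (z + t *\<^sub>R u)) t"
        by (intro isCont_o2[of t "\<lambda>t. z + t *\<^sub>R u" b]) auto
      then show ?thesis unfolding H_def by (intro continuous_intros)
    qed
    then have "continuous_on {-d..d} (H z)" by (simp add: continuous_at_imp_continuous_on)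
    then obtain t where "-d \<le> t" "t \<le> d" "H z t = 0"
      using IVT'[of "H z" "-d" 0 d] V(3)[OF z] d by auto
    then show ?thesis by (intro exI[of _ t]) auto
  qed
  then obtain t where t: "\<And>z. z \<in> V \<Longrightarrow> \<bar>t z\<bar> \<le> d \<and> H z (t z) = 0" by metis
  define g where "g = (\<lambda>z. z + t z *\<^sub>R u)"
  have gS: "g z \<in> S" "m (g z) u > 1/2" if "z \<in> V" for z
    using R(2)[OF inball, of z "t z"] V(3)[OF that] t[OF that] by (auto simp: g_def)
  have bg: "b (g z) = b y0 + l (z - y0)" if "z \<in> V" for z
    using t[OF that] by (simp add: g_def H_def)
  have "\<bar>t y0 - 0\<bar> \<le> 2 * \<bar>b (y0 + t y0 *\<^sub>R u) - b (y0 + 0 *\<^sub>R u)\<bar>"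
    by (rule slope[OF y0R]) (use t[OF V(2)] d in auto)
  then have gy0: "g y0 = y0" using bg[OF V(2)] by (simp add: g_def l.zero)
  have tcont: "isCont t z" if z: "z \<in> V" for z
  proof -
    have "((\<lambda>z'. 2 * \<bar>H z' (t z)\<bar>) \<longlongrightarrow> 2 * \<bar>H z (t z)\<bar>) (at z)"
      by (intro tendsto_intros Hcont[unfolded isCont_def]) (use V(3)[OF z] t[OF z] in auto)
    then have lim: "((\<lambda>z'. 2 * \<bar>H z' (t z)\<bar>) \<longlongrightarrow> 0) (at z)" using t[OF z] by simp
    have "\<bar>t z' - t z\<bar> \<le> 2 * \<bar>H z' (t z)\<bar>" if z': "z' \<in> V" for z'
    proof -
      have "\<bar>t z' - t z\<bar> \<le> 2 * \<bar>b (z' + t z' *\<^sub>R u) - b (z' + t z *\<^sub>R u)\<bar>"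
        by (rule slope) (use V(3)[OF z'] t[OF z'] t[OF z] in auto)
      also have "b (z' + t z' *\<^sub>R u) = b y0 + l (z' - y0)" using t[OF z'] by (simp add: H_def)
      finally show ?thesis by (simp add: H_def abs_minus_commute algebra_simps)
    qed
    then have "\<forall>\<^sub>F z' in at z. norm (t z' - t z) \<le> 2 * \<bar>H z' (t z)\<bar>"
      using eventually_at_in_open[OF V(1) z] by (auto elim!: eventually_mono)
    then have "((\<lambda>z'. t z' - t z) \<longlongrightarrow> 0) (at z)"
      by (rule Lim_null_comparison[OF _ lim])
    then show ?thesis by (simp add: isCont_def LIM_zero_iff)
  qed
  \<comment> \<open>The inverse of \<open>v \<mapsto> v + (m (g z) v - l v) u\<close>, using \<open>l u = 1\<close>.\<close>
  define g' where "g' = (\<lambda>z v. v - ((m (g z) v - l v) * inverse (m (g z) u)) *\<^sub>R u)"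
  have gderiv: "(g has_derivative g' z) (at z)" if z: "z \<in> V" for z
  proof (rule has_derivative_inverse_basic[OF _ _ _ _ V(1) z])
    define f where "f = (\<lambda>y. y + (b y - b y0 - l (y - y0)) *\<^sub>R u)"
    define f' where "f' = (\<lambda>v. v + (m (g z) v - l v) *\<^sub>R u)"
    interpret m: bounded_linear "m (g z)" using m[OF gS(1)[OF z]] by (rule has_derivative_bounded_linear)
    show "(f has_derivative f') (at (g z))"
      unfolding f_def f'_def
      by (auto intro!: derivative_eq_intros m[OF gS(1)[OF z]] l.has_derivative)
    show "bounded_linear (g' z)"
      unfolding g'_def
      by (intro bounded_linear_sub bounded_linear_ident bounded_linear_scaleR_const
          bounded_linear_mult_const m.bounded_linear_axioms l.bounded_linear_axioms)
    show "g' z \<circ> f' = id"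
    proof
      fix v
      define k where "k = m (g z) v - l v"
      have "m (g z) (v + k *\<^sub>R u) = m (g z) v + k * m (g z) u" by (simp add: m.add m.scaleR)
      moreover have "l (v + k *\<^sub>R u) = l v + k" by (simp add: l.add l.scaleR u)
      ultimately have "m (g z) (v + k *\<^sub>R u) - l (v + k *\<^sub>R u) = k * m (g z) u"
        using k_def by linarith
      then show "(g' z \<circ> f') v = id v"
        using gS(2)[OF z] by (simp add: g'_def f'_def flip: k_def)
    qed
    show "isCont g z" unfolding g_def by (intro continuous_intros tcont[OF z])
    show "f (g z') = z'" if "z' \<in> V" for z'
    proof -
      have "b (g z') - b y0 - l (g z' - y0) = - t z'"
        unfolding bg[OF that] by (simp add: g_def l.add l.diff l.scaleR u)
      then show ?thesis by (simp only: f_def) (simp add: g_def)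
    qed
  qed
  have "Ck_on k V g" for k
  proof (induction k)
    case 0
    have "isCont g z" if "z \<in> V" for z unfolding g_def by (intro continuous_intros tcont[OF that])
    then show ?case by (simp add: continuous_at_imp_continuous_on)
  next
    case (Suc k)
    have mg: "Ck_on k V (\<lambda>z. m (g z) v)" for v
      by (rule Ck_on_compose[OF fd V(1) Suc m_smooth]) (use gS in auto)
    have inv: "Ck_on k V (\<lambda>z. inverse (m (g z) u))"
      by (rule Ck_on_inverse[OF V(1) mg]) (use gS in force)
    have "Ck_on k V (\<lambda>z. v + ((m (g z) v + (- l v)) * inverse (m (g z) u)) *\<^sub>R (- u))" for v
      by (rule Ck_on_add[OF V(1) Ck_on_const Ck_on_bilinear[OF V(1) bounded_bilinear_scaleR
            Ck_on_bilinear[OF V(1) bounded_bilinear_mult Ck_on_add[OF V(1) mg Ck_on_const] inv] Ck_on_const]])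
    then have "Ck_on k V (\<lambda>z. g' z v)" for v by (simp add: g'_def)
    with gderiv show ?case by (rule Ck_on_SucI[OF V(1)])
  qed
  then have "smooth_on V g" by (simp add: smooth_on_def)
  moreover have "g' y0 = (\<lambda>v. v)" by (simp add: g'_def gy0 l)
  then have "(g has_derivative (\<lambda>v. v)) (at y0)" using gderiv[OF V(2)] by simp
  ultimately show ?thesis using V(1,2) gS(1) gy0 bg by blast
qed

text \<open>Functions with dual directions \<open>u\<close> are made constant one after the other. If \<open>r\<close> already lands in
  the level set of the previous functions, the next one composed with \<open>r\<close> is straightened by \<open>g\<close> and
  then frozen by first projecting along \<open>u i\<close>. The condition on \<open>D\<close> says that \<open>r\<close> is
  infinitesimally the identity on the directions tangent to the common level set.\<close>

lemma common_level_set_retraction: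
  fixes a :: "'i \<Rightarrow> 'e::real_normed_vector \<Rightarrow> real"
  assumes fd: "finite_dim TYPE('e)" and J: "finite J" and S: "open S" "y0 \<in> S"
    and a: "\<And>j. j \<in> J \<Longrightarrow> smooth_on S (a j)"
    and a': "\<And>j. j \<in> J \<Longrightarrow> (a j has_derivative a' j) (at y0)"
    and u: "\<And>i j. i \<in> J \<Longrightarrow> j \<in> J \<Longrightarrow> a' i (u j) = (if i = j then 1 else 0)"
  shows "\<exists>V r D. open V \<and> y0 \<in> V \<and> r ` V \<subseteq> S \<and> r y0 = y0 \<and> smooth_on V r \<and>
    (\<forall>j\<in>J. \<forall>z\<in>V. a j (r z) = a j y0) \<and> (r has_derivative D) (at y0) \<and>
    (\<forall>w. (\<forall>j\<in>J. a' j w = 0) \<longrightarrow> D w = w)"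
  using J a a' u
proof (induction J)
  case empty
  have "((\<lambda>x. x) has_derivative (\<lambda>x. x)) (at y0)" by (rule has_derivative_ident)
  then show ?case using S smooth_on_id[of S] by (intro exI[of _ S] exI[of _ "\<lambda>x. x"]) auto
next
  case (insert i J)
  have "\<exists>V r D. open V \<and> y0 \<in> V \<and> r ` V \<subseteq> S \<and> r y0 = y0 \<and> smooth_on V r \<and>
    (\<forall>j\<in>J. \<forall>z\<in>V. a j (r z) = a j y0) \<and> (r has_derivative D) (at y0) \<and>
    (\<forall>w. (\<forall>j\<in>J. a' j w = 0) \<longrightarrow> D w = w)"
    by (rule insert.IH) (use insert.prems in auto)
  then obtain V r D where r: "open V" "y0 \<in> V" "r ` V \<subseteq> S" "r y0 = y0" "smooth_on V r"
    "\<And>j z. j \<in> J \<Longrightarrow> z \<in> V \<Longrightarrow> a j (r z) = a j y0" "(r has_derivative D) (at y0)"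
    "\<And>w. (\<forall>j\<in>J. a' j w = 0) \<Longrightarrow> D w = w" by blast
  define l where "l = (\<lambda>v. a' i (D v))"
  have bd: "((\<lambda>z. a i (r z)) has_derivative l) (at y0)"
    unfolding l_def
    by (rule has_derivative_compose[OF r(7)]) (use insert.prems(2)[of i] r(4) in simp)
  have bs: "smooth_on V (\<lambda>z. a i (r z))"
    by (rule smooth_on_compose[OF fd r(1,5) _ r(3)]) (use insert.prems(1) in simp)
  have "a' j (u i) = 0" if "j \<in> J" for j
    using insert.prems(3)[of j i] insert.hyps that by auto
  then have "D (u i) = u i" using r(8) by blast
  then have lu: "l (u i) = 1" using insert.prems(3)[of i i] by (simp add: l_def)
  obtain V' g where g: "open V'" "y0 \<in> V'" "g ` V' \<subseteq> V" "g y0 = y0" "smooth_on V' g"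
    "\<And>z. z \<in> V' \<Longrightarrow> a i (r (g z)) = a i (r y0) + l (z - y0)" "(g has_derivative (\<lambda>v. v)) (at y0)"
    using scalar_straightening[OF fd r(1,2) bs bd lu] by blast
  interpret l: bounded_linear l using bd by (rule has_derivative_bounded_linear)
  \<comment> \<open>The projection onto the hyperplane through \<open>y0\<close> on which the straightened function is constant.\<close>
  define p where "p = (\<lambda>z. z - l (z - y0) *\<^sub>R u i)"
  have "bounded_linear (\<lambda>z. z - l z *\<^sub>R u i)"
    by (intro bounded_linear_sub bounded_linear_ident bounded_linear_scaleR_const l.bounded_linear_axioms)
  then have "smooth_on UNIV (\<lambda>z. (z - l z *\<^sub>R u i) + l y0 *\<^sub>R u i)"
    by (rule smooth_on_add[OF open_UNIV smooth_on_linear smooth_on_const])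
  moreover have "p = (\<lambda>z. (z - l z *\<^sub>R u i) + l y0 *\<^sub>R u i)"
    by (auto simp: p_def l.diff algebra_simps)
  ultimately have ps: "smooth_on UNIV p" by simp
  define W where "W = p -` V'"
  have W: "open W" unfolding W_def using smooth_on_continuous[OF ps] g(1) by (simp add: open_vimage)
  have py0: "p y0 = y0" by (simp add: p_def l.zero)
  have pW: "p ` W \<subseteq> V'" by (auto simp: W_def)
  have gpW: "(\<lambda>z. g (p z)) ` W \<subseteq> V" using g(3) pW by auto
  have "smooth_on W (\<lambda>z. g (p z))"
    by (rule smooth_on_compose[OF fd W smooth_on_subset[OF ps] g(5) pW]) simp
  then have rs: "smooth_on W (\<lambda>z. r (g (p z)))"
    by (rule smooth_on_compose[OF fd W _ r(5) gpW])
  have const: "a j (r (g (p z))) = a j y0" if "j \<in> insert i J" "z \<in> W" for j z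
  proof (cases "j \<in> J")
    case True
    then show ?thesis using r(6) gpW that by auto
  next
    case False
    then have "j = i" using that by auto
    moreover have "l (p z - y0) = 0" using lu by (simp add: p_def l.diff l.scaleR)
    ultimately show ?thesis using g(6)[of "p z"] pW that r(4) by auto
  qed
  have "(p has_derivative (\<lambda>v. v - l v *\<^sub>R u i)) (at y0)"
    unfolding p_def by (auto intro!: derivative_eq_intros l.has_derivative)
  from has_derivative_compose[OF this, of g "\<lambda>v. v"] g(7) py0
  have "((\<lambda>z. g (p z)) has_derivative (\<lambda>v. v - l v *\<^sub>R u i)) (at y0)" by simp
  from has_derivative_compose[OF this, of r D] r(7) py0 g(4)
  have rd: "((\<lambda>z. r (g (p z))) has_derivative (\<lambda>v. D (v - l v *\<^sub>R u i))) (at y0)" by simp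
  have "D (w - l w *\<^sub>R u i) = w" if w: "\<forall>j\<in>insert i J. a' j w = 0" for w
  proof -
    have "D w = w" using w r(8) by auto
    moreover from this have "l w = 0" using w by (simp add: l_def)
    ultimately show ?thesis by simp
  qed
  moreover have "(\<lambda>z. r (g (p z))) ` W \<subseteq> S" using gpW r(3) by blast
  moreover have "y0 \<in> W" using py0 g(2) by (simp add: W_def)
  moreover have "r (g (p y0)) = y0" using py0 g(4) r(4) by simp
  ultimately have "open W \<and> y0 \<in> W \<and> (\<lambda>z. r (g (p z))) ` W \<subseteq> S \<and> r (g (p y0)) = y0 \<and>
      smooth_on W (\<lambda>z. r (g (p z))) \<and> (\<forall>j\<in>insert i J. \<forall>z\<in>W. a j (r (g (p z))) = a j y0) \<and>
      ((\<lambda>z. r (g (p z))) has_derivative (\<lambda>v. D (v - l v *\<^sub>R u i))) (at y0) \<and>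
      (\<forall>w. (\<forall>j\<in>insert i J. a' j w = 0) \<longrightarrow> D (w - l w *\<^sub>R u i) = w)"
    using W rs const rd by blast
  then show ?case by (intro exI)
qed

section \<open>Smooth maps between manifolds\<close>

text \<open>The pointwise form of \<^const>\<open>smooth_map\<close>; it composes without any tracking of domains.\<close>

definition smooth_at :: "('p::topological_space, 'e::real_normed_vector) atlas \<Rightarrow>
    ('q::topological_space, 'f::real_normed_vector) atlas \<Rightarrow> 'p \<Rightarrow> ('p \<Rightarrow> 'q) \<Rightarrow> bool" where
  "smooth_at A B x F \<longleftrightarrow> (\<exists>W. x \<in> W \<and> smooth_map A B W F)"

lemma smooth_near_iff_at: "smooth_near A x f \<longleftrightarrow> smooth_at A std_atlas x f"
  by (simp add: smooth_near_def smooth_at_def)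

lemma manifold_finite_dim:
  fixes A :: "('p::{t2_space, second_countable_topology}, 'e::real_normed_vector) atlas"
  assumes "smooth_manifold A" shows "finite_dim TYPE('e)"
  using assms by (simp add: smooth_manifold_def finite_dim_def)

lemma chart_exists:
  assumes "smooth_manifold A"
  obtains U \<phi> where "(U, \<phi>) \<in> A" "x \<in> U"
proof -
  have "x \<in> (\<Union>(U, \<phi>)\<in>A. U)" using assms by (simp add: smooth_manifold_def)
  then show ?thesis using that by blast
qed

lemma chart_homeo:
  assumes "smooth_manifold A" "(U, \<phi>) \<in> A"
  shows "open U" "open (\<phi> ` U)" "homeomorphism U (\<phi> ` U) \<phi> (inv_into U \<phi>)"
  using assms unfolding smooth_manifold_def by fast+

lemma chart_continuous:
  assumes "smooth_manifold A" "(U, \<phi>) \<in> A"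
  shows "continuous_on U \<phi>" "continuous_on (\<phi> ` U) (inv_into U \<phi>)"
  using chart_homeo(3)[OF assms] by (auto simp: homeomorphism_def)

lemma chart_inv:
  assumes "smooth_manifold A" "(U, \<phi>) \<in> A" "p \<in> U"
  shows "inv_into U \<phi> (\<phi> p) = p"
  using chart_homeo(3)[OF assms(1,2)] assms(3) by (auto simp: homeomorphism_def)

lemma chart_open_image:
  assumes "smooth_manifold A" "(U, \<phi>) \<in> A" "open W" "W \<subseteq> U"
  shows "open (\<phi> ` W)"
proof -
  have "\<phi> ` W = \<phi> ` U \<inter> inv_into U \<phi> -` W"
    using assms(4) chart_inv[OF assms(1,2)] by (force simp: subset_iff)
  then show ?thesis
    using continuous_open_preimage[OF chart_continuous(2)[OF assms(1,2)] chart_homeo(2)[OF assms(1,2)] assms(3)]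
    by simp
qed

lemma chart_transition:
  assumes "smooth_manifold A" "(U, \<phi>) \<in> A" "(V, \<psi>) \<in> A"
  shows "smooth_on (\<phi> ` (U \<inter> V)) (\<lambda>y. \<psi> (inv_into U \<phi> y))"
  using assms unfolding smooth_manifold_def by (fastforce simp: o_def)

lemma smooth_map_chart:
  assumes "smooth_map A B W F" "(U, \<phi>) \<in> A" "(V, \<psi>) \<in> B"
  shows "smooth_on (\<phi> ` (U \<inter> W \<inter> F -` V)) (\<lambda>y. \<psi> (F (inv_into U \<phi> y)))"
proof -
  have "smooth_on (\<phi> ` (U \<inter> W \<inter> F -` V)) (\<psi> \<circ> F \<circ> inv_into U \<phi>)"
    using assms unfolding smooth_map_def by blast
  then show ?thesis by (simp add: o_def)
qed

text \<open>One pair of charts suffices: all others differ by smooth transition maps.\<close>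

lemma smooth_map_chartI:
  fixes A :: "('p::{t2_space, second_countable_topology}, 'e::real_normed_vector) atlas"
    and B :: "('q::{t2_space, second_countable_topology}, 'f::real_normed_vector) atlas"
  assumes A: "smooth_manifold A" and B: "smooth_manifold B"
    and U: "(U, \<phi>) \<in> A" and V: "(V, \<psi>) \<in> B"
    and W: "open W" "W \<subseteq> U" "F ` W \<subseteq> V" and cont: "continuous_on W F"
    and smooth: "smooth_on (\<phi> ` W) (\<lambda>y. \<psi> (F (inv_into U \<phi> y)))"
  shows "smooth_map A B W F"
  unfolding smooth_map_def
proof (intro conjI W(1) cont, safe)
  fix U' \<phi>' V' \<psi>' assume U': "(U', \<phi>') \<in> A" and V': "(V', \<psi>') \<in> B"
  define T where "T = U' \<inter> W \<inter> F -` V'"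
  have "open (W \<inter> F -` V')"
    using continuous_open_preimage[OF cont W(1) chart_homeo(1)[OF B V']] .
  then have T: "open T" unfolding T_def using chart_homeo(1)[OF A U'] by (metis Int_assoc open_Int)
  have TU: "T \<subseteq> U'" "T \<subseteq> U" "T \<subseteq> W" using W(2) by (auto simp: T_def)
  have oT': "open (\<phi>' ` T)" and oT: "open (\<phi> ` T)"
    using chart_open_image[OF A U' T] chart_open_image[OF A U T] TU by auto
  have i': "inv_into U' \<phi>' (\<phi>' p) = p" if "p \<in> T" for p using chart_inv[OF A U'] TU that by blast
  have i: "inv_into U \<phi> (\<phi> p) = p" if "p \<in> T" for p using chart_inv[OF A U] TU that by blast
  have j: "inv_into V \<psi> (\<psi> (F p)) = F p" if "p \<in> T" for p using chart_inv[OF B V] TU W(3) that by blast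
  have s1: "smooth_on (\<phi>' ` T) (\<lambda>y. \<phi> (inv_into U' \<phi>' y))"
    by (rule smooth_on_subset[OF chart_transition[OF A U' U]]) (use TU in blast)
  have s2: "smooth_on (\<phi>' ` T) (\<lambda>y. \<psi> (F (inv_into U \<phi> (\<phi> (inv_into U' \<phi>' y)))))"
    by (rule smooth_on_compose[OF manifold_finite_dim[OF A] oT' s1 smooth]) (use TU i' in auto)
  have "smooth_on (\<phi>' ` T) (\<lambda>y. \<psi>' (inv_into V \<psi> (\<psi> (F (inv_into U \<phi> (\<phi> (inv_into U' \<phi>' y)))))))"
    by (rule smooth_on_compose[OF manifold_finite_dim[OF B] oT' s2 chart_transition[OF B V V']])
      (use i i' W(3) TU in \<open>auto simp: T_def\<close>)
  then have "smooth_on (\<phi>' ` T) (\<psi>' \<circ> F \<circ> inv_into U' \<phi>')"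
    by (rule smooth_on_cong[OF oT']) (auto simp: i i' j)
  then show "smooth_on (\<phi>' ` (U' \<inter> W \<inter> F -` V')) (\<psi>' \<circ> F \<circ> inv_into U' \<phi>')" by (simp add: T_def)
qed

lemma smooth_map_open_subset:
  assumes "smooth_map A B W F" "open W'" "W' \<subseteq> W"
  shows "smooth_map A B W' F"
  using assms unfolding smooth_map_def
  by (fastforce intro: continuous_on_subset smooth_on_subset)

lemma smooth_at_chartsD:
  assumes A: "smooth_manifold A" and B: "smooth_manifold B" and F: "smooth_at A B x F"
    and U: "(U, \<phi>) \<in> A" "x \<in> U" and V: "(V, \<psi>) \<in> B" "F x \<in> V"
  obtains W where "open W" "x \<in> W" "W \<subseteq> U" "F ` W \<subseteq> V" "continuous_on W F"
    "smooth_on (\<phi> ` W) (\<lambda>y. \<psi> (F (inv_into U \<phi> y)))"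
proof -
  obtain W where W: "x \<in> W" "smooth_map A B W F" using F by (auto simp: smooth_at_def)
  then have W': "open W" "continuous_on W F" by (auto simp: smooth_map_def)
  have "open (W \<inter> F -` V)"
    using continuous_open_preimage[OF W'(2,1) chart_homeo(1)[OF B V(1)]] .
  then have "open (U \<inter> W \<inter> F -` V)" using chart_homeo(1)[OF A U(1)] by (metis Int_assoc open_Int)
  moreover have "continuous_on (U \<inter> W \<inter> F -` V) F"
    by (rule continuous_on_subset[OF W'(2)]) auto
  ultimately show ?thesis
    using U(2) V(2) W(1) by (intro that[of "U \<inter> W \<inter> F -` V"] smooth_map_chart[OF W(2) U(1) V(1)]) auto
qed

lemma smooth_at_chartsI:
  assumes "smooth_manifold A" "smooth_manifold B" "(U, \<phi>) \<in> A" "(V, \<psi>) \<in> B"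
    "open W" "x \<in> W" "W \<subseteq> U" "F ` W \<subseteq> V" "continuous_on W F"
    "smooth_on (\<phi> ` W) (\<lambda>y. \<psi> (F (inv_into U \<phi> y)))"
  shows "smooth_at A B x F"
  using smooth_map_chartI[OF assms(1-5,7-10)] assms(6) by (auto simp: smooth_at_def)

lemma smooth_map_imp_at: "smooth_map A B W F \<Longrightarrow> x \<in> W \<Longrightarrow> smooth_at A B x F"
  by (auto simp: smooth_at_def)

lemma smooth_map_iff_at:
  fixes A :: "('p::{t2_space, second_countable_topology}, 'e::real_normed_vector) atlas"
    and B :: "('q::{t2_space, second_countable_topology}, 'f::real_normed_vector) atlas"
  assumes A: "smooth_manifold A" and B: "smooth_manifold B"
  shows "smooth_map A B W F \<longleftrightarrow> open W \<and> (\<forall>x\<in>W. smooth_at A B x F)"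
proof
  assume "smooth_map A B W F"
  then show "open W \<and> (\<forall>x\<in>W. smooth_at A B x F)"
    using smooth_map_imp_at smooth_map_def by metis
next
  assume R: "open W \<and> (\<forall>x\<in>W. smooth_at A B x F)"
  have "isCont F x" if "x \<in> W" for x
    using R that by (auto simp: smooth_at_def smooth_map_def continuous_on_eq_continuous_at)
  then have cont: "continuous_on W F" by (simp add: continuous_at_imp_continuous_on)
  show "smooth_map A B W F"
    unfolding smooth_map_def
  proof (intro conjI cont, use R in simp, safe)
    fix U \<phi> V \<psi> assume U: "(U, \<phi>) \<in> A" and V: "(V, \<psi>) \<in> B"
    show "smooth_on (\<phi> ` (U \<inter> W \<inter> F -` V)) (\<psi> \<circ> F \<circ> inv_into U \<phi>)"
    proof (rule smooth_on_local)
      fix y assume "y \<in> \<phi> ` (U \<inter> W \<inter> F -` V)"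
      then obtain p where p: "y = \<phi> p" "p \<in> U" "p \<in> W" "F p \<in> V" by auto
      obtain W' where W': "open W'" "p \<in> W'" "W' \<subseteq> U"
        "smooth_on (\<phi> ` W') (\<lambda>y. \<psi> (F (inv_into U \<phi> y)))"
        by (rule smooth_at_chartsD[OF A B R[THEN conjunct2, rule_format, OF p(3)] U p(2) V p(4)])
      show "\<exists>T. open T \<and> y \<in> T \<and> smooth_on T (\<psi> \<circ> F \<circ> inv_into U \<phi>)"
        using chart_open_image[OF A U W'(1,3)] W'(2,4) p(1)
        by (intro exI[of _ "\<phi> ` W'"]) (auto simp: o_def)
    qed
  qed
qed

lemma smooth_at_continuous: "smooth_at A B x F \<Longrightarrow> isCont F x"
  by (auto simp: smooth_at_def smooth_map_def continuous_on_eq_continuous_at)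

lemma smooth_at_compose:
  assumes A: "smooth_manifold A" and B: "smooth_manifold B" and C: "smooth_manifold C"
    and F: "smooth_at A B x F" and H: "smooth_at B C (F x) H"
  shows "smooth_at A C x (\<lambda>p. H (F p))"
proof -
  obtain U \<phi> where U: "(U, \<phi>) \<in> A" "x \<in> U" using chart_exists[OF A] .
  obtain V \<psi> where V: "(V, \<psi>) \<in> B" "F x \<in> V" using chart_exists[OF B] .
  obtain X \<theta> where X: "(X, \<theta>) \<in> C" "H (F x) \<in> X" using chart_exists[OF C] .
  obtain W where W: "open W" "x \<in> W" "W \<subseteq> U" "F ` W \<subseteq> V" "continuous_on W F"
    "smooth_on (\<phi> ` W) (\<lambda>y. \<psi> (F (inv_into U \<phi> y)))"
    using smooth_at_chartsD[OF A B F U V] .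
  obtain W' where W': "open W'" "F x \<in> W'" "W' \<subseteq> V" "H ` W' \<subseteq> X" "continuous_on W' H"
    "smooth_on (\<psi> ` W') (\<lambda>y. \<theta> (H (inv_into V \<psi> y)))"
    using smooth_at_chartsD[OF B C H V X] .
  define T where "T = W \<inter> F -` W'"
  have T: "open T" unfolding T_def using continuous_open_preimage[OF W(5,1) W'(1)] .
  have TU: "T \<subseteq> U" using W(3) by (auto simp: T_def)
  have oT: "open (\<phi> ` T)" using chart_open_image[OF A U(1) T TU] .
  have i: "inv_into U \<phi> (\<phi> p) = p" if "p \<in> T" for p using chart_inv[OF A U(1)] TU that by blast
  have j: "inv_into V \<psi> (\<psi> (F p)) = F p" if "p \<in> T" for p
    using chart_inv[OF B V(1)] W'(3) that by (auto simp: T_def)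
  have s: "smooth_on (\<phi> ` T) (\<lambda>y. \<psi> (F (inv_into U \<phi> y)))"
    by (rule smooth_on_subset[OF W(6)]) (auto simp: T_def)
  have "smooth_on (\<phi> ` T) (\<lambda>y. \<theta> (H (inv_into V \<psi> (\<psi> (F (inv_into U \<phi> y))))))"
    by (rule smooth_on_compose[OF manifold_finite_dim[OF B] oT s W'(6)]) (auto simp: i, auto simp: T_def)
  then have "smooth_on (\<phi> ` T) (\<lambda>y. \<theta> (H (F (inv_into U \<phi> y))))"
    by (rule smooth_on_cong[OF oT]) (auto simp: i j)
  moreover have "continuous_on T (\<lambda>p. H (F p))"
    by (rule continuous_on_compose2[OF W'(5) continuous_on_subset[OF W(5)]]) (auto simp: T_def)
  moreover have "(\<lambda>p. H (F p)) ` T \<subseteq> X" using W'(4) by (auto simp: T_def)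
  ultimately show ?thesis
    using smooth_at_chartsI[OF A C U(1) X(1) T, of x "\<lambda>p. H (F p)"] TU W(2) W'(2) by (auto simp: T_def)
qed

lemma smooth_at_id:
  assumes A: "smooth_manifold A" shows "smooth_at A A x (\<lambda>p. p)"
proof -
  obtain U \<phi> where U: "(U, \<phi>) \<in> A" "x \<in> U" using chart_exists[OF A] .
  have "smooth_on (\<phi> ` U) (\<lambda>y. \<phi> (inv_into U \<phi> y))"
    by (rule smooth_on_cong[OF chart_homeo(2)[OF A U(1)] smooth_on_id]) (auto simp: chart_inv[OF A U(1)])
  then show ?thesis
    using smooth_at_chartsI[OF A A U(1) U(1) chart_homeo(1)[OF A U(1)] U(2), of "\<lambda>p. p"] by auto
qed

lemma smooth_at_const:
  assumes A: "smooth_manifold A" and B: "smooth_manifold B" shows "smooth_at A B x (\<lambda>p. c)"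
proof -
  obtain U \<phi> where U: "(U, \<phi>) \<in> A" "x \<in> U" using chart_exists[OF A] .
  obtain V \<psi> where V: "(V, \<psi>) \<in> B" "c \<in> V" using chart_exists[OF B] .
  show ?thesis
    by (rule smooth_at_chartsI[OF A B U(1) V(1) chart_homeo(1)[OF A U(1)] U(2)])
      (use V(2) in \<open>auto intro: smooth_on_const\<close>)
qed

lemma inv_into_map_prod:
  assumes A: "smooth_manifold A" and B: "smooth_manifold B" and U: "(U, \<phi>) \<in> A" and V: "(V, \<psi>) \<in> B"
    and pq: "p \<in> U" "q \<in> V"
  shows "inv_into (U \<times> V) (map_prod \<phi> \<psi>) (\<phi> p, \<psi> q) = (p, q)"
proof -
  have "inj_on \<phi> U" by (rule inj_on_inverseI[of _ "inv_into U \<phi>"]) (rule chart_inv[OF A U])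
  moreover have "inj_on \<psi> V" by (rule inj_on_inverseI[of _ "inv_into V \<psi>"]) (rule chart_inv[OF B V])
  ultimately have "inj_on (map_prod \<phi> \<psi>) (U \<times> V)" by (rule map_prod_inj_on)
  from inv_into_f_f[OF this, of "(p, q)"] pq show ?thesis by simp
qed

lemma smooth_manifold_prod:
  fixes A :: "('p::{t2_space, second_countable_topology}, 'e::real_normed_vector) atlas"
    and B :: "('q::{t2_space, second_countable_topology}, 'f::real_normed_vector) atlas"
  assumes A: "smooth_manifold A" and B: "smooth_manifold B"
  shows "smooth_manifold (prod_atlas A B)"
  unfolding smooth_manifold_def
proof (intro conjI)
  show "\<exists>B::('e \<times> 'f) set. finite B \<and> span B = UNIV"
    using finite_dim_prod[OF manifold_finite_dim[OF A] manifold_finite_dim[OF B]] by (simp add: finite_dim_def)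
  show "(\<Union>(U, \<phi>)\<in>prod_atlas A B. U) = UNIV"
  proof (intro equalityI subsetI UNIV_I)
    fix z :: "'p \<times> 'q"
    obtain U \<phi> where U: "(U, \<phi>) \<in> A" "fst z \<in> U" using chart_exists[OF A] .
    obtain V \<psi> where V: "(V, \<psi>) \<in> B" "snd z \<in> V" using chart_exists[OF B] .
    have "(U \<times> V, map_prod \<phi> \<psi>) \<in> prod_atlas A B" using U V by (auto simp: prod_atlas_def)
    then show "z \<in> (\<Union>(U, \<phi>)\<in>prod_atlas A B. U)"
      by (rule UN_I) (use U(2) V(2) in \<open>auto simp: mem_Times_iff\<close>)
  qed
  show "\<forall>(U, \<phi>)\<in>prod_atlas A B. open U \<and> open (\<phi> ` U) \<and> homeomorphism U (\<phi> ` U) \<phi> (inv_into U \<phi>)"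
  proof (clarify)
    fix Z \<zeta> assume "(Z, \<zeta>) \<in> prod_atlas A B"
    then obtain U \<phi> V \<psi> where Z: "Z = U \<times> V" "\<zeta> = map_prod \<phi> \<psi>" and U: "(U, \<phi>) \<in> A" and V: "(V, \<psi>) \<in> B"
      by (auto simp: prod_atlas_def)
    have im: "\<zeta> ` Z = \<phi> ` U \<times> \<psi> ` V" by (auto simp: Z)
    have inv: "inv_into Z \<zeta> (\<phi> p, \<psi> q) = (p, q)" if "p \<in> U" "q \<in> V" for p q
      unfolding Z by (rule inv_into_map_prod[OF A B U V that])
    have "continuous_on (\<phi> ` U \<times> \<psi> ` V) (\<lambda>y. (inv_into U \<phi> (fst y), inv_into V \<psi> (snd y)))"
      by (intro continuous_on_Pair continuous_on_compose2[OF chart_continuous(2)[OF A U]]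
          continuous_on_compose2[OF chart_continuous(2)[OF B V]] continuous_on_fst continuous_on_snd continuous_on_id)
        auto
    then have c: "continuous_on (\<zeta> ` Z) (inv_into Z \<zeta>)"
      unfolding im by (rule continuous_on_eq) (auto simp: inv chart_inv[OF A U] chart_inv[OF B V])
    have "continuous_on Z (\<lambda>y. (\<phi> (fst y), \<psi> (snd y)))"
      unfolding Z
      by (intro continuous_on_Pair continuous_on_compose2[OF chart_continuous(1)[OF A U]]
          continuous_on_compose2[OF chart_continuous(1)[OF B V]] continuous_on_fst continuous_on_snd continuous_on_id)
        auto
    then have c': "continuous_on Z \<zeta>" by (simp add: Z map_prod_def case_prod_unfold)
    have "homeomorphism Z (\<zeta> ` Z) \<zeta> (inv_into Z \<zeta>)"
      by (rule homeomorphismI[OF c' c]) (auto simp: Z inv[unfolded Z])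
    then show "open Z \<and> open (\<zeta> ` Z) \<and> homeomorphism Z (\<zeta> ` Z) \<zeta> (inv_into Z \<zeta>)"
      using chart_homeo(1,2)[OF A U] chart_homeo(1,2)[OF B V] im by (auto simp: Z(1) open_Times)
  qed
  show "\<forall>(U, \<phi>)\<in>prod_atlas A B. \<forall>(V, \<psi>)\<in>prod_atlas A B. smooth_on (\<phi> ` (U \<inter> V)) (\<psi> \<circ> inv_into U \<phi>)"
  proof (clarify)
    fix Z \<zeta> Z' \<zeta>' assume "(Z, \<zeta>) \<in> prod_atlas A B" "(Z', \<zeta>') \<in> prod_atlas A B"
    then obtain U \<phi> V \<psi> U' \<phi>' V' \<psi>' where Z: "Z = U \<times> V" "\<zeta> = map_prod \<phi> \<psi>" "Z' = U' \<times> V'" "\<zeta>' = map_prod \<phi>' \<psi>'"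
      and U: "(U, \<phi>) \<in> A" and V: "(V, \<psi>) \<in> B" and U': "(U', \<phi>') \<in> A" and V': "(V', \<psi>') \<in> B"
      by (auto simp: prod_atlas_def)
    have im: "\<zeta> ` (Z \<inter> Z') = \<phi> ` (U \<inter> U') \<times> \<psi> ` (V \<inter> V')" by (auto simp: Z)
    have ou: "open (\<phi> ` (U \<inter> U'))" "open (\<psi> ` (V \<inter> V'))"
      by (auto intro!: chart_open_image[OF A U] chart_open_image[OF B V] open_Int
          chart_homeo(1)[OF A U] chart_homeo(1)[OF A U'] chart_homeo(1)[OF B V] chart_homeo(1)[OF B V'])
    then have o: "open (\<phi> ` (U \<inter> U') \<times> \<psi> ` (V \<inter> V'))" by (rule open_Times)
    have s1: "smooth_on (\<phi> ` (U \<inter> U') \<times> \<psi> ` (V \<inter> V')) (\<lambda>y. \<phi>' (inv_into U \<phi> (fst y)))"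
      by (rule smooth_on_compose[OF manifold_finite_dim[OF A] o smooth_on_linear[OF bounded_linear_fst]
            chart_transition[OF A U U']]) auto
    have s2: "smooth_on (\<phi> ` (U \<inter> U') \<times> \<psi> ` (V \<inter> V')) (\<lambda>y. \<psi>' (inv_into V \<psi> (snd y)))"
      by (rule smooth_on_compose[OF manifold_finite_dim[OF B] o smooth_on_linear[OF bounded_linear_snd]
            chart_transition[OF B V V']]) auto
    show "smooth_on (\<zeta> ` (Z \<inter> Z')) (\<zeta>' \<circ> inv_into Z \<zeta>)"
      unfolding im
      by (rule smooth_on_cong[OF o smooth_on_Pair[OF o s1 s2]])
        (auto simp: Z inv_into_map_prod[OF A B U V] chart_inv[OF A U] chart_inv[OF B V])
  qed
qed

lemma smooth_at_fst:
  assumes A: "smooth_manifold A" and B: "smooth_manifold B"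
  shows "smooth_at (prod_atlas A B) A z fst"
proof -
  obtain U \<phi> where U: "(U, \<phi>) \<in> A" "fst z \<in> U" using chart_exists[OF A] .
  obtain V \<psi> where V: "(V, \<psi>) \<in> B" "snd z \<in> V" using chart_exists[OF B] .
  have UV: "(U \<times> V, map_prod \<phi> \<psi>) \<in> prod_atlas A B" using U V by (auto simp: prod_atlas_def)
  note P = smooth_manifold_prod[OF A B]
  have "smooth_on (map_prod \<phi> \<psi> ` (U \<times> V)) (\<lambda>y. \<phi> (fst (inv_into (U \<times> V) (map_prod \<phi> \<psi>) y)))"
    by (rule smooth_on_cong[OF chart_homeo(2)[OF P UV] smooth_on_linear[OF bounded_linear_fst]])
      (auto simp: inv_into_map_prod[OF A B U(1) V(1)])
  then show ?thesis
    by (intro smooth_at_chartsI[OF P A UV U(1) chart_homeo(1)[OF P UV]] continuous_on_fst continuous_on_id)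
      (use U(2) V(2) in \<open>auto simp: mem_Times_iff\<close>)
qed

lemma smooth_at_snd:
  assumes A: "smooth_manifold A" and B: "smooth_manifold B"
  shows "smooth_at (prod_atlas A B) B z snd"
proof -
  obtain U \<phi> where U: "(U, \<phi>) \<in> A" "fst z \<in> U" using chart_exists[OF A] .
  obtain V \<psi> where V: "(V, \<psi>) \<in> B" "snd z \<in> V" using chart_exists[OF B] .
  have UV: "(U \<times> V, map_prod \<phi> \<psi>) \<in> prod_atlas A B" using U V by (auto simp: prod_atlas_def)
  note P = smooth_manifold_prod[OF A B]
  have "smooth_on (map_prod \<phi> \<psi> ` (U \<times> V)) (\<lambda>y. \<psi> (snd (inv_into (U \<times> V) (map_prod \<phi> \<psi>) y)))"
    by (rule smooth_on_cong[OF chart_homeo(2)[OF P UV] smooth_on_linear[OF bounded_linear_snd]])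
      (auto simp: inv_into_map_prod[OF A B U(1) V(1)])
  then show ?thesis
    by (intro smooth_at_chartsI[OF P B UV V(1) chart_homeo(1)[OF P UV]] continuous_on_snd continuous_on_id)
      (use U(2) V(2) in \<open>auto simp: mem_Times_iff\<close>)
qed

lemma smooth_at_Pair:
  assumes A: "smooth_manifold A" and B: "smooth_manifold B" and C: "smooth_manifold C"
    and F: "smooth_at A B x F" and H: "smooth_at A C x H"
  shows "smooth_at A (prod_atlas B C) x (\<lambda>p. (F p, H p))"
proof -
  obtain U \<phi> where U: "(U, \<phi>) \<in> A" "x \<in> U" using chart_exists[OF A] .
  obtain V \<psi> where V: "(V, \<psi>) \<in> B" "F x \<in> V" using chart_exists[OF B] .
  obtain X \<theta> where X: "(X, \<theta>) \<in> C" "H x \<in> X" using chart_exists[OF C] .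
  obtain W where W: "open W" "x \<in> W" "W \<subseteq> U" "F ` W \<subseteq> V" "continuous_on W F"
    "smooth_on (\<phi> ` W) (\<lambda>y. \<psi> (F (inv_into U \<phi> y)))"
    using smooth_at_chartsD[OF A B F U V] .
  obtain W' where W': "open W'" "x \<in> W'" "W' \<subseteq> U" "H ` W' \<subseteq> X" "continuous_on W' H"
    "smooth_on (\<phi> ` W') (\<lambda>y. \<theta> (H (inv_into U \<phi> y)))"
    using smooth_at_chartsD[OF A C H U X] .
  have VX: "(V \<times> X, map_prod \<psi> \<theta>) \<in> prod_atlas B C" using V X by (auto simp: prod_atlas_def)
  have o: "open (W \<inter> W')" using W W' by auto
  then have o': "open (\<phi> ` (W \<inter> W'))" by (rule chart_open_image[OF A U(1)]) (use W in auto)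
  have "smooth_on (\<phi> ` (W \<inter> W')) (\<lambda>y. (\<psi> (F (inv_into U \<phi> y)), \<theta> (H (inv_into U \<phi> y))))"
    by (rule smooth_on_Pair[OF o' smooth_on_subset[OF W(6)] smooth_on_subset[OF W'(6)]]) auto
  moreover have "continuous_on (W \<inter> W') (\<lambda>p. (F p, H p))"
    by (rule continuous_on_Pair[OF continuous_on_subset[OF W(5)] continuous_on_subset[OF W'(5)]]) auto
  ultimately show ?thesis
    using W W' by (intro smooth_at_chartsI[OF A smooth_manifold_prod[OF B C] U(1) VX o]) auto
qed

lemma smooth_manifold_real: "smooth_manifold (std_atlas :: (real, real) atlas)"
proof -
  have "homeomorphism UNIV UNIV (\<lambda>x::real. x) (\<lambda>x. x)" by (rule homeomorphismI) auto
  moreover have "inv (\<lambda>x::real. x) = (\<lambda>x. x)" by (rule inv_unique_comp) auto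
  ultimately show ?thesis
    using finite_dim_real smooth_on_id[of "UNIV :: real set"]
    by (simp add: smooth_manifold_def std_atlas_def finite_dim_def o_def)
qed

lemma smooth_near_chart:
  assumes A: "smooth_manifold A" and U: "(U, \<phi>) \<in> A" "x \<in> U"
  shows "smooth_near A x f \<longleftrightarrow>
    (\<exists>W. open W \<and> x \<in> W \<and> W \<subseteq> U \<and> smooth_on (\<phi> ` W) (\<lambda>y. f (inv_into U \<phi> y)))"
proof
  have std: "(UNIV, \<lambda>x. x) \<in> (std_atlas :: (real, real) atlas)" by (simp add: std_atlas_def)
  {
    assume "smooth_near A x f"
    then have "smooth_at A std_atlas x f" by (simp add: smooth_near_iff_at)
    then show "\<exists>W. open W \<and> x \<in> W \<and> W \<subseteq> U \<and> smooth_on (\<phi> ` W) (\<lambda>y. f (inv_into U \<phi> y))"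
      using smooth_at_chartsD[OF A smooth_manifold_real _ U std UNIV_I] by metis
  }
  assume "\<exists>W. open W \<and> x \<in> W \<and> W \<subseteq> U \<and> smooth_on (\<phi> ` W) (\<lambda>y. f (inv_into U \<phi> y))"
  then obtain W where W: "open W" "x \<in> W" "W \<subseteq> U" "smooth_on (\<phi> ` W) (\<lambda>y. f (inv_into U \<phi> y))" by blast
  have "continuous_on W (\<lambda>p. f (inv_into U \<phi> (\<phi> p)))"
    by (rule continuous_on_compose2[OF smooth_on_continuous[OF W(4)]
          continuous_on_subset[OF chart_continuous(1)[OF A U(1)] W(3)]]) auto
  then have "continuous_on W f"
    by (rule continuous_on_eq) (use W(3) chart_inv[OF A U(1)] in auto)
  then show "smooth_near A x f"
    unfolding smooth_near_iff_at
    using smooth_at_chartsI[OF A smooth_manifold_real U(1) std W(1-3) subset_UNIV] W(4) by blast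
qed

text \<open>Stated for an arbitrary smoothness-preserving operation so that sums and products share the
  comparison of domains.\<close>

lemma smooth_near_binary:
  assumes A: "smooth_manifold A" and f: "smooth_near A x f" and g: "smooth_near A x g"
    and op: "\<And>S (F::'e::real_normed_vector \<Rightarrow> real) G. open S \<Longrightarrow> smooth_on S F \<Longrightarrow> smooth_on S G \<Longrightarrow> smooth_on S (\<lambda>y. h (F y) (G y))"
  shows "smooth_near (A :: ('p::{t2_space, second_countable_topology}, 'e) atlas) x (\<lambda>p. h (f p) (g p))"
proof -
  obtain U \<phi> where U: "(U, \<phi>) \<in> A" "x \<in> U" using chart_exists[OF A] .
  obtain W where W: "open W" "x \<in> W" "W \<subseteq> U" "smooth_on (\<phi> ` W) (\<lambda>y. f (inv_into U \<phi> y))"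
    using f[unfolded smooth_near_chart[OF A U]] by (elim exE conjE)
  obtain W' where W': "open W'" "x \<in> W'" "W' \<subseteq> U" "smooth_on (\<phi> ` W') (\<lambda>y. g (inv_into U \<phi> y))"
    using g[unfolded smooth_near_chart[OF A U]] by (elim exE conjE)
  have o: "open (\<phi> ` (W \<inter> W'))"
    by (rule chart_open_image[OF A U(1)]) (use W W' in auto)
  have "smooth_on (\<phi> ` (W \<inter> W')) (\<lambda>y. h (f (inv_into U \<phi> y)) (g (inv_into U \<phi> y)))"
    by (rule op[OF o smooth_on_subset[OF W(4)] smooth_on_subset[OF W'(4)]]) auto
  then show ?thesis
    unfolding smooth_near_chart[OF A U]
    by (intro exI[of _ "W \<inter> W'"] conjI open_Int IntI le_infI1) (assumption | rule W(1) W'(1) W(2) W'(2) W(3))+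
qed

lemma smooth_near_mult:
  assumes "smooth_manifold A" "smooth_near A x f" "smooth_near A x g"
  shows "smooth_near A x (\<lambda>p. f p * g p)"
  using assms by (rule smooth_near_binary) (rule smooth_on_bilinear[OF _ bounded_bilinear_mult])

lemma smooth_near_add:
  assumes "smooth_manifold A" "smooth_near A x f" "smooth_near A x g"
  shows "smooth_near A x (\<lambda>p. f p + g p)"
  using assms by (rule smooth_near_binary) (rule smooth_on_add)

lemma smooth_near_const: "smooth_manifold A \<Longrightarrow> smooth_near A x (\<lambda>p. c)"
  unfolding smooth_near_iff_at by (rule smooth_at_const[OF _ smooth_manifold_real])

lemma smooth_near_lincomb:
  assumes "smooth_manifold A" "smooth_near A x f" "smooth_near A x g"
  shows "smooth_near A x (\<lambda>p. a * f p + b * g p)"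
  by (intro smooth_near_add smooth_near_mult smooth_near_const assms)

lemma smooth_near_diff:
  assumes "smooth_manifold A" "smooth_near A x f" "smooth_near A x g"
  shows "smooth_near A x (\<lambda>p. f p - g p)"
  using smooth_near_lincomb[OF assms, of 1 "-1"] by simp

lemma smooth_near_compose:
  assumes "smooth_manifold A" "smooth_manifold B" "smooth_at A B x F" "smooth_near B (F x) f"
  shows "smooth_near A x (\<lambda>p. f (F p))"
  using smooth_at_compose[OF assms(1,2) smooth_manifold_real assms(3)] assms(4) by (simp add: smooth_near_iff_at)

lemma smooth_functions_iff:
  "smooth_manifold A \<Longrightarrow> f \<in> smooth_functions A \<longleftrightarrow> (\<forall>x. smooth_near A x f)"
  by (simp add: smooth_functions_def smooth_map_iff_at[OF _ smooth_manifold_real] smooth_near_iff_at)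

section \<open>Tangent and cotangent vectors\<close>

lemma std_chart: "(UNIV, \<lambda>x. x) \<in> std_atlas"
  by (simp add: std_atlas_def)

lemma inv_ident: "inv_into UNIV (\<lambda>x. x) = (\<lambda>x. x)"
  by (rule inv_unique_comp) auto

lemma tangent_spaceE:
  assumes "v \<in> tangent_space A C x"
  obtains \<gamma> where "\<gamma> 0 = x" "smooth_at std_atlas A 0 \<gamma>" "\<forall>\<^sub>F t in nhds 0. \<gamma> t \<in> C" "v = velocity A \<gamma>"
proof -
  obtain \<gamma> r where \<gamma>: "v = velocity A \<gamma>" "\<gamma> 0 = x" "r > 0" "smooth_map std_atlas A {-r<..<r} \<gamma>"
    "\<gamma> ` {-r<..<r} \<subseteq> C"
    using assms by (auto simp: tangent_space_def curves_in_def)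
  have "\<forall>\<^sub>F t in nhds 0. t \<in> {-r<..<r}" using \<gamma>(3) by (intro eventually_nhds_in_open) auto
  then have "\<forall>\<^sub>F t in nhds 0. \<gamma> t \<in> C" by eventually_elim (use \<gamma>(5) in blast)
  moreover have "smooth_at std_atlas A 0 \<gamma>" using smooth_map_imp_at[OF \<gamma>(4), of 0] \<gamma>(3) by simp
  ultimately show ?thesis using that \<gamma>(1,2) by blast
qed

lemma tangent_spaceI:
  assumes "\<gamma> 0 = x" "smooth_at std_atlas A 0 \<gamma>" "\<forall>\<^sub>F t in nhds 0. \<gamma> t \<in> C"
  shows "velocity A \<gamma> \<in> tangent_space A C x"
proof -
  obtain W where W: "0 \<in> W" "smooth_map std_atlas A W \<gamma>" using assms(2) by (auto simp: smooth_at_def)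
  then have "open W" by (simp add: smooth_map_def)
  then have "\<forall>\<^sub>F t in nhds 0. t \<in> W" using W(1) by (rule eventually_nhds_in_open)
  with assms(3) have "\<forall>\<^sub>F t in nhds 0. t \<in> W \<and> \<gamma> t \<in> C" by eventually_elim auto
  then obtain r where r: "r > 0" "\<And>t. dist t 0 < r \<Longrightarrow> t \<in> W \<and> \<gamma> t \<in> C"
    by (auto simp: eventually_nhds_metric)
  have "smooth_map std_atlas A {-r<..<r} \<gamma>"
    by (rule smooth_map_open_subset[OF W(2)]) (use r(2) in \<open>auto simp: dist_real_def\<close>)
  moreover have "\<gamma> ` {-r<..<r} \<subseteq> C" using r(2) by (auto simp: dist_real_def)
  ultimately show ?thesis using assms(1) r(1) by (auto simp: tangent_space_def curves_in_def)
qed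

lemma tangent_spaceI_UNIV:
  "smooth_at std_atlas A 0 \<gamma> \<Longrightarrow> velocity A \<gamma> \<in> tangent_space A UNIV (\<gamma> 0)"
  by (rule tangent_spaceI) auto

lemma tangent_space_subset: "v \<in> tangent_space A C x \<Longrightarrow> v \<in> tangent_space A UNIV x"
  by (erule tangent_spaceE) (use tangent_spaceI_UNIV in blast)

text \<open>The chain rule in a chart: along \<open>\<gamma>\<close> a function sees only the chart velocity \<open>w\<close>.\<close>

lemma curve_chart_derivative:
  assumes A: "smooth_manifold A" and \<gamma>: "smooth_at std_atlas A 0 \<gamma>" and U: "(U, \<phi>) \<in> A" "\<gamma> 0 \<in> U"
  shows "\<exists>w. ((\<lambda>t. \<phi> (\<gamma> t)) has_vector_derivative w) (at 0)"
    and "((\<lambda>t. \<phi> (\<gamma> t)) has_vector_derivative w) (at 0) \<Longrightarrow> smooth_near A (\<gamma> 0) f \<Longrightarrow>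
      ((\<lambda>t. f (\<gamma> t)) has_real_derivative frechet_derivative (\<lambda>y. f (inv_into U \<phi> y)) (at (\<phi> (\<gamma> 0))) w) (at 0)"
proof -
  obtain W where W: "open W" "0 \<in> W" "\<gamma> ` W \<subseteq> U" "smooth_on W (\<lambda>t. \<phi> (\<gamma> t))"
    using smooth_at_chartsD[OF smooth_manifold_real A \<gamma> std_chart UNIV_I U]
    unfolding inv_ident by (metis image_ident)
  note d = smooth_on_has_derivative[OF W(4,2)]
  show "\<exists>w. ((\<lambda>t. \<phi> (\<gamma> t)) has_vector_derivative w) (at 0)"
    using differentiableI[OF d] vector_derivative_works by blast
  assume w: "((\<lambda>t. \<phi> (\<gamma> t)) has_vector_derivative w) (at 0)" and f: "smooth_near A (\<gamma> 0) f"
  obtain W' where W': "\<gamma> 0 \<in> W'" "smooth_on (\<phi> ` W') (\<lambda>y. f (inv_into U \<phi> y))"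
    using f[unfolded smooth_near_chart[OF A U]] by (elim exE conjE)
  define D where "D = frechet_derivative (\<lambda>y. f (inv_into U \<phi> y)) (at (\<phi> (\<gamma> 0)))"
  have D: "((\<lambda>y. f (inv_into U \<phi> y)) has_derivative D) (at (\<phi> (\<gamma> 0)))"
    unfolding D_def by (rule smooth_on_has_derivative[OF W'(2)]) (use W'(1) in auto)
  have "((\<lambda>t. f (inv_into U \<phi> (\<phi> (\<gamma> t)))) has_derivative (\<lambda>h. D (h *\<^sub>R w))) (at 0)"
    by (rule has_derivative_compose[OF w[unfolded has_vector_derivative_def] D])
  then have "((\<lambda>t. f (\<gamma> t)) has_derivative (\<lambda>h. D (h *\<^sub>R w))) (at 0)"
    by (rule has_derivative_transform_within_open[OF _ W(1,2)])
      (use W(3) chart_inv[OF A U(1)] in auto)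
  moreover have "D (h *\<^sub>R w) = D w * h" for h
    using linear_cmul[OF has_derivative_linear[OF D], of h w] by simp
  ultimately show "((\<lambda>t. f (\<gamma> t)) has_real_derivative D w) (at 0)"
    by (simp add: has_field_derivative_def)
qed

text \<open>The tangent vector at \<open>x\<close> with components \<open>w\<close> in the chart, in the encoding of
  \<^const>\<open>velocity\<close>.\<close>

definition chart_vector :: "('p::topological_space, 'e::real_normed_vector) atlas \<Rightarrow> 'p set \<Rightarrow>
    ('p \<Rightarrow> 'e) \<Rightarrow> 'p \<Rightarrow> 'e \<Rightarrow> 'p tvec" where
  "chart_vector A U \<phi> x w = (\<lambda>f. if smooth_near A x f
     then frechet_derivative (\<lambda>y. f (inv_into U \<phi> y)) (at (\<phi> x)) w else 0)"

lemma velocity_eq_chart_vector: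
  assumes A: "smooth_manifold A" and \<gamma>: "smooth_at std_atlas A 0 \<gamma>" and U: "(U, \<phi>) \<in> A" "\<gamma> 0 \<in> U"
    and w: "((\<lambda>t. \<phi> (\<gamma> t)) has_vector_derivative w) (at 0)"
  shows "velocity A \<gamma> = chart_vector A U \<phi> (\<gamma> 0) w"
  using DERIV_imp_deriv[OF curve_chart_derivative(2)[OF A \<gamma> U w]]
  by (auto simp: velocity_def chart_vector_def)

lemma velocity_has_derivative:
  assumes A: "smooth_manifold A" and \<gamma>: "smooth_at std_atlas A 0 \<gamma>" and f: "smooth_near A (\<gamma> 0) f"
  shows "((\<lambda>t. f (\<gamma> t)) has_real_derivative velocity A \<gamma> f) (at 0)"
proof -
  obtain U \<phi> where U: "(U, \<phi>) \<in> A" "\<gamma> 0 \<in> U" using chart_exists[OF A] .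
  obtain w where w: "((\<lambda>t. \<phi> (\<gamma> t)) has_vector_derivative w) (at 0)"
    using curve_chart_derivative(1)[OF A \<gamma> U] by blast
  show ?thesis
    using curve_chart_derivative(2)[OF A \<gamma> U w f] velocity_eq_chart_vector[OF A \<gamma> U w] f
    by (simp add: chart_vector_def)
qed

lemma velocity_eqI:
  assumes "smooth_manifold A" "smooth_at std_atlas A 0 \<gamma>" "smooth_near A (\<gamma> 0) f"
    "((\<lambda>t. f (\<gamma> t)) has_real_derivative d) (at 0)"
  shows "velocity A \<gamma> f = d"
  using DERIV_unique[OF velocity_has_derivative[OF assms(1-3)] assms(4)] .

lemma lift_chart_curve:
  assumes A: "smooth_manifold A" and U: "(U, \<phi>) \<in> A" "x \<in> U"
    and c: "open T" "0 \<in> T" "smooth_on T c" "c 0 = \<phi> x" "(c has_vector_derivative w) (at 0)"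
  defines "\<gamma> \<equiv> \<lambda>t::real. inv_into U \<phi> (c t)"
  shows "\<gamma> 0 = x" "smooth_at std_atlas A 0 \<gamma>" "velocity A \<gamma> = chart_vector A U \<phi> x w"
    "\<forall>\<^sub>F t in nhds 0. \<gamma> t \<in> U \<and> \<phi> (\<gamma> t) = c t"
proof -
  show g0: "\<gamma> 0 = x" using c(4) chart_inv[OF A U] by (simp add: \<gamma>_def)
  define S where "S = T \<inter> c -` (\<phi> ` U)"
  have S: "open S" unfolding S_def
    using continuous_open_preimage[OF smooth_on_continuous[OF c(3)] c(1) chart_homeo(2)[OF A U(1)]] .
  have S0: "0 \<in> S" using c(2,4) U(2) by (auto simp: S_def)
  have gS: "\<gamma> t \<in> U" "\<phi> (\<gamma> t) = c t" if "t \<in> S" for t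
    using that inv_into_into[of "c t" \<phi> U] f_inv_into_f[of "c t" \<phi> U] by (auto simp: S_def \<gamma>_def)
  have "smooth_on S (\<lambda>t. \<phi> (\<gamma> t))"
    by (rule smooth_on_cong[OF S smooth_on_subset[OF c(3)]]) (use gS in \<open>auto simp: S_def\<close>)
  moreover have "continuous_on S \<gamma>"
    unfolding \<gamma>_def
    by (rule continuous_on_compose2[OF chart_continuous(2)[OF A U(1)] continuous_on_subset[OF smooth_on_continuous[OF c(3)]]])
      (auto simp: S_def)
  ultimately show sm: "smooth_at std_atlas A 0 \<gamma>"
    by (intro smooth_at_chartsI[OF smooth_manifold_real A std_chart U(1) S S0])
      (auto simp: inv_ident gS)
  show ev: "\<forall>\<^sub>F t in nhds 0. \<gamma> t \<in> U \<and> \<phi> (\<gamma> t) = c t"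
    using S S0 gS by (auto simp: eventually_nhds)
  have "((\<lambda>t. \<phi> (\<gamma> t)) has_vector_derivative w) (at 0)"
    using c(5) S S0 by (rule has_vector_derivative_transform_within_open) (simp add: gS)
  then show "velocity A \<gamma> = chart_vector A U \<phi> x w"
    using velocity_eq_chart_vector[OF A sm U(1)] g0 U(2) by simp
qed

text \<open>In a chart, the tangent space is the image of the model space; straight lines realise all vectors.\<close>

lemma tangent_space_eq_range:
  assumes A: "smooth_manifold A" and U: "(U, \<phi>) \<in> A" "x \<in> U"
  shows "tangent_space A UNIV x = range (chart_vector A U \<phi> x)"
proof (intro equalityI subsetI)
  fix v assume "v \<in> tangent_space A UNIV x"
  then obtain \<gamma> where \<gamma>: "\<gamma> 0 = x" "smooth_at std_atlas A 0 \<gamma>" "v = velocity A \<gamma>"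
    by (rule tangent_spaceE)
  obtain w where "((\<lambda>t. \<phi> (\<gamma> t)) has_vector_derivative w) (at 0)"
    using curve_chart_derivative(1)[OF A \<gamma>(2) U(1)] \<gamma>(1) U(2) by auto
  then show "v \<in> range (chart_vector A U \<phi> x)"
    using velocity_eq_chart_vector[OF A \<gamma>(2) U(1), of w] \<gamma>(1,3) U(2) by auto
next
  fix v assume "v \<in> range (chart_vector A U \<phi> x)"
  then obtain w where v: "v = chart_vector A U \<phi> x w" by auto
  define c where "c = (\<lambda>t. t *\<^sub>R w + \<phi> x)"
  have "smooth_on UNIV c"
    unfolding c_def
    by (intro smooth_on_add smooth_on_const smooth_on_linear bounded_linear_scaleR_left) simp
  moreover have "(c has_vector_derivative w) (at 0)"
    unfolding c_def by (auto intro!: derivative_eq_intros)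
  ultimately have "velocity A (\<lambda>t. inv_into U \<phi> (c t)) = v" "inv_into U \<phi> (c 0) = x"
    "smooth_at std_atlas A 0 (\<lambda>t. inv_into U \<phi> (c t))"
    using lift_chart_curve[OF A U open_UNIV UNIV_I, of c w] v by (auto simp: c_def)
  then show "v \<in> tangent_space A UNIV x" using tangent_spaceI_UNIV by metis
qed

lemma chart_function_derivative:
  assumes A: "smooth_manifold A" and U: "(U, \<phi>) \<in> A" "x \<in> U" and f: "smooth_near A x f"
  shows "((\<lambda>y. f (inv_into U \<phi> y)) has_derivative (\<lambda>w. chart_vector A U \<phi> x w f)) (at (\<phi> x))"
proof -
  obtain W where W: "x \<in> W" "smooth_on (\<phi> ` W) (\<lambda>y. f (inv_into U \<phi> y))"
    using f[unfolded smooth_near_chart[OF A U]] by (elim exE conjE)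
  then show ?thesis using smooth_on_has_derivative[OF W(2), of "\<phi> x"] f by (simp add: chart_vector_def)
qed

lemma chart_linear_function:
  fixes l :: "'e::real_normed_vector \<Rightarrow> real"
  assumes A: "smooth_manifold A" and U: "(U, \<phi>) \<in> A" "x \<in> U" and l: "bounded_linear l"
  shows "smooth_near A x (\<lambda>p. l (\<phi> p))" "chart_vector A U \<phi> x w (\<lambda>p. l (\<phi> p)) = l w"
proof -
  show sm: "smooth_near A x (\<lambda>p. l (\<phi> p))"
    unfolding smooth_near_chart[OF A U]
    by (intro exI[of _ U] conjI chart_homeo(1)[OF A U(1)] U(2) subset_refl
        smooth_on_cong[OF chart_homeo(2)[OF A U(1)] smooth_on_linear[OF l]])
      (auto simp: chart_inv[OF A U(1)])
  have "(l has_derivative (\<lambda>w. chart_vector A U \<phi> x w (\<lambda>p. l (\<phi> p)))) (at (\<phi> x))"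
    by (rule has_derivative_transform_within_open[OF chart_function_derivative[OF A U sm] chart_homeo(2)[OF A U(1)]])
      (use U(2) chart_inv[OF A U(1)] in auto)
  from has_derivative_unique[OF this bounded_linear_imp_has_derivative[OF l]]
  show "chart_vector A U \<phi> x w (\<lambda>p. l (\<phi> p)) = l w" by metis
qed

lemma chart_vector_lincomb:
  assumes A: "smooth_manifold A" and U: "(U, \<phi>) \<in> A" "x \<in> U"
  shows "chart_vector A U \<phi> x (a *\<^sub>R w + b *\<^sub>R w') = (\<lambda>f. a * chart_vector A U \<phi> x w f + b * chart_vector A U \<phi> x w' f)"
proof
  fix f
  show "chart_vector A U \<phi> x (a *\<^sub>R w + b *\<^sub>R w') f = a * chart_vector A U \<phi> x w f + b * chart_vector A U \<phi> x w' f"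
  proof (cases "smooth_near A x f")
    case True
    have "linear (\<lambda>w. chart_vector A U \<phi> x w f)"
      using has_derivative_linear[OF chart_function_derivative[OF A U True]] .
    from linear_add[OF this] linear_cmul[OF this] show ?thesis by simp
  qed (simp add: chart_vector_def)
qed

lemma tangent_lincomb:
  assumes A: "smooth_manifold A" and "u \<in> tangent_space A UNIV x" "v \<in> tangent_space A UNIV x"
  shows "(\<lambda>f. a * u f + b * v f) \<in> tangent_space A UNIV x"
proof -
  obtain U \<phi> where U: "(U, \<phi>) \<in> A" "x \<in> U" using chart_exists[OF A] .
  obtain w w' where "u = chart_vector A U \<phi> x w" "v = chart_vector A U \<phi> x w'"
    using assms(2,3) by (auto simp: tangent_space_eq_range[OF A U])
  then have "(\<lambda>f. a * u f + b * v f) = chart_vector A U \<phi> x (a *\<^sub>R w + b *\<^sub>R w')"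
    by (simp add: chart_vector_lincomb[OF A U])
  then show ?thesis by (simp add: tangent_space_eq_range[OF A U])
qed

lemma tangent_not_smooth:
  "v \<in> tangent_space A UNIV x \<Longrightarrow> \<not> smooth_near A x f \<Longrightarrow> v f = 0"
  by (auto simp: tangent_space_def velocity_def curves_in_def)

lemma tangent_eqI:
  assumes "u \<in> tangent_space A UNIV x" "v \<in> tangent_space A UNIV x" "\<And>f. smooth_near A x f \<Longrightarrow> u f = v f"
  shows "u = v"
proof
  show "u f = v f" for f
    using assms tangent_not_smooth[of u A x f] tangent_not_smooth[of v A x f] by (cases "smooth_near A x f") auto
qed

lemma tangent_function_lincomb:
  assumes A: "smooth_manifold A" and v: "v \<in> tangent_space A UNIV x"
    and f: "smooth_near A x f" and g: "smooth_near A x g"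
  shows "v (\<lambda>p. a * f p + b * g p) = a * v f + b * v g"
proof -
  obtain \<gamma> where \<gamma>: "\<gamma> 0 = x" "smooth_at std_atlas A 0 \<gamma>" "v = velocity A \<gamma>"
    using v by (rule tangent_spaceE)
  have "((\<lambda>t. a * f (\<gamma> t) + b * g (\<gamma> t)) has_real_derivative (a * velocity A \<gamma> f + b * velocity A \<gamma> g)) (at 0)"
    using velocity_has_derivative[OF A \<gamma>(2)] f g \<gamma>(1) by (auto intro!: derivative_eq_intros)
  then show ?thesis
    using velocity_eqI[OF A \<gamma>(2)] smooth_near_lincomb[OF A f g] \<gamma>(1,3) by blast
qed

lemma tangent_const:
  assumes A: "smooth_manifold A" and v: "v \<in> tangent_space A UNIV x" shows "v (\<lambda>p. c) = 0"
proof -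
  obtain \<gamma> where \<gamma>: "\<gamma> 0 = x" "smooth_at std_atlas A 0 \<gamma>" "v = velocity A \<gamma>"
    using v by (rule tangent_spaceE)
  show ?thesis unfolding \<gamma>(3) by (rule velocity_eqI[OF A \<gamma>(2) smooth_near_const[OF A]]) simp
qed

lemma differential_velocity:
  assumes A: "smooth_manifold A" and B: "smooth_manifold B" and \<gamma>: "smooth_at std_atlas A 0 \<gamma>"
    and F: "smooth_at A B (\<gamma> 0) F"
  shows "differential B F (\<gamma> 0) (velocity A \<gamma>) = velocity B (\<lambda>t. F (\<gamma> t))"
  using smooth_near_compose[OF A B F]
  by (auto simp: differential_def velocity_def o_def)

lemma differential_tangent:
  assumes A: "smooth_manifold A" and B: "smooth_manifold B"
    and F: "smooth_at A B x F" and v: "v \<in> tangent_space A UNIV x"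
  shows "differential B F x v \<in> tangent_space B UNIV (F x)"
proof -
  obtain \<gamma> where \<gamma>: "\<gamma> 0 = x" "smooth_at std_atlas A 0 \<gamma>" "v = velocity A \<gamma>"
    using v by (rule tangent_spaceE)
  have "smooth_at std_atlas B 0 (\<lambda>t. F (\<gamma> t))"
    by (rule smooth_at_compose[OF smooth_manifold_real A B \<gamma>(2)]) (simp add: \<gamma>(1) F)
  then show ?thesis
    using tangent_spaceI_UNIV[of B "\<lambda>t. F (\<gamma> t)"] differential_velocity[OF A B \<gamma>(2)] F \<gamma>(1,3) by simp
qed

text \<open>Holds for every \<open>f\<close>, as tangent vectors vanish on functions that are not smooth near the point.\<close>

lemma ext_d_cotangent:
  assumes A: "smooth_manifold A" shows "ext_d A f x \<in> cotangent_space A x"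
  using tangent_lincomb[OF A] by (auto simp: cotangent_space_def ext_d_def)

lemma ext_d_lincomb:
  assumes A: "smooth_manifold A" and f: "smooth_near A x f" and g: "smooth_near A x g"
  shows "ext_d A (\<lambda>p. a * f p + b * g p) x = (\<lambda>v. a * ext_d A f x v + b * ext_d A g x v)"
  using tangent_function_lincomb[OF A _ f g] by (auto simp: ext_d_def)

lemma ext_d_const: "smooth_manifold A \<Longrightarrow> ext_d A (\<lambda>p. c) x = (\<lambda>v. 0)"
  using tangent_const by (force simp: ext_d_def)

lemma ext_d_minus:
  assumes "smooth_manifold A" "smooth_near A x f"
  shows "ext_d A (\<lambda>p. - f p) x = (\<lambda>v. - ext_d A f x v)"
  using ext_d_lincomb[OF assms assms(2), of "-1" 0] by simp

lemma ext_d_diff: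
  assumes "smooth_manifold A" "smooth_near A x f" "smooth_near A x g"
  shows "ext_d A (\<lambda>p. f p - g p) x = (\<lambda>v. ext_d A f x v - ext_d A g x v)"
  using ext_d_lincomb[OF assms, of 1 "-1"] by simp

lemma ext_d_add_const:
  assumes "smooth_manifold A" "smooth_near A x f"
  shows "ext_d A (\<lambda>p. f p + c) x = ext_d A f x"
  using ext_d_lincomb[OF assms smooth_near_const[OF assms(1)], of 1 1 c] ext_d_const[OF assms(1), of c x] by simp

lemma pullback_ext_d:
  assumes A: "smooth_manifold A" and B: "smooth_manifold B"
    and F: "smooth_at A B x F" and f: "smooth_near B (F x) f"
  shows "pullback A B F x (ext_d B f (F x)) = ext_d A (\<lambda>p. f (F p)) x"
  using differential_tangent[OF A B F] f
  by (auto simp: pullback_def ext_d_def differential_def o_def)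

lemma cotangent_linear:
  "\<omega> \<in> cotangent_space A x \<Longrightarrow> u \<in> tangent_space A UNIV x \<Longrightarrow> v \<in> tangent_space A UNIV x \<Longrightarrow>
    \<omega> (\<lambda>f. a * u f + b * v f) = a * \<omega> u + b * \<omega> v"
  by (simp add: cotangent_space_def)

lemma cotangent_zero:
  assumes "\<omega> \<in> cotangent_space A x" shows "\<omega> (\<lambda>f. 0) = 0"
proof (cases "(\<lambda>f. 0) \<in> tangent_space A UNIV x")
  case True
  then show ?thesis using cotangent_linear[OF assms True True, of 0 0] by simp
qed (use assms in \<open>auto simp: cotangent_space_def\<close>)

lemma cotangent_sum:
  assumes A: "smooth_manifold A" and \<omega>: "\<omega> \<in> cotangent_space A x"
    and "finite I" "I \<noteq> {}" "\<And>i. i \<in> I \<Longrightarrow> u i \<in> tangent_space A UNIV x"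
  shows "(\<lambda>f. \<Sum>i\<in>I. k i * u i f) \<in> tangent_space A UNIV x \<and>
    \<omega> (\<lambda>f. \<Sum>i\<in>I. k i * u i f) = (\<Sum>i\<in>I. k i * \<omega> (u i))"
  using assms(3-5)
proof (induction I rule: finite_ne_induct)
  case (singleton i)
  have ui: "u i \<in> tangent_space A UNIV x" using singleton by simp
  show ?case
    using tangent_lincomb[OF A ui ui, of "k i" 0] cotangent_linear[OF \<omega> ui ui, of "k i" 0] by simp
next
  case (insert i I)
  have IH: "(\<lambda>f. \<Sum>i\<in>I. k i * u i f) \<in> tangent_space A UNIV x"
    "\<omega> (\<lambda>f. \<Sum>i\<in>I. k i * u i f) = (\<Sum>i\<in>I. k i * \<omega> (u i))"
    using insert.IH insert.prems by auto
  have ui: "u i \<in> tangent_space A UNIV x" using insert.prems by simp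
  show ?case
    using tangent_lincomb[OF A ui IH(1), of "k i" 1] cotangent_linear[OF \<omega> ui IH(1), of "k i" 1]
      insert.hyps IH(2) by simp
qed

lemma multivector_update_lincomb:
  assumes "multivector A n x L" "length \<omega>s = n" "set \<omega>s \<subseteq> cotangent_space A x" "i < n"
    "\<xi> \<in> cotangent_space A x" "\<eta> \<in> cotangent_space A x"
  shows "L (\<omega>s[i := (\<lambda>v. a * \<xi> v + b * \<eta> v)]) = a * L (\<omega>s[i := \<xi>]) + b * L (\<omega>s[i := \<eta>])"
  using assms unfolding multivector_def by blast

lemma multivector_zero_slot:
  assumes L: "multivector A n x L" and \<omega>s: "length \<omega>s = n" "set \<omega>s \<subseteq> cotangent_space A x"
    and zero: "(\<lambda>v. 0) \<in> set \<omega>s"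
  shows "L \<omega>s = 0"
proof -
  obtain i where i: "i < n" "\<omega>s ! i = (\<lambda>v. 0)" using zero \<omega>s(1) by (metis in_set_conv_nth)
  have "L (\<omega>s[i := (\<lambda>v. 0 * (0::real) + 0 * 0)]) = 0 * L (\<omega>s[i := (\<lambda>v. 0)]) + 0 * L (\<omega>s[i := (\<lambda>v. 0)])"
    by (rule multivector_update_lincomb[OF L \<omega>s i(1)]) (use zero \<omega>s(2) in auto)
  moreover have "\<omega>s[i := (\<lambda>v. 0)] = \<omega>s" using list_update_id[of \<omega>s i] i(2) by simp
  ultimately show ?thesis by simp
qed

lemma multivector_last_lincomb:
  assumes L: "multivector A (Suc m) x L" and \<omega>s: "length \<omega>s = m" "set \<omega>s \<subseteq> cotangent_space A x"
    and \<xi>: "\<xi> \<in> cotangent_space A x" and \<eta>: "\<eta> \<in> cotangent_space A x"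
  shows "L (\<omega>s @ [\<lambda>v. a * \<xi> v + b * \<eta> v]) = a * L (\<omega>s @ [\<xi>]) + b * L (\<omega>s @ [\<eta>])"
  using multivector_update_lincomb[OF L, of "\<omega>s @ [\<xi>]" m \<xi> \<eta> a b] \<omega>s \<xi> \<eta> by (simp add: list_update_append)

lemma cotangent_lincomb:
  assumes "\<xi> \<in> cotangent_space A x" "\<eta> \<in> cotangent_space A x"
  shows "(\<lambda>v. a * \<xi> v + b * \<eta> v) \<in> cotangent_space A x"
  using assms by (auto simp: cotangent_space_def algebra_simps)

text \<open>Negating the slots one by one, from left to right.\<close>

lemma multivector_minus_all:
  assumes L: "multivector A n x L"
    and \<omega>s: "length \<omega>s = n" "set \<omega>s \<subseteq> cotangent_space A x"
  shows "L (map (\<lambda>\<omega> v. - \<omega> v) \<omega>s) = (-1) ^ n * L \<omega>s"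
proof -
  have neg: "(\<lambda>v. - \<omega> v) \<in> cotangent_space A x" if "\<omega> \<in> cotangent_space A x" for \<omega>
    using cotangent_lincomb[OF that that, of "-1" 0] by simp
  have "L (map (\<lambda>\<omega> v. - \<omega> v) (take k \<omega>s) @ drop k \<omega>s) = (-1) ^ k * L \<omega>s" if "k \<le> n" for k
    using that
  proof (induction k)
    case (Suc k)
    let ?l = "map (\<lambda>\<omega> v. - \<omega> v) (take k \<omega>s) @ drop k \<omega>s"
    have k: "k < length \<omega>s" using Suc.prems \<omega>s(1) by simp
    have \<omega>k: "\<omega>s ! k \<in> cotangent_space A x" using \<omega>s(2) k nth_mem by blast
    have "set (take k \<omega>s) \<subseteq> cotangent_space A x" "set (drop k \<omega>s) \<subseteq> cotangent_space A x"
      using \<omega>s(2) set_take_subset set_drop_subset by fast+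
    then have c: "set ?l \<subseteq> cotangent_space A x" using neg by auto
    have "L (?l[k := (\<lambda>v. (-1) * (\<omega>s ! k) v + 0 * (\<omega>s ! k) v)]) = (-1) * L (?l[k := \<omega>s ! k]) + 0 * L (?l[k := \<omega>s ! k])"
      by (rule multivector_update_lincomb[OF L _ c _ \<omega>k \<omega>k]) (use k \<omega>s(1) in auto)
    moreover have "?l[k := \<omega>s ! k] = ?l"
      using k by (simp add: list_update_append Cons_nth_drop_Suc[symmetric])
    moreover have "?l[k := (\<lambda>v. (-1) * (\<omega>s ! k) v + 0 * (\<omega>s ! k) v)]
        = map (\<lambda>\<omega> v. - \<omega> v) (take (Suc k) \<omega>s) @ drop (Suc k) \<omega>s"
      using k by (simp add: list_update_append Cons_nth_drop_Suc[symmetric] take_Suc_conv_app_nth)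
    ultimately show ?case using Suc by simp
  qed simp
  from this[of n] show ?thesis using \<omega>s(1) by simp
qed

lemma multivector_last_sum:
  assumes L: "multivector A (Suc m) x L"
    and \<omega>s: "length \<omega>s = m" "set \<omega>s \<subseteq> cotangent_space A x"
    and "finite I" and \<eta>: "\<And>i. i \<in> I \<Longrightarrow> \<eta> i \<in> cotangent_space A x"
  shows "(\<lambda>v. \<Sum>i\<in>I. k i * \<eta> i v) \<in> cotangent_space A x \<and>
    L (\<omega>s @ [\<lambda>v. \<Sum>i\<in>I. k i * \<eta> i v]) = (\<Sum>i\<in>I. k i * L (\<omega>s @ [\<eta> i]))"
  using assms(4,5)
proof (induction I rule: finite_induct)
  case empty
  have z: "(\<lambda>v. 0) \<in> cotangent_space A x" by (simp add: cotangent_space_def)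
  then have "L (\<omega>s @ [\<lambda>v. 0]) = 0" by (intro multivector_zero_slot[OF L]) (use \<omega>s in auto)
  then show ?case using z by simp
next
  case (insert i I)
  have \<eta>i: "\<eta> i \<in> cotangent_space A x" using insert.prems by simp
  have IH: "(\<lambda>v. \<Sum>i\<in>I. k i * \<eta> i v) \<in> cotangent_space A x"
    "L (\<omega>s @ [\<lambda>v. \<Sum>i\<in>I. k i * \<eta> i v]) = (\<Sum>i\<in>I. k i * L (\<omega>s @ [\<eta> i]))"
    using insert.IH insert.prems by auto
  show ?case
    using multivector_last_lincomb[OF L \<omega>s \<eta>i IH(1), of "k i" 1] cotangent_lincomb[OF \<eta>i IH(1), of "k i" 1]
      insert.hyps IH(2) by simp
qed

text \<open>Finite-dimensional double duality. In a chart with coordinates \<open>c\<close>, a covector \<open>\<omega>\<close> is the combination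
  of the coordinate differentials \<open>e b\<close> with coefficients \<open>\<omega>(X b)\<close>; hence the vector with components
  \<open>N x (\<omega>s @ [e b])\<close> represents the functional. Uniqueness holds because differentials of functions
  separate tangent vectors.\<close>

lemma sharp_exists_unique:
  fixes A :: "('p::{t2_space, second_countable_topology}, 'e::real_normed_vector) atlas"
  assumes A: "smooth_manifold A" and L: "multivector A (Suc m) x (N x)"
    and \<omega>s: "length \<omega>s = m" "set \<omega>s \<subseteq> cotangent_space A x"
  shows "\<exists>!v. v \<in> tangent_space A UNIV x \<and> (\<forall>\<beta>\<in>cotangent_space A x. \<beta> v = N x (\<omega>s @ [\<beta>]))"
proof (rule ex_ex1I)
  obtain U \<phi> where U: "(U, \<phi>) \<in> A" "x \<in> U" using chart_exists[OF A] .
  obtain B :: "'e set" and c where "coordinates B c"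
    using finite_dim_coordinates[OF manifold_finite_dim[OF A]] .
  then have B: "finite B" "\<And>b. b \<in> B \<Longrightarrow> bounded_linear (c b)" "\<And>v. (\<Sum>b\<in>B. c b v *\<^sub>R b) = v"
    "\<And>b b'. b \<in> B \<Longrightarrow> b' \<in> B \<Longrightarrow> c b b' = (if b = b' then 1 else 0)"
    by (auto simp: coordinates_def)
  define X where "X = chart_vector A U \<phi> x"
  have XT: "X w \<in> tangent_space A UNIV x" for w by (simp add: X_def tangent_space_eq_range[OF A U])
  have Xphi: "X w (\<lambda>p. c b (\<phi> p)) = c b w" if b: "b \<in> B" for b w
    unfolding X_def by (rule chart_linear_function(2)[OF A U B(2)[OF b]])
  define e where "e = (\<lambda>b. ext_d A (\<lambda>p. c b (\<phi> p)) x)"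
  have eT: "e b \<in> cotangent_space A x" for b by (simp add: e_def ext_d_cotangent[OF A])
  have Xsum: "X w = (\<lambda>f. \<Sum>b\<in>B. c b w * X b f)" for w
  proof
    fix f
    show "X w f = (\<Sum>b\<in>B. c b w * X b f)"
    proof (cases "smooth_near A x f")
      case True
      have lin: "linear (\<lambda>w. X w f)"
        unfolding X_def using has_derivative_linear[OF chart_function_derivative[OF A U True]] .
      have "X (\<Sum>b\<in>B. c b w *\<^sub>R b) f = (\<Sum>b\<in>B. c b w * X b f)"
        by (simp add: linear_sum[OF lin] linear_cmul[OF lin])
      then show ?thesis by (simp add: B(3))
    qed (simp add: X_def chart_vector_def)
  qed
  have omega_X: "\<omega> (X w) = (\<Sum>b\<in>B. c b w * \<omega> (X b))" if "\<omega> \<in> cotangent_space A x" for \<omega> w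
  proof (cases "B = {}")
    case True
    then show ?thesis using Xsum[of w] cotangent_zero[OF that] by simp
  next
    case False
    have "\<omega> (\<lambda>f. \<Sum>b\<in>B. c b w * X b f) = (\<Sum>b\<in>B. c b w * \<omega> (X b))"
      using cotangent_sum[OF A that B(1) False, of X "\<lambda>b. c b w"] XT by blast
    then show ?thesis by (simp only: Xsum[of w, symmetric])
  qed
  have expand: "\<omega> = (\<lambda>v. \<Sum>b\<in>B. \<omega> (X b) * e b v)" if "\<omega> \<in> cotangent_space A x" for \<omega>
  proof
    fix v
    show "\<omega> v = (\<Sum>b\<in>B. \<omega> (X b) * e b v)"
    proof (cases "v \<in> tangent_space A UNIV x")
      case True
      then obtain w where v: "v = X w" by (auto simp: X_def tangent_space_eq_range[OF A U])
      have "e b v = c b w" if "b \<in> B" for b using True Xphi[OF that] by (simp add: e_def ext_d_def v)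
      then have "(\<Sum>b\<in>B. \<omega> (X b) * e b v) = (\<Sum>b\<in>B. c b w * \<omega> (X b))"
        by (intro sum.cong) (auto simp: mult.commute)
      then show ?thesis using omega_X[OF that, of w] by (simp add: v)
    next
      case False
      then have "\<omega> v = 0" using that by (simp add: cotangent_space_def)
      moreover have "e b v = 0" for b using False by (simp add: e_def ext_d_def)
      ultimately show ?thesis by simp
    qed
  qed
  define w where "w = (\<Sum>b\<in>B. N x (\<omega>s @ [e b]) *\<^sub>R b)"
  have cw: "c b w = N x (\<omega>s @ [e b])" if b: "b \<in> B" for b
  proof -
    interpret cb: bounded_linear "c b" using B(2)[OF b] .
    have "c b w = (\<Sum>b'\<in>B. N x (\<omega>s @ [e b']) * c b b')" by (simp add: w_def cb.sum cb.scaleR)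
    also have "\<dots> = (\<Sum>b'\<in>B. if b = b' then N x (\<omega>s @ [e b']) else 0)"
      by (rule sum.cong) (use B(4)[OF b] in auto)
    finally show ?thesis using B(1) b by simp
  qed
  have "\<beta> (X w) = N x (\<omega>s @ [\<beta>])" if "\<beta> \<in> cotangent_space A x" for \<beta>
  proof -
    have "N x (\<omega>s @ [\<beta>]) = N x (\<omega>s @ [\<lambda>v. \<Sum>b\<in>B. \<beta> (X b) * e b v])"
      by (rule arg_cong[OF expand[OF that], of "\<lambda>\<eta>. N x (\<omega>s @ [\<eta>])"])
    also have "\<dots> = (\<Sum>b\<in>B. \<beta> (X b) * N x (\<omega>s @ [e b]))"
      using multivector_last_sum[OF L \<omega>s B(1), of e "\<lambda>b. \<beta> (X b)"] eT by blast
    also have "\<dots> = (\<Sum>b\<in>B. c b w * \<beta> (X b))" by (rule sum.cong) (use cw in auto)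
    also have "\<dots> = \<beta> (X w)" by (rule omega_X[OF that, symmetric])
    finally show ?thesis by simp
  qed
  then show "\<exists>v. v \<in> tangent_space A UNIV x \<and> (\<forall>\<beta>\<in>cotangent_space A x. \<beta> v = N x (\<omega>s @ [\<beta>]))"
    using XT by blast
next
  fix u v
  assume u: "u \<in> tangent_space A UNIV x \<and> (\<forall>\<beta>\<in>cotangent_space A x. \<beta> u = N x (\<omega>s @ [\<beta>]))"
    and v: "v \<in> tangent_space A UNIV x \<and> (\<forall>\<beta>\<in>cotangent_space A x. \<beta> v = N x (\<omega>s @ [\<beta>]))"
  show "u = v"
  proof (rule tangent_eqI)
    show "u f = v f" if "smooth_near A x f" for f
      using u v ext_d_cotangent[OF A, of f x] by (metis ext_d_def)
  qed (use u v in auto)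
qed

lemma sharp_spec:
  assumes "smooth_manifold A" "multivector A (Suc m) x (N x)" "length \<omega>s = m" "set \<omega>s \<subseteq> cotangent_space A x"
  shows "sharp A N x \<omega>s \<in> tangent_space A UNIV x"
    "\<beta> \<in> cotangent_space A x \<Longrightarrow> \<beta> (sharp A N x \<omega>s) = N x (\<omega>s @ [\<beta>])"
  using theI'[OF sharp_exists_unique[of A m x N \<omega>s, OF assms]] unfolding sharp_def by blast+

text \<open>The total derivative of \<open>P\<close> is the sum of its partial derivatives: the chart velocity \<open>(w, w')\<close> of
  the pair splits as \<open>(w, 0) + (0, w')\<close>, and these belong to curves with one constant component.\<close>

lemma velocity_prod:
  assumes A: "smooth_manifold A" and B: "smooth_manifold B"
    and \<sigma>: "smooth_at std_atlas A 0 \<sigma>" and \<tau>: "smooth_at std_atlas B 0 \<tau>"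
    and P: "smooth_near (prod_atlas A B) (\<sigma> 0, \<tau> 0) P"
  shows "((\<lambda>t. P (\<sigma> t, \<tau> t)) has_real_derivative
    velocity A \<sigma> (\<lambda>p. P (p, \<tau> 0)) + velocity B \<tau> (\<lambda>q. P (\<sigma> 0, q))) (at 0)"
proof -
  obtain U \<phi> where U: "(U, \<phi>) \<in> A" "\<sigma> 0 \<in> U" using chart_exists[OF A] .
  obtain V \<psi> where V: "(V, \<psi>) \<in> B" "\<tau> 0 \<in> V" using chart_exists[OF B] .
  have UV: "(U \<times> V, map_prod \<phi> \<psi>) \<in> prod_atlas A B" "(\<sigma> 0, \<tau> 0) \<in> U \<times> V"
    using U V by (auto simp: prod_atlas_def)
  note AB = smooth_manifold_prod[OF A B]
  obtain w where w: "((\<lambda>t. \<phi> (\<sigma> t)) has_vector_derivative w) (at 0)"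
    using curve_chart_derivative(1)[OF A \<sigma> U] by blast
  obtain w' where w': "((\<lambda>t. \<psi> (\<tau> t)) has_vector_derivative w') (at 0)"
    using curve_chart_derivative(1)[OF B \<tau> V] by blast
  have X: "((\<lambda>t. P (\<mu> t, \<nu> t)) has_real_derivative chart_vector (prod_atlas A B) (U \<times> V) (map_prod \<phi> \<psi>) (\<sigma> 0, \<tau> 0) (d, d') P) (at 0)"
    if "smooth_at std_atlas A 0 \<mu>" "smooth_at std_atlas B 0 \<nu>" "\<mu> 0 = \<sigma> 0" "\<nu> 0 = \<tau> 0"
      "((\<lambda>t. \<phi> (\<mu> t)) has_vector_derivative d) (at 0)" "((\<lambda>t. \<psi> (\<nu> t)) has_vector_derivative d') (at 0)"
    for \<mu> \<nu> d d'
  proof -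
    have c: "smooth_at std_atlas (prod_atlas A B) 0 (\<lambda>t. (\<mu> t, \<nu> t))"
      by (rule smooth_at_Pair[OF smooth_manifold_real A B that(1,2)])
    have "((\<lambda>t. map_prod \<phi> \<psi> (\<mu> t, \<nu> t)) has_vector_derivative (d, d')) (at 0)"
      using has_vector_derivative_Pair[OF that(5,6)] by simp
    then have "velocity (prod_atlas A B) (\<lambda>t. (\<mu> t, \<nu> t))
        = chart_vector (prod_atlas A B) (U \<times> V) (map_prod \<phi> \<psi>) (\<sigma> 0, \<tau> 0) (d, d')"
      using velocity_eq_chart_vector[OF AB c UV(1)] UV(2) that(3,4) by simp
    then show ?thesis using velocity_has_derivative[OF AB c, of P] P that(3,4) by simp
  qed
  have c1: "smooth_at A (prod_atlas A B) (\<sigma> 0) (\<lambda>p. (p, \<tau> 0))"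
    by (rule smooth_at_Pair[OF A A B smooth_at_id[OF A] smooth_at_const[OF A B]])
  have c2: "smooth_at B (prod_atlas A B) (\<tau> 0) (\<lambda>q. (\<sigma> 0, q))"
    by (rule smooth_at_Pair[OF B A B smooth_at_const[OF B A] smooth_at_id[OF B]])
  have "velocity A \<sigma> (\<lambda>p. P (p, \<tau> 0)) = chart_vector (prod_atlas A B) (U \<times> V) (map_prod \<phi> \<psi>) (\<sigma> 0, \<tau> 0) (w, 0) P"
    by (rule velocity_eqI[OF A \<sigma> smooth_near_compose[OF A AB c1 P]
        X[OF \<sigma> smooth_at_const[OF smooth_manifold_real B] refl refl w has_vector_derivative_const]])
  moreover have "velocity B \<tau> (\<lambda>q. P (\<sigma> 0, q)) = chart_vector (prod_atlas A B) (U \<times> V) (map_prod \<phi> \<psi>) (\<sigma> 0, \<tau> 0) (0, w') P"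
    by (rule velocity_eqI[OF B \<tau> smooth_near_compose[OF B AB c2 P]
        X[OF smooth_at_const[OF smooth_manifold_real A] \<tau> refl refl has_vector_derivative_const w']])
  moreover have "chart_vector (prod_atlas A B) (U \<times> V) (map_prod \<phi> \<psi>) (\<sigma> 0, \<tau> 0) (w, w') P
      = chart_vector (prod_atlas A B) (U \<times> V) (map_prod \<phi> \<psi>) (\<sigma> 0, \<tau> 0) (w, 0) P
      + chart_vector (prod_atlas A B) (U \<times> V) (map_prod \<phi> \<psi>) (\<sigma> 0, \<tau> 0) (0, w') P"
    using chart_vector_lincomb[OF AB UV, of 1 "(w, 0)" 1 "(0, w')"] by simp
  ultimately show ?thesis using X[OF \<sigma> \<tau> refl refl w w'] by simp
qed

text \<open>The part of the submersion theorem about tangent vectors, for a submersion with a section. The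
  section \<open>s\<close> supplies the directions dual to the components of \<open>F\<close>, and the curve is the image of a
  straight line under the retraction onto the level set of these components.\<close>

lemma tangent_level_set:
  fixes A :: "('p::{t2_space, second_countable_topology}, 'e::real_normed_vector) atlas"
    and B :: "('q::{t2_space, second_countable_topology}, 'f::real_normed_vector) atlas"
  assumes A: "smooth_manifold A" and B: "smooth_manifold B"
    and F: "smooth_at A B (s x) F" and s: "smooth_at B A x s" and Fs: "\<And>y. F (s y) = y"
    and v: "v \<in> tangent_space A UNIV (s x)"
    and ker: "\<And>f. smooth_near B x f \<Longrightarrow> v (\<lambda>p. f (F p)) = 0"
  shows "v \<in> tangent_space A (F -` {x}) (s x)"
proof -
  obtain U \<phi> where U: "(U, \<phi>) \<in> A" "s x \<in> U" using chart_exists[OF A] .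
  obtain V \<psi> where V: "(V, \<psi>) \<in> B" "x \<in> V" using chart_exists[OF B] .
  obtain J :: "'f set" and c where "coordinates J c"
    using finite_dim_coordinates[OF manifold_finite_dim[OF B]] .
  then have J: "finite J" "\<And>j. j \<in> J \<Longrightarrow> bounded_linear (c j)" "\<And>v. (\<Sum>j\<in>J. c j v *\<^sub>R j) = v"
    "\<And>i j. i \<in> J \<Longrightarrow> j \<in> J \<Longrightarrow> c i j = (if i = j then 1 else 0)"
    by (auto simp: coordinates_def)
  obtain W where W: "open W" "s x \<in> W" "W \<subseteq> U" "F ` W \<subseteq> V"
    "smooth_on (\<phi> ` W) (\<lambda>y. \<psi> (F (inv_into U \<phi> y)))"
    using smooth_at_chartsD[OF A B F U V(1)] V(2) Fs by metis
  have oW: "open (\<phi> ` W)" by (rule chart_open_image[OF A U(1) W(1,3)])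
  define a where "a = (\<lambda>j y. c j (\<psi> (F (inv_into U \<phi> y))))"
  define a' where "a' = (\<lambda>j w. chart_vector A U \<phi> (s x) w (\<lambda>p. c j (\<psi> (F p))))"
  note cs = chart_linear_function[OF B V J(2)]
  have cF: "smooth_near A (s x) (\<lambda>p. c j (\<psi> (F p)))" if "j \<in> J" for j
    by (rule smooth_near_compose[OF A B F]) (simp add: Fs cs(1)[OF that])
  define X where "X = chart_vector B V \<psi> x"
  have XT: "X w \<in> tangent_space B UNIV x" for w by (simp add: X_def tangent_space_eq_range[OF B V])
  \<comment> \<open>As \<open>F \<circ> s = id\<close>, the images of the coordinate vectors under the section are dual to the
    components of \<open>F\<close>.\<close>
  have "\<exists>u. differential A s x (X j) = chart_vector A U \<phi> (s x) u" for j
    using differential_tangent[OF B A s XT] by (auto simp: tangent_space_eq_range[OF A U])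
  then obtain u where u: "\<And>j. differential A s x (X j) = chart_vector A U \<phi> (s x) (u j)" by metis
  have a'u: "a' i (u j) = (if i = j then 1 else 0)" if "i \<in> J" "j \<in> J" for i j
  proof -
    have "a' i (u j) = differential A s x (X j) (\<lambda>p. c i (\<psi> (F p)))" by (simp add: a'_def u)
    also have "\<dots> = X j (\<lambda>q. c i (\<psi> q))" using cF[OF that(1)] by (simp add: differential_def o_def Fs)
    also have "\<dots> = c i j" unfolding X_def by (rule cs(2)[OF that(1)])
    finally show ?thesis using J(4)[OF that] by simp
  qed
  have as: "smooth_on (\<phi> ` W) (a j)" if "j \<in> J" for j
    unfolding a_def by (rule smooth_on_bounded_linear[OF oW J(2)[OF that] W(5)])
  have ad: "(a j has_derivative a' j) (at (\<phi> (s x)))" if "j \<in> J" for j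
    unfolding a_def a'_def by (rule chart_function_derivative[OF A U cF[OF that]])
  have y0: "\<phi> (s x) \<in> \<phi> ` W" using W(2) by simp
  obtain Y r D where r: "open Y" "\<phi> (s x) \<in> Y" "r ` Y \<subseteq> \<phi> ` W" "r (\<phi> (s x)) = \<phi> (s x)" "smooth_on Y r"
    "\<And>j z. j \<in> J \<Longrightarrow> z \<in> Y \<Longrightarrow> a j (r z) = a j (\<phi> (s x))" "(r has_derivative D) (at (\<phi> (s x)))"
    "\<And>w. (\<forall>j\<in>J. a' j w = 0) \<Longrightarrow> D w = w"
    using common_level_set_retraction[OF manifold_finite_dim[OF A] J(1) oW y0 as ad a'u] by blast
  obtain w where w: "v = chart_vector A U \<phi> (s x) w"
    using v by (auto simp: tangent_space_eq_range[OF A U])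
  have "a' j w = 0" if "j \<in> J" for j
    using ker[OF cs(1)[OF that]] by (simp add: a'_def w)
  then have Dw: "D w = w" using r(8) by blast
  define l where "l = (\<lambda>t::real. t *\<^sub>R w + \<phi> (s x))"
  have ls: "smooth_on UNIV l"
    unfolding l_def
    by (intro smooth_on_add smooth_on_const smooth_on_linear bounded_linear_scaleR_left) simp
  define T where "T = l -` Y"
  have T: "open T" "0 \<in> T"
    using r(1,2) smooth_on_continuous[OF ls] by (auto simp: T_def open_vimage) (simp add: l_def)
  have rs: "smooth_on T (\<lambda>t. r (l t))"
    by (rule smooth_on_compose[OF manifold_finite_dim[OF A] T(1) smooth_on_subset[OF ls] r(5)]) (auto simp: T_def)
  have "(l has_derivative (\<lambda>t. t *\<^sub>R w)) (at 0)"
    unfolding l_def by (auto intro!: derivative_eq_intros)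
  from has_derivative_compose[OF this, of r D] r(7)
  have "((\<lambda>t. r (l t)) has_derivative (\<lambda>t. D (t *\<^sub>R w))) (at 0)" by (simp add: l_def)
  then have rd: "((\<lambda>t. r (l t)) has_vector_derivative w) (at 0)"
    using linear_cmul[OF has_derivative_linear[OF r(7)], of _ w] by (simp add: has_vector_derivative_def Dw)
  note lift = lift_chart_curve[OF A U T rs _ rd]
  define \<gamma> where "\<gamma> = (\<lambda>t. inv_into U \<phi> (r (l t)))"
  have r0: "r (l 0) = \<phi> (s x)" by (simp add: l_def r(4))
  have "F (\<gamma> t) = x" if t: "t \<in> T" for t
  proof -
    have "r (l t) \<in> \<phi> ` W" using t r(3) by (auto simp: T_def)
    then have gW: "\<gamma> t \<in> W" using chart_inv[OF A U(1)] W(3) by (auto simp: \<gamma>_def)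
    have "c j (\<psi> (F (\<gamma> t))) = c j (\<psi> x)" if "j \<in> J" for j
      using r(6)[OF that, of "l t"] t chart_inv[OF A U] by (simp add: a_def \<gamma>_def T_def Fs)
    then have "(\<Sum>j\<in>J. c j (\<psi> (F (\<gamma> t))) *\<^sub>R j) = (\<Sum>j\<in>J. c j (\<psi> x) *\<^sub>R j)" by simp
    then have "\<psi> (F (\<gamma> t)) = \<psi> x" by (simp only: J(3))
    then show ?thesis using chart_inv[OF B V(1)] V(2) W(4) gW by (metis image_subset_iff)
  qed
  then have "\<forall>\<^sub>F t in nhds 0. \<gamma> t \<in> F -` {x}" using T by (auto simp: eventually_nhds)
  from tangent_spaceI[OF _ _ this, of "s x" A] lift(1-3)[OF r0] show ?thesis by (simp add: \<gamma>_def w)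
qed

section \<open>Multiplicative Nambu tensors\<close>

lemma eventually_compose_curve:
  assumes "isCont \<gamma> t0" "\<forall>\<^sub>F p in nhds (\<gamma> t0). Q p" shows "\<forall>\<^sub>F t in nhds t0. Q (\<gamma> t)"
proof -
  have "filterlim \<gamma> (nhds (\<gamma> t0)) (nhds t0)"
    using assms(1) by (simp only: isCont_def tendsto_at_iff_tendsto_nhds)
  then show ?thesis using assms(2) unfolding filterlim_iff by blast
qed

lemma has_real_derivative_eventually_eq:
  fixes f g :: "real \<Rightarrow> real"
  assumes "(f has_real_derivative d) (at t)" "\<forall>\<^sub>F s in nhds t. f s = g s"
  shows "(g has_real_derivative d) (at t)"
  using DERIV_cong_ev[OF refl assms(2) refl] assms(1) by simp

lemma smooth_tuples_update:
  "fs \<in> smooth_tuples A k \<Longrightarrow> f \<in> smooth_functions A \<Longrightarrow> fs[i := f] \<in> smooth_tuples A k"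
  using set_update_subset_insert[of fs i f] by (auto simp: smooth_tuples_def)

lemma smooth_tuples_nth:
  "fs \<in> smooth_tuples A k \<Longrightarrow> i < k \<Longrightarrow> fs ! i \<in> smooth_functions A"
  by (auto simp: smooth_tuples_def)

lemma smooth_tuples_snoc:
  "fs \<in> smooth_tuples A (k - 1) \<Longrightarrow> f \<in> smooth_functions A \<Longrightarrow> k > 0 \<Longrightarrow> fs @ [f] \<in> smooth_tuples A k"
  by (auto simp: smooth_tuples_def)

locale nambu_lie =
  fixes G :: "('g::{t2_space, second_countable_topology}, 'a::real_normed_vector,
      'm::{t2_space, second_countable_topology}, 'b::real_normed_vector) groupoid_data"
    and N :: "'g \<Rightarrow> 'g cvec list \<Rightarrow> real" and n :: nat
  assumes NL: "nambu_lie_groupoid n G N" and n: "n > 0"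
begin

abbreviation "arrows \<equiv> arr G"
abbreviation "objects \<equiv> obj G"

lemma lie: "lie_groupoid G" and tensor: "nambu_tensor arrows n N" and multi: "multiplicative n G N"
  using NL unfolding nambu_lie_groupoid_def by blast+

lemma arrows: "smooth_manifold arrows" and objects: "smooth_manifold objects" and gr: "groupoid_axioms G"
  using lie unfolding lie_groupoid_def by blast+

lemma src_unt [simp]: "src G (unt G x) = x" and tgt_unt [simp]: "tgt G (unt G x) = x"
  using gr unfolding groupoid_axioms_def by blast+

lemma src_mul: "tgt G g = src G h \<Longrightarrow> src G (mul G g h) = src G g"
  using gr unfolding groupoid_axioms_def by blast+

lemma mul_unt_left: "mul G (unt G (src G g)) g = g" and mul_unt_right: "mul G g (unt G (tgt G g)) = g"
  using gr unfolding groupoid_axioms_def by blast+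

lemma mul_unt_unt: "mul G (unt G x) (unt G x) = unt G x"
  using mul_unt_left[of "unt G x"] by simp

lemma src_ivs: "src G (ivs G g) = tgt G g" and mul_ivs: "mul G g (ivs G g) = unt G (src G g)"
  using gr unfolding groupoid_axioms_def by blast+

lemma src_smooth: "smooth_at arrows objects g (src G)" and tgt_smooth: "smooth_at arrows objects g (tgt G)"
  and unt_smooth: "smooth_at objects arrows x (unt G)"
proof -
  have "smooth_map arrows objects UNIV (src G)" "smooth_map arrows objects UNIV (tgt G)" "smooth_map objects arrows UNIV (unt G)"
    using lie unfolding lie_groupoid_def submersion_def by blast+
  then show "smooth_at arrows objects g (src G)" "smooth_at arrows objects g (tgt G)" "smooth_at objects arrows x (unt G)"
    by (auto intro: smooth_map_imp_at)
qed

lemma tensor_at: "multivector arrows n g (N g)"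
  using tensor by (simp add: nambu_tensor_def multivector_field_def)

lemma smooth_near_src: "smooth_near objects (src G g) f \<Longrightarrow> smooth_near arrows g (\<lambda>p. f (src G p))"
  by (rule smooth_near_compose[OF arrows objects src_smooth])

lemma smooth_near_tgt: "smooth_near objects (tgt G g) f \<Longrightarrow> smooth_near arrows g (\<lambda>p. f (tgt G p))"
  by (rule smooth_near_compose[OF arrows objects tgt_smooth])

text \<open>Curves in the graph of the multiplication through \<open>(g, h, gh)\<close>, listed by their three components so
  that no product manifold has to be mentioned.\<close>

definition composable_curves :: "'g \<Rightarrow> 'g \<Rightarrow> (real \<Rightarrow> 'g) \<Rightarrow> (real \<Rightarrow> 'g) \<Rightarrow> (real \<Rightarrow> 'g) \<Rightarrow> bool" where
  "composable_curves g h \<sigma> \<tau> \<rho> \<longleftrightarrow>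
     smooth_at std_atlas arrows 0 \<sigma> \<and> smooth_at std_atlas arrows 0 \<tau> \<and> smooth_at std_atlas arrows 0 \<rho> \<and>
     \<sigma> 0 = g \<and> \<tau> 0 = h \<and> \<rho> 0 = mul G g h \<and>
     (\<forall>\<^sub>F t in nhds 0. tgt G (\<sigma> t) = src G (\<tau> t) \<and> \<rho> t = mul G (\<sigma> t) (\<tau> t))"

abbreviation "dlist c g \<equiv> map (\<lambda>i. ext_d arrows (c i) g) [0..<n]"

text \<open>Multiplicativity in the form used throughout. The covectors are the differentials of
  \<open>F i (g, h, k) = a i g + b i h + c i k\<close>; they are conormal to the graph of the multiplication by
  \<open>deriv\<close>, and their pullbacks to the three factors are \<open>d(a i)\<close>, \<open>d(b i)\<close>, \<open>d(c i)\<close> because the other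
  two summands are constant there.\<close>

lemma multiplicative_on_functions:
  assumes comp: "tgt G g = src G h"
    and a: "\<And>i. i < n \<Longrightarrow> smooth_near arrows g (a i)" and b: "\<And>i. i < n \<Longrightarrow> smooth_near arrows h (b i)"
    and c: "\<And>i. i < n \<Longrightarrow> smooth_near arrows (mul G g h) (c i)"
    and deriv: "\<And>i \<sigma> \<tau> \<rho>. i < n \<Longrightarrow> composable_curves g h \<sigma> \<tau> \<rho> \<Longrightarrow>
      ((\<lambda>t. a i (\<sigma> t) + b i (\<tau> t) + c i (\<rho> t)) has_real_derivative 0) (at 0)"
  shows "N g (dlist a g) + N h (dlist b h) + (-1) ^ (n - 1) * N (mul G g h) (dlist c (mul G g h)) = 0"
proof -
  define k where "k = mul G g h"
  define AA where "AA = prod_atlas arrows arrows"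
  define P where "P = prod_atlas arrows AA"
  have AA: "smooth_manifold AA" unfolding AA_def by (rule smooth_manifold_prod[OF arrows arrows])
  have P: "smooth_manifold P" unfolding P_def by (rule smooth_manifold_prod[OF arrows AA])
  define F where "F = (\<lambda>i (p :: 'g \<times> 'g \<times> 'g). a i (fst p) + b i (fst (snd p)) + c i (snd (snd p)))"
  have p1: "smooth_at P arrows z fst" for z unfolding P_def by (rule smooth_at_fst[OF arrows AA])
  have p23: "smooth_at P AA z snd" for z unfolding P_def by (rule smooth_at_snd[OF arrows AA])
  have p2: "smooth_at P arrows z (\<lambda>p. fst (snd p))" for z
    by (rule smooth_at_compose[OF P AA arrows p23]) (simp only: AA_def smooth_at_fst[OF arrows arrows])
  have p3: "smooth_at P arrows z (\<lambda>p. snd (snd p))" for z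
    by (rule smooth_at_compose[OF P AA arrows p23]) (simp only: AA_def smooth_at_snd[OF arrows arrows])
  have F: "smooth_near P (g, h, k) (F i)" if "i < n" for i
    unfolding F_def
    by (intro smooth_near_add[OF P] smooth_near_compose[OF P arrows p1] smooth_near_compose[OF P arrows p2]
        smooth_near_compose[OF P arrows p3]) (simp_all add: a b c that k_def)
  define C where "C = {(g, h, mul G g h) | g h. tgt G g = src G h}"
  define \<omega>s where "\<omega>s = map (\<lambda>i. ext_d P (F i) (g, h, k)) [0..<n]"
  have "ext_d P (F i) (g, h, k) \<in> conormal_space P C (g, h, k)" if i: "i < n" for i
    unfolding conormal_space_def
  proof (intro CollectI conjI ext_d_cotangent[OF P] ballI)
    fix v assume v: "v \<in> tangent_space P C (g, h, k)"
    obtain \<gamma> where \<gamma>: "\<gamma> 0 = (g, h, k)" "smooth_at std_atlas P 0 \<gamma>" "\<forall>\<^sub>F t in nhds 0. \<gamma> t \<in> C" "v = velocity P \<gamma>"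
      using v by (rule tangent_spaceE)
    have ev: "\<forall>\<^sub>F t in nhds 0. tgt G (fst (\<gamma> t)) = src G (fst (snd (\<gamma> t))) \<and>
        snd (snd (\<gamma> t)) = mul G (fst (\<gamma> t)) (fst (snd (\<gamma> t)))"
      by (rule eventually_mono[OF \<gamma>(3)]) (auto simp: C_def)
    have "composable_curves g h (\<lambda>t. fst (\<gamma> t)) (\<lambda>t. fst (snd (\<gamma> t))) (\<lambda>t. snd (snd (\<gamma> t)))"
      unfolding composable_curves_def
      using smooth_at_compose[OF smooth_manifold_real P arrows \<gamma>(2) p1]
        smooth_at_compose[OF smooth_manifold_real P arrows \<gamma>(2) p2]
        smooth_at_compose[OF smooth_manifold_real P arrows \<gamma>(2) p3] \<gamma>(1) ev
      by (simp add: k_def)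
    from deriv[OF i this] have "((\<lambda>t. F i (\<gamma> t)) has_real_derivative 0) (at 0)" by (simp add: F_def)
    from velocity_eqI[OF P \<gamma>(2) _ this] F[OF i] \<gamma>(1,4) have "v (F i) = 0" by simp
    then show "ext_d P (F i) (g, h, k) v = 0" by (simp add: ext_d_def)
  qed
  then have con: "set \<omega>s \<subseteq> conormal_space P C (g, h, k)" by (auto simp: \<omega>s_def)
  have "(g, h, k) \<in> C" using comp by (auto simp: C_def k_def)
  then have zero: "multivector_oplus arrows AA N (multivector_oplus arrows arrows N (\<lambda>x \<omega>s. (-1) ^ (n - 1) * N x \<omega>s)) (g, h, k) \<omega>s = 0"
    using multi con by (auto simp: multiplicative_def coisotropic_def P_def AA_def C_def \<omega>s_def)
  have i1: "smooth_at arrows P g (\<lambda>p. (p, (h, k)))"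
    unfolding P_def by (rule smooth_at_Pair[OF arrows arrows AA smooth_at_id[OF arrows] smooth_at_const[OF arrows AA]])
  have i2: "smooth_at AA P (h, k) (\<lambda>q. (g, q))"
    unfolding P_def by (rule smooth_at_Pair[OF AA arrows AA smooth_at_const[OF AA arrows] smooth_at_id[OF AA]])
  have i3: "smooth_at arrows AA h (\<lambda>p. (p, k))"
    unfolding AA_def by (rule smooth_at_Pair[OF arrows arrows arrows smooth_at_id[OF arrows] smooth_at_const[OF arrows arrows]])
  have i4: "smooth_at arrows AA k (\<lambda>p. (h, p))"
    unfolding AA_def by (rule smooth_at_Pair[OF arrows arrows arrows smooth_at_const[OF arrows arrows] smooth_at_id[OF arrows]])
  have e1: "pullback arrows P (\<lambda>p. (p, (h, k))) g (ext_d P (F i) (g, h, k)) = ext_d arrows (a i) g" if i: "i < n" for i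
    using pullback_ext_d[OF arrows P i1, of "F i"] F[OF i] ext_d_add_const[OF arrows a[OF i], of "b i h + c i k"]
    by (simp add: F_def add.assoc)
  have e23: "pullback AA P (\<lambda>q. (g, q)) (h, k) (ext_d P (F i) (g, h, k)) = ext_d AA (\<lambda>q. F i (g, q)) (h, k)"
    if i: "i < n" for i using pullback_ext_d[OF AA P i2, of "F i"] F[OF i] by simp
  have F2: "smooth_near AA (h, k) (\<lambda>q. F i (g, q))" if i: "i < n" for i
    by (rule smooth_near_compose[OF AA P i2]) (simp add: F[OF i])
  have e2: "pullback arrows AA (\<lambda>p. (p, k)) h (ext_d AA (\<lambda>q. F i (g, q)) (h, k)) = ext_d arrows (b i) h" if i: "i < n" for i
    using pullback_ext_d[OF arrows AA i3 F2[OF i]] ext_d_add_const[OF arrows b[OF i], of "a i g + c i k"]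
    by (simp add: F_def algebra_simps)
  have e3: "pullback arrows AA (\<lambda>p. (h, p)) k (ext_d AA (\<lambda>q. F i (g, q)) (h, k)) = ext_d arrows (c i) k" if i: "i < n" for i
    using pullback_ext_d[OF arrows AA i4 F2[OF i]] ext_d_add_const[OF arrows c[OF i, folded k_def], of "a i g + b i h"]
    by (simp add: F_def algebra_simps)
  have m1: "map (pullback arrows P (\<lambda>p. (p, (h, k))) g) \<omega>s = dlist a g"
    unfolding \<omega>s_def map_map by (rule map_cong) (auto simp: e1)
  have m23: "map (pullback AA P (\<lambda>q. (g, q)) (h, k)) \<omega>s = map (\<lambda>i. ext_d AA (\<lambda>q. F i (g, q)) (h, k)) [0..<n]"
    unfolding \<omega>s_def map_map by (rule map_cong) (auto simp: e23)
  have m2: "map (pullback arrows AA (\<lambda>p. (p, k)) h) (map (\<lambda>i. ext_d AA (\<lambda>q. F i (g, q)) (h, k)) [0..<n]) = dlist b h"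
    unfolding map_map by (rule map_cong) (auto simp: e2)
  have m3: "map (pullback arrows AA (\<lambda>p. (h, p)) k) (map (\<lambda>i. ext_d AA (\<lambda>q. F i (g, q)) (h, k)) [0..<n]) = dlist c k"
    unfolding map_map by (rule map_cong) (auto simp: e3)
  show ?thesis
    using zero m1 m23 m2 m3 unfolding multivector_oplus_def
    by (simp add: P_def AA_def k_def del: map_map)
qed

lemma dlist_cotangent: "set (dlist c g) \<subseteq> cotangent_space arrows g"
  using ext_d_cotangent[OF arrows] by auto

lemma zero_in_dlist:
  assumes "i < n" "c i = (\<lambda>p. r)" shows "N g (dlist c g) = 0"
proof (rule multivector_zero_slot[OF tensor_at _ dlist_cotangent])
  have "ext_d arrows (c i) g = (\<lambda>v. 0)" using ext_d_const[OF arrows] assms(2) by simp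
  then show "(\<lambda>v. 0) \<in> set (dlist c g)" using assms(1) by force
qed simp

text \<open>This cancels the sign \<open>(-1)\<^sup>n\<^sup>-\<^sup>1\<close> of the third factor against the \<open>n\<close> signs of its arguments.\<close>

lemma minus_dlist:
  assumes "\<And>i. i < n \<Longrightarrow> smooth_near arrows g (c i)"
  shows "(-1) ^ (n - 1) * N g (dlist (\<lambda>i p. - c i p) g) = - N g (dlist c g)"
proof -
  have "dlist (\<lambda>i p. - c i p) g = map (\<lambda>\<omega> v. - \<omega> v) (dlist c g)"
    unfolding map_map by (rule map_cong) (auto simp: ext_d_minus[OF arrows assms])
  then have "N g (dlist (\<lambda>i p. - c i p) g) = (-1) ^ n * N g (dlist c g)"
    using multivector_minus_all[OF tensor_at _ dlist_cotangent, of c g] by (simp del: map_map)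
  moreover have "(-1) ^ (n - 1) * ((-1) ^ n * r) = - r" for r :: real
    using n by (cases n) (simp_all add: minus_one_power_iff)
  ultimately show ?thesis by simp
qed

text \<open>Since \<open>\<alpha>(gh) = \<alpha>(g)\<close>, the triples \<open>(\<alpha>\<^sup>*f, 0, -\<alpha>\<^sup>*f)\<close> are admissible; at \<open>h = g\<inverse>\<close> the product
  is a unit.\<close>

lemma source_bracket_basic:
  assumes f: "\<And>i y. i < n \<Longrightarrow> smooth_near objects y (f i)"
  shows "N g (dlist (\<lambda>i p. f i (src G p)) g)
    = N (unt G (src G g)) (dlist (\<lambda>i p. f i (src G p)) (unt G (src G g)))"
proof -
  have "N g (dlist (\<lambda>i p. f i (src G p)) g) + N (ivs G g) (dlist (\<lambda>i p. 0) (ivs G g)) +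
    (-1) ^ (n - 1) * N (mul G g (ivs G g)) (dlist (\<lambda>i p. - f i (src G p)) (mul G g (ivs G g))) = 0"
  proof (rule multiplicative_on_functions)
    show "tgt G g = src G (ivs G g)" by (simp add: src_ivs)
    fix i assume i: "i < n"
    show "smooth_near arrows g (\<lambda>p. f i (src G p))" by (rule smooth_near_src[OF f[OF i]])
    show "smooth_near arrows (ivs G g) (\<lambda>p. 0)" by (rule smooth_near_const[OF arrows])
    show "smooth_near arrows (mul G g (ivs G g)) (\<lambda>p. - f i (src G p))"
      using smooth_near_diff[OF arrows smooth_near_const[OF arrows, of _ 0] smooth_near_src[OF f[OF i]]] by simp
    fix \<sigma> \<tau> \<rho> assume "composable_curves g (ivs G g) \<sigma> \<tau> \<rho>"
    then have "\<forall>\<^sub>F t in nhds 0. 0 = f i (src G (\<sigma> t)) + 0 + - f i (src G (\<rho> t))"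
      unfolding composable_curves_def by (elim conjE eventually_mono) (auto simp: src_mul)
    from has_real_derivative_eventually_eq[OF DERIV_const this]
    show "((\<lambda>t. f i (src G (\<sigma> t)) + 0 + - f i (src G (\<rho> t))) has_real_derivative 0) (at 0)" .
  qed
  moreover have "N (ivs G g) (dlist (\<lambda>i p. 0) (ivs G g)) = 0" by (rule zero_in_dlist[OF n]) simp
  ultimately show ?thesis
    using minus_dlist[of "unt G (src G g)" "\<lambda>i p. f i (src G p)"] smooth_near_src[OF f] by (simp add: mul_ivs)
qed

text \<open>The derivative of the multiplication at a pair of units. Let \<open>L\<close> and \<open>R\<close> be the partial derivatives
  of \<open>\<zeta> \<circ> m\<close>, where \<open>m\<close> smoothly extends the multiplication, and let \<open>\<upsilon>\<close> be the curve of units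
  \<open>\<epsilon>(\<beta>(\<sigma>)) = \<epsilon>(\<alpha>(\<tau>))\<close>. From \<open>\<sigma>\<upsilon> = \<sigma>\<close>, \<open>\<upsilon>\<tau> = \<tau>\<close> and \<open>\<upsilon>\<upsilon> = \<upsilon>\<close> the derivatives of \<open>\<zeta>\<close> along \<open>\<sigma>\<close> and \<open>\<tau>\<close>
  are \<open>L\<sigma> + R\<upsilon>\<close> and \<open>L\<upsilon> + R\<tau>\<close>, while \<open>L\<upsilon> + R\<upsilon> = 0\<close> as \<open>\<zeta>\<close> vanishes on units; their sum is the
  derivative \<open>L\<sigma> + R\<tau>\<close> along \<open>\<sigma>\<tau>\<close>.\<close>

lemma multiplication_derivative_at_unit:
  assumes \<zeta>: "smooth_near arrows (unt G x) \<zeta>" and unit: "\<And>y. \<zeta> (unt G y) = 0"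
    and curves: "composable_curves (unt G x) (unt G x) \<sigma> \<tau> \<rho>"
  shows "((\<lambda>t. \<zeta> (\<sigma> t) + \<zeta> (\<tau> t) + - \<zeta> (\<rho> t)) has_real_derivative 0) (at 0)"
proof -
  let ?e = "unt G x"
  define S where "S = {(g, h). tgt G g = src G h}"
  have "smooth_map_on_subset (prod_atlas arrows arrows) arrows S (\<lambda>(g, h). mul G g h)"
    using lie by (simp add: lie_groupoid_def S_def)
  moreover have eS: "(?e, ?e) \<in> S" by (simp add: S_def)
  ultimately obtain W m where Wm: "(?e, ?e) \<in> W" "smooth_map (prod_atlas arrows arrows) arrows W m"
    "\<forall>y\<in>W \<inter> S. m y = (\<lambda>(g, h). mul G g h) y"
    unfolding smooth_map_on_subset_def by metis
  have W3: "m (g, h) = mul G g h" if "(g, h) \<in> W" "tgt G g = src G h" for g h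
    using Wm(3) that by (auto simp: S_def)
  note W = Wm(1,2) W3
  have me: "m (?e, ?e) = ?e" using W(3)[OF W(1)] by (simp add: mul_unt_unt)
  have oW: "open W" using W(2) by (simp add: smooth_map_def)
  define P where "P = (\<lambda>z. \<zeta> (m z))"
  have P: "smooth_near (prod_atlas arrows arrows) (?e, ?e) P"
    unfolding P_def
    by (rule smooth_near_compose[OF smooth_manifold_prod[OF arrows arrows] arrows smooth_map_imp_at[OF W(2,1)]]) (simp add: me \<zeta>)
  define L where "L = (\<lambda>\<mu>. velocity arrows \<mu> (\<lambda>p. P (p, ?e)))"
  define R where "R = (\<lambda>\<mu>. velocity arrows \<mu> (\<lambda>p. P (?e, p)))"
  have key: "((\<lambda>t. \<zeta> (\<kappa> t)) has_real_derivative L \<mu> + R \<nu>) (at 0)"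
    if "composable_curves ?e ?e \<mu> \<nu> \<kappa>" for \<mu> \<nu> \<kappa>
  proof -
    have c: "smooth_at std_atlas arrows 0 \<mu>" "smooth_at std_atlas arrows 0 \<nu>" "\<mu> 0 = ?e" "\<nu> 0 = ?e"
      "\<forall>\<^sub>F t in nhds 0. tgt G (\<mu> t) = src G (\<nu> t) \<and> \<kappa> t = mul G (\<mu> t) (\<nu> t)"
      using that by (auto simp: composable_curves_def)
    have "isCont (\<lambda>t. (\<mu> t, \<nu> t)) 0"
      by (intro isCont_Pair smooth_at_continuous[OF c(1)] smooth_at_continuous[OF c(2)])
    moreover have "\<forall>\<^sub>F z in nhds (\<mu> 0, \<nu> 0). z \<in> W"
      using oW W(1) c(3,4) by (intro eventually_nhds_in_open) auto
    ultimately have "\<forall>\<^sub>F t in nhds 0. (\<mu> t, \<nu> t) \<in> W" by (rule eventually_compose_curve)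
    then have ev: "\<forall>\<^sub>F t in nhds 0. P (\<mu> t, \<nu> t) = \<zeta> (\<kappa> t)"
      using c(5) by eventually_elim (auto simp: P_def W(3))
    have "((\<lambda>t. P (\<mu> t, \<nu> t)) has_real_derivative L \<mu> + R \<nu>) (at 0)"
      using velocity_prod[OF arrows arrows c(1,2)] P c(3,4) by (simp add: L_def R_def)
    then show ?thesis using ev by (rule has_real_derivative_eventually_eq)
  qed
  have c: "smooth_at std_atlas arrows 0 \<sigma>" "smooth_at std_atlas arrows 0 \<tau>" "\<sigma> 0 = ?e" "\<tau> 0 = ?e"
    "\<forall>\<^sub>F t in nhds 0. tgt G (\<sigma> t) = src G (\<tau> t) \<and> \<rho> t = mul G (\<sigma> t) (\<tau> t)"
    using curves by (auto simp: composable_curves_def)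
  define \<upsilon> where "\<upsilon> = (\<lambda>t. unt G (tgt G (\<sigma> t)))"
  have \<upsilon>: "smooth_at std_atlas arrows 0 \<upsilon>" "\<upsilon> 0 = ?e"
    unfolding \<upsilon>_def
    by (rule smooth_at_compose[OF smooth_manifold_real objects arrows smooth_at_compose[OF smooth_manifold_real arrows objects c(1) tgt_smooth] unt_smooth])
      (simp add: c(3))
  have "composable_curves ?e ?e \<sigma> \<upsilon> \<sigma>"
    using c(1,3) \<upsilon> by (simp add: composable_curves_def mul_unt_unt \<upsilon>_def mul_unt_right)
  from key[OF this] have d1: "((\<lambda>t. \<zeta> (\<sigma> t)) has_real_derivative L \<sigma> + R \<upsilon>) (at 0)" .
  have "\<forall>\<^sub>F t in nhds 0. tgt G (\<upsilon> t) = src G (\<tau> t) \<and> \<tau> t = mul G (\<upsilon> t) (\<tau> t)"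
    using c(5) by eventually_elim (auto simp: \<upsilon>_def mul_unt_left)
  then have "composable_curves ?e ?e \<upsilon> \<tau> \<tau>"
    using c(2,4) \<upsilon> by (simp add: composable_curves_def mul_unt_unt)
  from key[OF this] have d2: "((\<lambda>t. \<zeta> (\<tau> t)) has_real_derivative L \<upsilon> + R \<tau>) (at 0)" .
  have "composable_curves ?e ?e \<upsilon> \<upsilon> \<upsilon>"
    using \<upsilon> by (simp add: composable_curves_def mul_unt_unt) (simp add: \<upsilon>_def mul_unt_unt)
  from key[OF this] have "((\<lambda>t. 0) has_real_derivative L \<upsilon> + R \<upsilon>) (at 0)" by (simp add: \<upsilon>_def unit)
  then have "L \<upsilon> + R \<upsilon> = 0" using DERIV_unique[OF _ DERIV_const] by blast
  then show ?thesis
    using DERIV_add[OF DERIV_add[OF d1 d2] DERIV_minus[OF key[OF curves]]] by (simp add: algebra_simps)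
qed

text \<open>The triples \<open>(c, c, -c)\<close> give three equal terms with signs \<open>+\<close>, \<open>+\<close>, \<open>-\<close>.\<close>

lemma units_coisotropic:
  assumes c: "\<And>i. i < n \<Longrightarrow> smooth_near arrows (unt G x) (c i)" and unit: "\<And>i y. i < n \<Longrightarrow> c i (unt G y) = 0"
  shows "N (unt G x) (dlist c (unt G x)) = 0"
proof -
  let ?e = "unt G x"
  have "N ?e (dlist c ?e) + N ?e (dlist c ?e) +
    (-1) ^ (n - 1) * N (mul G ?e ?e) (dlist (\<lambda>i p. - c i p) (mul G ?e ?e)) = 0"
  proof (rule multiplicative_on_functions)
    fix i assume i: "i < n"
    show "smooth_near arrows ?e (c i)" "smooth_near arrows ?e (c i)" by (rule c[OF i])+
    show "smooth_near arrows (mul G ?e ?e) (\<lambda>p. - c i p)"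
      using smooth_near_diff[OF arrows smooth_near_const[OF arrows, of _ 0] c[OF i]] by (simp add: mul_unt_unt)
    fix \<sigma> \<tau> \<rho> assume "composable_curves ?e ?e \<sigma> \<tau> \<rho>"
    then show "((\<lambda>t. c i (\<sigma> t) + c i (\<tau> t) + - c i (\<rho> t)) has_real_derivative 0) (at 0)"
      by (rule multiplication_derivative_at_unit[OF c[OF i] unit[OF i]])
  qed simp
  then show ?thesis using minus_dlist[of ?e c] c by (simp add: mul_unt_unt)
qed

text \<open>The source of the sign in the comparison of the two brackets. The first \<open>n - 1\<close> triples vanish
  along the graph because \<open>\<beta>(g) = \<alpha>(h)\<close> and \<open>\<alpha>(gh) = \<alpha>(g)\<close>. In the last triple the middle
  component is \<open>0\<close>, so the middle term drops out, and the third term carries a single minus sign.\<close>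

lemma mixed_bracket_at_unit:
  assumes f: "\<And>i. i < n \<Longrightarrow> smooth_near objects x (f i)"
  shows "N (unt G x) (dlist (\<lambda>i p. if i < n - 1 then f i (tgt G p) - f i (src G p) else f i (src G p)) (unt G x))
    = (-1) ^ (n - 1) * N (unt G x) (dlist (\<lambda>i p. f i (src G p)) (unt G x))"
proof -
  let ?e = "unt G x"
  let ?a = "\<lambda>i p. if i < n - 1 then f i (tgt G p) - f i (src G p) else f i (src G p)"
  let ?b = "\<lambda>i p. if i < n - 1 then - f i (src G p) else 0"
  let ?c = "\<lambda>i p. if i < n - 1 then f i (src G p) else - f i (src G p)"
  have fs: "smooth_near arrows ?e (\<lambda>p. f i (src G p))" "smooth_near arrows ?e (\<lambda>p. f i (tgt G p))" if "i < n" for i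
    using smooth_near_src[of ?e "f i"] smooth_near_tgt[of ?e "f i"] f[OF that] by simp_all
  have neg: "smooth_near arrows ?e (\<lambda>p. - f i (src G p))" if "i < n" for i
    using smooth_near_diff[OF arrows smooth_near_const[OF arrows, of _ 0] fs(1)[OF that]] by simp
  have main: "N ?e (dlist ?a ?e) + N ?e (dlist ?b ?e) + (-1) ^ (n - 1) * N (mul G ?e ?e) (dlist ?c (mul G ?e ?e)) = 0"
  proof (rule multiplicative_on_functions)
    fix i assume i: "i < n"
    show "smooth_near arrows ?e (?a i)" 
      using fs[OF i] smooth_near_diff[OF arrows fs(2,1)[OF i]] by (cases "i < n - 1") simp_all
    show "smooth_near arrows ?e (?b i)" 
      using neg[OF i] smooth_near_const[OF arrows] by (cases "i < n - 1") simp_all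
    show "smooth_near arrows (mul G ?e ?e) (?c i)" 
      using fs[OF i] neg[OF i] by (cases "i < n - 1") (simp_all add: mul_unt_unt)
    fix \<sigma> \<tau> \<rho> assume "composable_curves ?e ?e \<sigma> \<tau> \<rho>"
    then have "\<forall>\<^sub>F t in nhds 0. 0 = ?a i (\<sigma> t) + ?b i (\<tau> t) + ?c i (\<rho> t)"
      unfolding composable_curves_def by (elim conjE eventually_mono) (auto simp: src_mul)
    from has_real_derivative_eventually_eq[OF DERIV_const this]
    show "((\<lambda>t. ?a i (\<sigma> t) + ?b i (\<tau> t) + ?c i (\<rho> t)) has_real_derivative 0) (at 0)" .
  qed simp
  have "N ?e (dlist ?b ?e) = 0" by (rule zero_in_dlist[of "n - 1" _ 0]) (use n in auto)
  moreover have "N ?e (dlist ?c ?e) = - N ?e (dlist (\<lambda>i p. f i (src G p)) ?e)"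
  proof -
    obtain m where m: "n = Suc m" using n by (cases n) auto
    let ?\<omega> = "map (\<lambda>i. ext_d arrows (\<lambda>p. f i (src G p)) ?e) [0..<m]"
    let ?\<xi> = "ext_d arrows (\<lambda>p. f m (src G p)) ?e"
    have "ext_d arrows (?c m) ?e = (\<lambda>v. - ?\<xi> v)" using ext_d_minus[OF arrows fs(1)[of m]] m by simp
    moreover have "map (\<lambda>i. ext_d arrows (?c i) ?e) [0..<m] = ?\<omega>" using m by simp
    moreover have "dlist ?c ?e = map (\<lambda>i. ext_d arrows (?c i) ?e) [0..<m] @ [ext_d arrows (?c m) ?e]" using m by simp
    ultimately have "dlist ?c ?e = ?\<omega> @ [\<lambda>v. (-1) * ?\<xi> v + 0 * ?\<xi> v]" by simp
    moreover have "N ?e (?\<omega> @ [\<lambda>v. (-1) * ?\<xi> v + 0 * ?\<xi> v]) = (-1) * N ?e (?\<omega> @ [?\<xi>]) + 0 * N ?e (?\<omega> @ [?\<xi>])"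
      by (rule multivector_last_lincomb[OF tensor_at[unfolded m]]) (auto simp: ext_d_cotangent[OF arrows])
    moreover have "dlist (\<lambda>i p. f i (src G p)) ?e = ?\<omega> @ [?\<xi>]" using m by simp
    ultimately show ?thesis by simp
  qed
  ultimately show ?thesis using main by (simp add: mul_unt_unt)
qed

text \<open>Uniqueness: \<open>v\<close> splits into \<open>u = d\<epsilon> d\<alpha> v\<close>, tangent to the units, and \<open>w = v - u\<close>, which \<open>d\<alpha>\<close>
  kills and which is therefore tangent to the source fibre.\<close>

lemma to_conormal_d_A:
  assumes f: "smooth_near objects x f"
  shows "to_conormal G x (d_A G f x) = ext_d arrows (\<lambda>p. f (tgt G p) - f (src G p)) (unt G x)"
proof -
  let ?e = "unt G x"
  let ?f = "\<lambda>p. f (tgt G p) - f (src G p)"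
  let ?\<eta> = "ext_d arrows ?f ?e"
  have ft: "smooth_near arrows ?e (\<lambda>p. f (tgt G p))" using smooth_near_tgt[of ?e f] f by simp
  have fs: "smooth_near arrows ?e (\<lambda>p. f (src G p))" using smooth_near_src[of ?e f] f by simp
  note fd = smooth_near_diff[OF arrows ft fs]
  have con: "?\<eta> \<in> conormal_space arrows (range (unt G)) ?e"
    unfolding conormal_space_def
  proof (intro CollectI conjI ext_d_cotangent[OF arrows] ballI)
    fix v assume "v \<in> tangent_space arrows (range (unt G)) ?e"
    then obtain \<gamma> where \<gamma>: "\<gamma> 0 = ?e" "smooth_at std_atlas arrows 0 \<gamma>" "\<forall>\<^sub>F t in nhds 0. \<gamma> t \<in> range (unt G)"
      "v = velocity arrows \<gamma>" by (rule tangent_spaceE)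
    have "\<forall>\<^sub>F t in nhds 0. 0 = ?f (\<gamma> t)" by (rule eventually_mono[OF \<gamma>(3)]) auto
    from has_real_derivative_eventually_eq[OF DERIV_const this] velocity_eqI[OF arrows \<gamma>(2), of ?f 0] fd \<gamma>(1,4)
    have "v ?f = 0" by simp
    then show "?\<eta> v = 0" by (simp add: ext_d_def)
  qed
  have fibre: "?\<eta> X = d_A G f x X" if X: "X \<in> algebroid_fibre G x" for X
  proof -
    obtain \<gamma> where \<gamma>: "\<gamma> 0 = ?e" "smooth_at std_atlas arrows 0 \<gamma>" "\<forall>\<^sub>F t in nhds 0. \<gamma> t \<in> src G -` {x}"
      "X = velocity arrows \<gamma>" using X unfolding algebroid_fibre_def by (rule tangent_spaceE)
    have T: "X \<in> tangent_space arrows UNIV ?e" using X tangent_space_subset by (auto simp: algebroid_fibre_def)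
    have "\<forall>\<^sub>F t in nhds 0. f x = f (src G (\<gamma> t))" by (rule eventually_mono[OF \<gamma>(3)]) auto
    from has_real_derivative_eventually_eq[OF DERIV_const this]
      velocity_eqI[OF arrows \<gamma>(2), of "\<lambda>p. f (src G p)" 0] fs \<gamma>(1,4)
    have "X (\<lambda>p. f (src G p)) = 0" by simp
    then have "X ?f = X (\<lambda>p. f (tgt G p))"
      using tangent_function_lincomb[OF arrows T ft fs, of 1 "-1"] by simp
    then show ?thesis
      using X T f by (simp add: ext_d_def d_A_def algebroid_anchor_def differential_def o_def)
  qed
  have unique: "\<omega> = ?\<eta>"
    if \<omega>: "\<omega> \<in> conormal_space arrows (range (unt G)) ?e" "\<forall>X\<in>algebroid_fibre G x. \<omega> X = d_A G f x X" for \<omega>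
  proof
    fix v
    have \<omega>c: "\<omega> \<in> cotangent_space arrows ?e" using \<omega>(1) by (simp add: conormal_space_def)
    note \<eta>c = ext_d_cotangent[OF arrows, of ?f ?e]
    show "\<omega> v = ?\<eta> v"
    proof (cases "v \<in> tangent_space arrows UNIV ?e")
      case False
      then show ?thesis using \<omega>c \<eta>c by (simp add: cotangent_space_def)
    next
      case True
      then obtain \<gamma> where \<gamma>: "\<gamma> 0 = ?e" "smooth_at std_atlas arrows 0 \<gamma>" "v = velocity arrows \<gamma>"
        by (rule tangent_spaceE)
      define u where "u = velocity arrows (\<lambda>t. unt G (src G (\<gamma> t)))"
      have sm: "smooth_at std_atlas arrows 0 (\<lambda>t. unt G (src G (\<gamma> t)))"
        by (rule smooth_at_compose[OF smooth_manifold_real objects arrows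
              smooth_at_compose[OF smooth_manifold_real arrows objects \<gamma>(2) src_smooth] unt_smooth])
      have uM: "u \<in> tangent_space arrows (range (unt G)) ?e"
        unfolding u_def by (rule tangent_spaceI) (auto simp: sm \<gamma>(1))
      then have uT: "u \<in> tangent_space arrows UNIV ?e" by (rule tangent_space_subset)
      define w where "w = (\<lambda>f. 1 * v f + (-1) * u f)"
      have wT: "w \<in> tangent_space arrows UNIV ?e" unfolding w_def by (rule tangent_lincomb[OF arrows True uT])
      have "w (\<lambda>p. h (src G p)) = 0" if h: "smooth_near objects x h" for h
        using smooth_near_src[of ?e h] h \<gamma>(1) by (simp add: w_def u_def \<gamma>(3) velocity_def)
      then have wA: "w \<in> algebroid_fibre G x"
        unfolding algebroid_fibre_def
        by (intro tangent_level_set[OF arrows objects src_smooth unt_smooth _ wT]) auto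
      have v: "v = (\<lambda>f. 1 * w f + 1 * u f)" by (simp add: w_def)
      have "\<omega> u = 0" "?\<eta> u = 0" using \<omega>(1) con uM by (auto simp: conormal_space_def)
      moreover have "\<omega> w = ?\<eta> w" using \<omega>(2) fibre wA by simp
      moreover have "\<omega> v = 1 * \<omega> w + 1 * \<omega> u" unfolding v by (rule cotangent_linear[OF \<omega>c wT uT])
      moreover have "?\<eta> v = 1 * ?\<eta> w + 1 * ?\<eta> u" unfolding v by (rule cotangent_linear[OF \<eta>c wT uT])
      ultimately show ?thesis by simp
    qed
  qed
  show ?thesis
    unfolding to_conormal_def
  proof (rule the_equality)
    show "?\<eta> \<in> conormal_space arrows (range (unt G)) ?e \<and> (\<forall>X\<in>algebroid_fibre G x. ?\<eta> X = d_A G f x X)"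
      using con fibre by simp
  qed (rule unique, simp_all)
qed

text \<open>The vector \<open>s = \<Pi>\<^sup>\<sharp>(\<omega>s)\<close> agrees with \<open>d\<epsilon> d\<alpha> s\<close>: it takes the same value on \<open>h\<close> and on
  \<open>h \<circ> \<epsilon> \<circ> \<alpha>\<close>, because their difference vanishes on the units and these are coisotropic. So the anchor
  is \<open>d\<alpha> s\<close>, and applying it to \<open>f\<close> means applying \<open>s\<close> to \<open>f \<circ> \<alpha>\<close>.\<close>

lemma bialgebroid_anchor_apply:
  assumes m: "n = Suc m" and c: "\<And>i. i < m \<Longrightarrow> smooth_near arrows (unt G x) (c i)"
    and unit: "\<And>i y. i < m \<Longrightarrow> c i (unt G y) = 0" and f: "smooth_near objects x f"
  defines "\<omega>s \<equiv> map (\<lambda>i. ext_d arrows (c i) (unt G x)) [0..<m]"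
  shows "bialgebroid_anchor G N x \<omega>s f = N (unt G x) (\<omega>s @ [ext_d arrows (\<lambda>p. f (src G p)) (unt G x)])"
proof -
  let ?e = "unt G x"
  define s where "s = sharp arrows N ?e \<omega>s"
  have \<omega>: "length \<omega>s = m" "set \<omega>s \<subseteq> cotangent_space arrows ?e"
    using ext_d_cotangent[OF arrows] by (auto simp: \<omega>s_def)
  note tm = tensor_at[unfolded m]
  note spec = sharp_spec[of arrows m ?e N \<omega>s, OF arrows tm \<omega>, folded s_def]
  have sf: "s h = N ?e (\<omega>s @ [ext_d arrows h ?e])" for h
    using spec(2)[OF ext_d_cotangent[OF arrows, of h]] spec(1) by (simp add: ext_d_def)
  have s_base: "s h = s (\<lambda>p. h (unt G (src G p)))" if h: "smooth_near arrows ?e h" for h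
  proof -
    let ?h = "\<lambda>p. h (unt G (src G p))"
    have h': "smooth_near arrows ?e ?h"
      using smooth_near_src[of ?e "\<lambda>y. h (unt G y)"] smooth_near_compose[OF objects arrows unt_smooth, of x h] h by simp
    \<comment> \<open>All \<open>n\<close> of these functions vanish on the units.\<close>
    define z where "z = (\<lambda>i. if i < m then c i else (\<lambda>p. h p - ?h p))"
    have "N ?e (dlist z ?e) = 0"
    proof (rule units_coisotropic)
      show "smooth_near arrows ?e (z i)" if "i < n" for i
        using c smooth_near_diff[OF arrows h h'] by (cases "i < m") (simp_all add: z_def)
      show "z i (unt G y) = 0" if "i < n" for i y
        using unit by (simp add: z_def)
    qed
    moreover have "dlist z ?e = \<omega>s @ [\<lambda>v. 1 * ext_d arrows h ?e v + (-1) * ext_d arrows ?h ?e v]"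
      using ext_d_diff[OF arrows h h'] by (simp add: m z_def \<omega>s_def)
    moreover have "N ?e (\<omega>s @ [\<lambda>v. 1 * ext_d arrows h ?e v + (-1) * ext_d arrows ?h ?e v])
      = 1 * N ?e (\<omega>s @ [ext_d arrows h ?e]) + (-1) * N ?e (\<omega>s @ [ext_d arrows ?h ?e])"
      by (rule multivector_last_lincomb[OF tm \<omega>]) (rule ext_d_cotangent[OF arrows])+
    ultimately show ?thesis by (simp add: sf)
  qed
  define v where "v = differential objects (src G) ?e s"
  have vT: "v \<in> tangent_space objects UNIV x"
    using differential_tangent[OF arrows objects src_smooth spec(1)] by (simp add: v_def)
  have vs: "differential arrows (unt G) x v = s"
  proof (rule tangent_eqI[OF differential_tangent[OF objects arrows unt_smooth vT] spec(1)])
    fix h assume h: "smooth_near arrows ?e h"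
    have "smooth_near objects x (\<lambda>y. h (unt G y))" by (rule smooth_near_compose[OF objects arrows unt_smooth h])
    then show "differential arrows (unt G) x v h = s h"
      using h s_base[OF h] by (simp add: differential_def v_def o_def)
  qed
  have "bialgebroid_anchor G N x \<omega>s = v"
    unfolding bialgebroid_anchor_def s_def[symmetric]
  proof (rule the_equality)
    show "v \<in> tangent_space objects UNIV x \<and> differential arrows (unt G) x v = s" using vT vs by simp
    fix v' assume v': "v' \<in> tangent_space objects UNIV x \<and> differential arrows (unt G) x v' = s"
    show "v' = v"
    proof (rule tangent_eqI[OF conjunct1[OF v'] vT])
      fix h assume h: "smooth_near objects x h"
      have "smooth_near arrows ?e (\<lambda>p. h (src G p))" using smooth_near_src[of ?e h] h by simp
      then have "u h = differential arrows (unt G) x u (\<lambda>p. h (src G p))" for u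
        by (simp add: differential_def o_def)
      then show "v' h = v h" using v' vs by metis
    qed
  qed
  moreover have "v f = s (\<lambda>p. f (src G p))" using f by (simp add: v_def differential_def o_def)
  ultimately show ?thesis by (simp add: sf)
qed

lemma bialgebroid_bracket_eq:
  assumes fs: "fs \<in> smooth_tuples objects n"
  shows "bialgebroid_bracket G N fs x
    = (-1) ^ (n - 1) * N (unt G x) (map (\<lambda>f. ext_d arrows (\<lambda>p. f (src G p)) (unt G x)) fs)"
proof -
  let ?e = "unt G x"
  obtain m where m: "n = Suc m" using n by (cases n) auto
  have len: "length fs = n" using fs by (simp add: smooth_tuples_def)
  have sm: "smooth_near objects y (fs ! i)" if "i < n" for i y
    using smooth_tuples_nth[OF fs that] by (simp add: smooth_functions_iff[OF objects])
  let ?c = "\<lambda>i p. (fs ! i) (tgt G p) - (fs ! i) (src G p)"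
  let ?\<omega> = "map (\<lambda>i. ext_d arrows (?c i) ?e) [0..<m]"
  have c: "smooth_near arrows ?e (?c i)" if "i < m" for i
    by (rule smooth_near_diff[OF arrows smooth_near_tgt smooth_near_src]) (use sm that m in auto)
  have "map (\<lambda>f. to_conormal G x (d_A G f x)) (butlast fs) = ?\<omega>"
  proof (rule nth_equalityI)
    fix i assume "i < length (map (\<lambda>f. to_conormal G x (d_A G f x)) (butlast fs))"
    then have i: "i < m" using len m by simp
    then show "map (\<lambda>f. to_conormal G x (d_A G f x)) (butlast fs) ! i = ?\<omega> ! i"
      using len m to_conormal_d_A[OF sm[of i]] by (simp add: nth_butlast)
  qed (use len m in simp)
  moreover have "last fs = fs ! m" using len m by (metis diff_Suc_1 last_conv_nth length_0_conv nat.distinct(1))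
  ultimately have "bialgebroid_bracket G N fs x = bialgebroid_anchor G N x ?\<omega> (fs ! m)"
    by (simp add: bialgebroid_bracket_def)
  also have "\<dots> = N ?e (?\<omega> @ [ext_d arrows (\<lambda>p. (fs ! m) (src G p)) ?e])"
    by (rule bialgebroid_anchor_apply[OF m c]) (use sm m in auto)
  also have "?\<omega> @ [ext_d arrows (\<lambda>p. (fs ! m) (src G p)) ?e]
    = dlist (\<lambda>i p. if i < n - 1 then (fs ! i) (tgt G p) - (fs ! i) (src G p) else (fs ! i) (src G p)) ?e"
    using m by simp
  also have "N ?e \<dots> = (-1) ^ (n - 1) * N ?e (dlist (\<lambda>i p. (fs ! i) (src G p)) ?e)"
    by (rule mixed_bracket_at_unit) (rule sm)
  also have "dlist (\<lambda>i p. (fs ! i) (src G p)) ?e = map (\<lambda>f. ext_d arrows (\<lambda>p. f (src G p)) ?e) fs"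
    by (rule nth_equalityI) (use len in auto)
  finally show ?thesis .
qed

text \<open>Evaluating \<open>{\<alpha>\<^sup>*f\<^sub>1, \<dots>, \<alpha>\<^sup>*f\<^sub>n}\<close> at units defines a bracket on \<open>M\<close> through which the bracket on \<open>G\<close>
  factors; this yields the axioms, and any other bracket with the defining property has the same
  values because \<open>\<alpha> \<circ> \<epsilon> = id\<close>.\<close>

lemma base_bracket_eq:
  assumes fs: "fs \<in> smooth_tuples objects n"
  shows "base_bracket n G N fs x = N (unt G x) (map (\<lambda>f. ext_d arrows (\<lambda>p. f (src G p)) (unt G x)) fs)"
proof -
  define T where "T = smooth_tuples objects n"
  define lift where "lift = map (\<lambda>f :: 'm \<Rightarrow> real. f \<circ> src G)"
  define TB where "TB = tensor_bracket arrows N"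
  \<comment> \<open>Restricted to \<open>T\<close> because the definition of the bracket on \<open>M\<close> asks for an extensional function.\<close>
  define br where "br = restrict (\<lambda>fs y. TB (lift fs) (unt G y)) T"
  have br: "br fs = (\<lambda>y. TB (lift fs) (unt G y))" if "fs \<in> T" for fs using that by (simp add: br_def)
  have lift_fun: "f \<circ> src G \<in> smooth_functions arrows" if "f \<in> smooth_functions objects" for f
    using smooth_near_src[of _ f] that by (simp add: smooth_functions_iff[OF arrows] smooth_functions_iff[OF objects] o_def)
  have lift_tuple: "lift fs \<in> smooth_tuples arrows k" if "fs \<in> smooth_tuples objects k" for fs k
    using that lift_fun by (auto simp: smooth_tuples_def lift_def)
  have basic: "br fs \<circ> src G = TB (lift fs)" if T: "fs \<in> T" for fs
  proof
    fix g
    have len: "length fs = n" using T by (simp add: T_def smooth_tuples_def)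
    have sm: "smooth_near objects y (fs ! i)" if "i < n" for i y
      using smooth_tuples_nth[of fs objects n i] T that smooth_functions_iff[OF objects] by (simp add: T_def)
    have "map (\<lambda>f. ext_d arrows f g) (lift fs) = dlist (\<lambda>i p. (fs ! i) (src G p)) g" for g
      by (rule nth_equalityI) (use len in \<open>auto simp: lift_def o_def\<close>)
    then show "(br fs \<circ> src G) g = TB (lift fs) g"
      using source_bracket_basic[of "\<lambda>i. fs ! i" g] sm
      by (simp add: br[OF T] TB_def tensor_bracket_def)
  qed
  have np: "nambu_poisson arrows n TB" using tensor by (simp add: nambu_tensor_def TB_def)
  have lift_upd: "lift (fs[i := f]) = (lift fs)[i := f \<circ> src G]" for fs i f by (simp add: lift_def map_update)
  have lift_nth: "lift fs ! i = fs ! i \<circ> src G" if "i < length fs" for fs i using that by (simp add: lift_def)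
  have lift_snoc: "lift (fs @ [f]) = lift fs @ [f \<circ> src G]" for fs f by (simp add: lift_def)
  have len: "length fs = n" if "fs \<in> T" for fs using that by (simp add: T_def smooth_tuples_def)
  have br_smooth: "br fs \<in> smooth_functions objects" if T: "fs \<in> T" for fs
  proof -
    have "TB (lift fs) \<in> smooth_functions arrows"
      using np lift_tuple[of fs n] T unfolding nambu_poisson_def T_def by blast
    then show ?thesis
      using smooth_near_compose[OF objects arrows unt_smooth] by (simp add: smooth_functions_iff[OF arrows] smooth_functions_iff[OF objects] br[OF T])
  qed
  have np': "nambu_poisson objects n br"
    unfolding nambu_poisson_def T_def[symmetric]
  proof (intro conjI ballI allI impI)
    fix fs assume "fs \<in> T" then show "br fs \<in> smooth_functions objects" by (rule br_smooth)
  next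
    fix fs i j assume h: "fs \<in> T" "i < n" "j < n" "i \<noteq> j"
    have T': "fs[i := fs ! j, j := fs ! i] \<in> T"
      using h unfolding T_def by (intro smooth_tuples_update smooth_tuples_nth)
    have "TB ((lift fs)[i := lift fs ! j, j := lift fs ! i]) = (\<lambda>x. - TB (lift fs) x)"
      using np lift_tuple[of fs n] h unfolding nambu_poisson_def T_def by blast
    then show "br (fs[i := fs ! j, j := fs ! i]) = (\<lambda>x. - br fs x)"
      using h len[OF h(1)] by (simp add: br[OF T'] br lift_upd lift_nth)
  next
    fix fs i f g and a b :: real
    assume h: "fs \<in> T" "i < n" "f \<in> smooth_functions objects" "g \<in> smooth_functions objects"
    have lc: "(\<lambda>x. a * f x + b * g x) \<in> smooth_functions objects"
      using h(3,4) smooth_near_lincomb[OF objects] by (simp add: smooth_functions_iff[OF objects])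
    have T': "fs[i := (\<lambda>x. a * f x + b * g x)] \<in> T" "fs[i := f] \<in> T" "fs[i := g] \<in> T"
      using h lc unfolding T_def by (auto intro: smooth_tuples_update)
    have "TB ((lift fs)[i := (\<lambda>x. a * (f \<circ> src G) x + b * (g \<circ> src G) x)])
      = (\<lambda>x. a * TB ((lift fs)[i := f \<circ> src G]) x + b * TB ((lift fs)[i := g \<circ> src G]) x)"
      using np lift_tuple[of fs n] lift_fun[OF h(3)] lift_fun[OF h(4)] h(1,2) unfolding nambu_poisson_def T_def by blast
    then show "br (fs[i := (\<lambda>x. a * f x + b * g x)]) = (\<lambda>x. a * br (fs[i := f]) x + b * br (fs[i := g]) x)"
      by (simp add: br T' lift_upd o_def)
  next
    fix fs f g
    assume h: "fs \<in> smooth_tuples objects (n - 1)" "f \<in> smooth_functions objects" "g \<in> smooth_functions objects"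
    have ml: "(\<lambda>x. f x * g x) \<in> smooth_functions objects"
      using h(2,3) smooth_near_mult[OF objects] by (simp add: smooth_functions_iff[OF objects])
    have T': "fs @ [\<lambda>x. f x * g x] \<in> T" "fs @ [f] \<in> T" "fs @ [g] \<in> T"
      unfolding T_def by (intro smooth_tuples_snoc[OF h(1) _ n] ml h(2,3))+
    have "TB (lift fs @ [\<lambda>x. (f \<circ> src G) x * (g \<circ> src G) x])
      = (\<lambda>x. (f \<circ> src G) x * TB (lift fs @ [g \<circ> src G]) x + TB (lift fs @ [f \<circ> src G]) x * (g \<circ> src G) x)"
      using np lift_tuple[OF h(1)] lift_fun[OF h(2)] lift_fun[OF h(3)] unfolding nambu_poisson_def by blast
    then show "br (fs @ [\<lambda>x. f x * g x]) = (\<lambda>x. f x * br (fs @ [g]) x + br (fs @ [f]) x * g x)"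
      by (simp add: br T' lift_snoc o_def)
  next
    fix fs gs assume h: "fs \<in> smooth_tuples objects (n - 1)" "gs \<in> T"
    have T1: "fs @ [f] \<in> T" if "f \<in> smooth_functions objects" for f
      unfolding T_def by (rule smooth_tuples_snoc[OF h(1) that n])
    have gk: "gs ! k \<in> smooth_functions objects" if "k < n" for k
      using smooth_tuples_nth h(2) that unfolding T_def by blast
    have T2: "gs[k := br (fs @ [gs ! k])] \<in> T" if "k < n" for k
      using smooth_tuples_update[OF h(2)[unfolded T_def] br_smooth[OF T1[OF gk[OF that]]]] by (simp add: T_def)
    have lift2: "TB (lift fs @ [lift gs ! k]) = br (fs @ [gs ! k]) \<circ> src G" if "k < n" for k
      using basic[OF T1[OF gk[OF that]]] that len[OF h(2)] by (simp add: lift_snoc lift_nth)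
    have fi: "TB (lift fs @ [TB (lift gs)]) = (\<lambda>x. \<Sum>k<n. TB ((lift gs)[k := TB (lift fs @ [lift gs ! k])]) x)"
      using np lift_tuple[OF h(1)] lift_tuple[of gs n] h(2) unfolding nambu_poisson_def T_def by blast
    show "br (fs @ [br gs]) = (\<lambda>x. \<Sum>k<n. br (gs[k := br (fs @ [gs ! k])]) x)"
    proof
      fix y
      have "br (fs @ [br gs]) y = TB (lift fs @ [TB (lift gs)]) (unt G y)"
        by (simp add: br[OF T1[OF br_smooth[OF h(2)]]] lift_snoc basic[OF h(2)])
      also have "\<dots> = (\<Sum>k<n. TB ((lift gs)[k := TB (lift fs @ [lift gs ! k])]) (unt G y))"
        by (simp add: fi)
      also have "\<dots> = (\<Sum>k<n. br (gs[k := br (fs @ [gs ! k])]) y)"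
        by (rule sum.cong) (simp_all add: lift2 br[OF T2] lift_upd)
      finally show "br (fs @ [br gs]) y = (\<Sum>k<n. br (gs[k := br (fs @ [gs ! k])]) y)" .
    qed
  qed
  have map': "nambu_poisson_map objects n TB br (src G)"
    unfolding nambu_poisson_map_def using basic by (simp add: T_def lift_def)
  have "base_bracket n G N = br"
    unfolding base_bracket_def TB_def[symmetric] T_def[symmetric]
  proof (rule the_equality)
    show "br \<in> extensional T \<and> nambu_poisson objects n br \<and> nambu_poisson_map objects n TB br (src G)"
      using np' map' by (simp add: br_def)
    fix b assume b: "b \<in> extensional T \<and> nambu_poisson objects n b \<and> nambu_poisson_map objects n TB b (src G)"
    show "b = br"
    proof (rule extensionalityI[of _ T])
      fix fs assume T: "fs \<in> T"
      have "TB (lift fs) = b fs \<circ> src G" using b T by (simp add: nambu_poisson_map_def T_def lift_def)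
      then show "b fs = br fs" by (simp add: br[OF T] fun_eq_iff)
    qed (use b in \<open>simp_all add: br_def\<close>)
  qed
  then show ?thesis
    using fs by (simp add: br T_def TB_def tensor_bracket_def lift_def o_def)
qed

end

theorem proposition5p9:
  fixes G :: "('g::{t2_space, second_countable_topology}, 'a::real_normed_vector,
      'm::{t2_space, second_countable_topology}, 'b::real_normed_vector) groupoid_data"
    and N :: "'g \<Rightarrow> 'g cvec list \<Rightarrow> real"
    and n :: nat
  assumes "n > 2"
    and "nambu_lie_groupoid n G N"
  shows "\<forall>fs\<in>smooth_tuples (obj G) n. \<forall>x.
           base_bracket n G N fs x = (-1) ^ (n - 1) * bialgebroid_bracket G N fs x"
proof (intro ballI allI)
  fix fs x assume fs: "fs \<in> smooth_tuples (obj G) n"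
  interpret nambu_lie G N n using assms by unfold_locales simp_all
  have "(-1) ^ (n - 1) * ((-1) ^ (n - 1) * r) = r" for r :: real
    by (simp add: minus_one_power_iff)
  then show "base_bracket n G N fs x = (-1) ^ (n - 1) * bialgebroid_bracket G N fs x"
    by (simp only: base_bracket_eq[OF fs] bialgebroid_bracket_eq[OF fs])
qed

end
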